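(* Let $R$ be a field and $(E,\omega)$ a row-finite weighted graph with at least one weighted vertex (i.e. $E^0_\omega\neq\emptyset$). Then the weighted Leavitt path algebra $L_R(E,\omega)$ is graded simple (with respect to its $\mathbb Z^n$-grading) if and only if $(E,\omega)$ is reducible and $L_R(F)$ is graded simple (with respect to its $\mathbb Z$-grading), where $F$ is the unweighted graph associated with $(E,\omega)$.
   Context: A weighted graph $(E,\omega)$, $E=(E^0,E^{\mathrm{st}},E^1,s,r,\omega)$, consists of countable sets $E^0$ (vertices), $E^{\mathrm{st}}$ (structured edges), $E^1$ (edges), maps $s,r:E^{\mathrm{st}}\to E^0$ and a weight map $\omega:E^{\mathrm{st}}\to\mathbb N=\{1,2,\dots\}$ such that $E^1=\bigsqcup_{\alpha\in E^{\mathrm{st}}}\{\alpha_1,\dots,\alpha_{\omega(\alpha)}\}$. It is row-finite if $s^{-1}(v)\subseteq E^{\mathrm{st}}$ is finite for every $v\in E^0$. A vertex $v$ is a sink if $s^{-1}(v)=\emptyset$; if $v$ is not a sink, $\omega(v):=\max\{\omega(\alpha)\mid\alpha\in s^{-1}(v)\}$. Let $(E^1)^*=\{\alpha_i^*\mid\alpha_i\in E^1\}$, $X=E^0\cup E^1\cup(E^1)^*$, and let $R\langle X\rangle$ be the free (non-unital) $R$-ring on $X$: the free left $R$-module on the nonempty words over $X$ with multiplication $(\sum r_xx)(\sum s_yy)=\sum r_xs_y\,xy$. The weighted Leavitt path algebra $L_R(E,\omega)$ is the quotient of $R\langle X\rangle$ by the ideal generated by the relations: (1) $vw=\delta_{vw}v$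 for $v,w\in E^0$; (2) $s(\alpha)\alpha_i=\alpha_ir(\alpha)=\alpha_i$ and $r(\alpha)\alpha_i^*=\alpha_i^*s(\alpha)=\alpha_i^*$ for $\alpha\in E^{\mathrm{st}}$, $1\le i\le\omega(\alpha)$; (3) $\sum_{\alpha\in s^{-1}(v)}\alpha_i\alpha_j^*=\delta_{ij}v$ for every non-sink $v$ and $1\le i,j\le\omega(v)$; (4) $\sum_{1\le i\le\max\{\omega(\alpha),\omega(\beta)\}}\alpha_i^*\beta_i=\delta_{\alpha\beta}r(\alpha)$ for all $\alpha,\beta\in E^{\mathrm{st}}$; where in (3) and (4) $\alpha_i:=\alpha_i^*:=0$ whenever $i>\omega(\alpha)$. A weighted graph with $\omega\equiv1$ is called unweighted; for an unweighted graph $F$ one identifies $F^{\mathrm{st}}$ and $F^1$ and writes $L_R(F)$ for its weighted Leavitt path algebra; this is the usual Leavitt path algebra. Grading: $L_R(E,\omega)$ is $\mathbb Z^n$-graded, $n=\max\{\omega(\alpha)\mid\alpha\in E^{\mathrm{st}}\}$ (if the weights are unbounded, $\mathbb Z^n$ is read as the free abelian group with basis $e_1,e_2,\dots$), by $\deg(v)=0$ for $v\in E^0$, $\deg(\alpha_i)=e_i$, $\deg(\alpha_i^* )=-e_i$, with $e_i$ the $i$-th standard basis vector. In particular $L_R(F)$ is $\mathbb Z$-graded for $F$ unweighted. A graded ring is graded simple if it is nonzero and its only graded two-sided ideals are $\{0\}$ and itself. A path is either a single vertex or a word $x_1\cdots x_n$ ($n\ge1$) with $x_i\in E^1$ and $r(x_i)=s(x_{i+1})$,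 where $s(\alpha_i)=s(\alpha)$, $r(\alpha_i)=r(\alpha)$. For $u\in E^0$, $T(u)$ is the set of vertices $v$ such that there is a path from $u$ to $v$ (so $u\in T(u)$). A vertex $v$ is weighted if it is not a sink and $\omega(v)>1$; $E^0_\omega$ is the set of weighted vertices, and the weight forest is $\overline{E^0_\omega}=\bigcup_{v\in E^0_\omega}T(v)$. A weighted graph with $E^0_\omega\ne\emptyset$ is reducible if $|s^{-1}(v)|\le1$ and $|r^{-1}(v)\cap s^{-1}(\overline{E^0_\omega})|\le1$ for every $v\in\overline{E^0_\omega}$, and irreducible otherwise. The unweighted graph $F$ associated with $(E,\omega)$: $F^0=E^0$, $F^1=\{e_{\alpha_i}\mid\alpha_i\in E^1\}$, with $s(e_{\alpha_i})=s(\alpha)$, $r(e_{\alpha_i})=r(\alpha)$ if $s(\alpha)\notin\overline{E^0_\omega}$, and $s(e_{\alpha_i})=r(\alpha)$, $r(e_{\alpha_i})=s(\alpha)$ if $s(\alpha)\in\overline{E^0_\omega}$. *)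

theory Defs
  imports
    "HOL-Library.Countable_Set"
    "HOL-Library.Poly_Mapping"
    "HOL-Algebra.QuotRing"
    "Graph_Theory.Arc_Walk"
begin

section \<open>Weighted graphs\<close>

text \<open>
  A weighted graph is a digraph \<open>E\<close>, whose arcs are the structured edges, together with a weight
  map \<open>\<omega>\<close>. The edge \<open>\<alpha>\<^sub>i\<close> is represented by the pair \<open>(\<alpha>, i)\<close>.
\<close>

locale weighted_graph = wf_digraph E for E :: "('v, 'e) pre_digraph" +
  fixes \<omega> :: "'e \<Rightarrow> nat"
  assumes countable_verts: "countable (verts E)"
    and countable_arcs: "countable (arcs E)"
    and weight_pos: "\<alpha> \<in> arcs E \<Longrightarrow> 1 \<le> \<omega> \<alpha>"

definition edges :: "('v, 'e) pre_digraph \<Rightarrow> ('e \<Rightarrow> nat) \<Rightarrow> ('e \<times> nat) set" where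
  "edges E \<omega> = (SIGMA \<alpha>:arcs E. {1..\<omega> \<alpha>})"

definition row_finite :: "('v, 'e) pre_digraph \<Rightarrow> bool" where
  "row_finite E \<longleftrightarrow> (\<forall>v\<in>verts E. finite (out_arcs E v))"

definition sink :: "('v, 'e) pre_digraph \<Rightarrow> 'v \<Rightarrow> bool" where
  "sink E v \<longleftrightarrow> out_arcs E v = {}"

definition vertex_weight :: "('v, 'e) pre_digraph \<Rightarrow> ('e \<Rightarrow> nat) \<Rightarrow> 'v \<Rightarrow> nat" where
  "vertex_weight E \<omega> v = Max (\<omega> ` out_arcs E v)"

definition weighted_vertices :: "('v, 'e) pre_digraph \<Rightarrow> ('e \<Rightarrow> nat) \<Rightarrow> 'v set" where
  "weighted_vertices E \<omega> = {v \<in> verts E. \<not> sink E v \<and> vertex_weight E \<omega> v > 1}"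

definition edge_graph :: "('v, 'e) pre_digraph \<Rightarrow> ('e \<Rightarrow> nat) \<Rightarrow> ('v, 'e \<times> nat) pre_digraph" where
  "edge_graph E \<omega> = \<lparr>verts = verts E, arcs = edges E \<omega>, tail = tail E \<circ> fst, head = head E \<circ> fst\<rparr>"

text \<open>Paths are words in the edges \<open>\<alpha>\<^sub>i\<close>, that is, walks in \<^const>\<open>edge_graph\<close>.\<close>

definition tree :: "('v, 'e) pre_digraph \<Rightarrow> ('e \<Rightarrow> nat) \<Rightarrow> 'v \<Rightarrow> 'v set" where
  "tree E \<omega> u = {v. \<exists>p. pre_digraph.awalk (edge_graph E \<omega>) u p v}"

definition weight_forest :: "('v, 'e) pre_digraph \<Rightarrow> ('e \<Rightarrow> nat) \<Rightarrow> 'v set" where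
  "weight_forest E \<omega> = (\<Union>v\<in>weighted_vertices E \<omega>. tree E \<omega> v)"

text \<open>Finiteness is stated explicitly because \<^const>\<open>card\<close> of an infinite set is \<open>0\<close>.\<close>

definition reducible :: "('v, 'e) pre_digraph \<Rightarrow> ('e \<Rightarrow> nat) \<Rightarrow> bool" where
  "reducible E \<omega> \<longleftrightarrow>
    (\<forall>v\<in>weight_forest E \<omega>.
      (finite (out_arcs E v) \<and> card (out_arcs E v) \<le> 1) \<and>
      (let B = {\<alpha> \<in> in_arcs E v. tail E \<alpha> \<in> weight_forest E \<omega>} in finite B \<and> card B \<le> 1))"

text \<open>The associated graph is unweighted, i.e. it is to be used with the weight map \<open>\<lambda>_. 1\<close>.\<close>

definition assoc_graph :: "('v, 'e) pre_digraph \<Rightarrow> ('e \<Rightarrow> nat) \<Rightarrow> ('v, 'e \<times> nat) pre_digraph" where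
  "assoc_graph E \<omega> =
    \<lparr>verts = verts E,
     arcs = edges E \<omega>,
     tail = (\<lambda>(\<alpha>, i). if tail E \<alpha> \<in> weight_forest E \<omega> then head E \<alpha> else tail E \<alpha>),
     head = (\<lambda>(\<alpha>, i). if tail E \<alpha> \<in> weight_forest E \<omega> then tail E \<alpha> else head E \<alpha>)\<rparr>"

lemma weighted_graph_assoc_graph:
  assumes "weighted_graph E \<omega>"
  shows "weighted_graph (assoc_graph E \<omega>) (\<lambda>_. 1)"
proof -
  interpret weighted_graph E \<omega> by fact
  show ?thesis
    by unfold_locales
      (auto simp: assoc_graph_def edges_def countable_verts countable_arcs)
qed


section \<open>Free non-unital rings\<close>

text \<open>
  Lists form a monoid under concatenation, so the type \<open>'x list \<Rightarrow>\<^sub>0 'k\<close> of finitely supported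
  functions on words is the free unital algebra on \<open>'x\<close>, with convolution as multiplication.
\<close>

instantiation list :: (type) monoid_add
begin

definition zero_list :: "'a list" where "zero_list = []"

definition plus_list :: "'a list \<Rightarrow> 'a list \<Rightarrow> 'a list" where "plus_list xs ys = xs @ ys"

instance by standard (simp_all add: zero_list_def plus_list_def)

end

text \<open>
  The free non-unital ring on \<open>X\<close> and its quotients are records of type \<^typ>\<open>'a ring\<close> with no
  meaningful \<open>one\<close> field.
\<close>

definition free_rng :: "'k::field itself \<Rightarrow> 'x set \<Rightarrow> ('x list \<Rightarrow>\<^sub>0 'k) ring" where
  "free_rng _ X =
    \<lparr>carrier = {f. Poly_Mapping.keys f \<subseteq> lists X - {[]}},
     mult = (*), one = undefined, zero = 0, add = (+)\<rparr>"

definition rng_ideal :: "'a set \<Rightarrow> 'a ring \<Rightarrow> bool" where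
  "rng_ideal I A \<longleftrightarrow> additive_subgroup I A \<and>
    (\<forall>x\<in>I. \<forall>a\<in>carrier A. a \<otimes>\<^bsub>A\<^esub> x \<in> I \<and> x \<otimes>\<^bsub>A\<^esub> a \<in> I)"

text \<open>
  As \<open>k\<close> does not embed into the free non-unital ring, an ideal generated by a set of relations has
  to be closed under scalar multiplication explicitly for the quotient to be an algebra over \<open>k\<close>.
\<close>

definition generated_ideal ::
    "'k::field itself \<Rightarrow> 'x set \<Rightarrow> ('x list \<Rightarrow>\<^sub>0 'k) set \<Rightarrow> ('x list \<Rightarrow>\<^sub>0 'k) set" where
  "generated_ideal K X S =
    \<Inter>{I. rng_ideal I (free_rng K X) \<and>
       (\<forall>c. \<forall>f\<in>I. Poly_Mapping.map ((*) c) f \<in> I) \<and> S \<subseteq> I}"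


section \<open>Weighted Leavitt path algebras\<close>

datatype ('v, 'e) letter = Vertex 'v | Edge 'e nat | Ghost 'e nat

type_synonym ('v, 'e, 'k) words_alg = "('v, 'e) letter list \<Rightarrow>\<^sub>0 'k"

definition letters :: "('v, 'e) pre_digraph \<Rightarrow> ('e \<Rightarrow> nat) \<Rightarrow> ('v, 'e) letter set" where
  "letters E \<omega> =
    Vertex ` verts E \<union> case_prod Edge ` edges E \<omega> \<union> case_prod Ghost ` edges E \<omega>"

definition vtx :: "'v \<Rightarrow> ('v, 'e, 'k::field) words_alg" where
  "vtx v = Poly_Mapping.single [Vertex v] 1"

definition edg :: "('e \<Rightarrow> nat) \<Rightarrow> 'e \<Rightarrow> nat \<Rightarrow> ('v, 'e, 'k::field) words_alg" where
  "edg \<omega> \<alpha> i = (if i \<le> \<omega> \<alpha> then Poly_Mapping.single [Edge \<alpha> i] 1 else 0)"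

definition gst :: "('e \<Rightarrow> nat) \<Rightarrow> 'e \<Rightarrow> nat \<Rightarrow> ('v, 'e, 'k::field) words_alg" where
  "gst \<omega> \<alpha> i = (if i \<le> \<omega> \<alpha> then Poly_Mapping.single [Ghost \<alpha> i] 1 else 0)"

text \<open>
  A relation \<open>l = r\<close> is represented by \<open>l - r\<close>. The finiteness condition on \<^term>\<open>out_arcs E v\<close>
  always holds for row-finite graphs; for other graphs it gives the usual convention that no relation
  is imposed at infinite emitters.
\<close>

definition relations ::
    "'k::field itself \<Rightarrow> ('v, 'e) pre_digraph \<Rightarrow> ('e \<Rightarrow> nat) \<Rightarrow> ('v, 'e, 'k) words_alg set" where
  "relations _ E \<omega> =
    {vtx v * vtx w - (if v = w then vtx v else 0) | v w. v \<in> verts E \<and> w \<in> verts E} \<union>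
    {vtx (tail E \<alpha>) * edg \<omega> \<alpha> i - edg \<omega> \<alpha> i | \<alpha> i. (\<alpha>, i) \<in> edges E \<omega>} \<union>
    {edg \<omega> \<alpha> i * vtx (head E \<alpha>) - edg \<omega> \<alpha> i | \<alpha> i. (\<alpha>, i) \<in> edges E \<omega>} \<union>
    {vtx (head E \<alpha>) * gst \<omega> \<alpha> i - gst \<omega> \<alpha> i | \<alpha> i. (\<alpha>, i) \<in> edges E \<omega>} \<union>
    {gst \<omega> \<alpha> i * vtx (tail E \<alpha>) - gst \<omega> \<alpha> i | \<alpha> i. (\<alpha>, i) \<in> edges E \<omega>} \<union>
    {(\<Sum>\<alpha>\<in>out_arcs E v. edg \<omega> \<alpha> i * gst \<omega> \<alpha> j) - (if i = j then vtx v else 0) | v i j.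
      v \<in> verts E \<and> \<not> sink E v \<and> finite (out_arcs E v) \<and>
      i \<in> {1..vertex_weight E \<omega> v} \<and> j \<in> {1..vertex_weight E \<omega> v}} \<union>
    {(\<Sum>i=1..max (\<omega> \<alpha>) (\<omega> \<beta>). gst \<omega> \<alpha> i * edg \<omega> \<beta> i) - (if \<alpha> = \<beta> then vtx (head E \<alpha>) else 0) | \<alpha> \<beta>.
      \<alpha> \<in> arcs E \<and> \<beta> \<in> arcs E}"

definition wlpa_ideal ::
    "'k::field itself \<Rightarrow> ('v, 'e) pre_digraph \<Rightarrow> ('e \<Rightarrow> nat) \<Rightarrow> ('v, 'e, 'k) words_alg set" where
  "wlpa_ideal K E \<omega> = generated_ideal K (letters E \<omega>) (relations K E \<omega>)"

definition wlpa ::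
    "'k::field itself \<Rightarrow> ('v, 'e) pre_digraph \<Rightarrow> ('e \<Rightarrow> nat) \<Rightarrow> ('v, 'e, 'k) words_alg set ring" where
  "wlpa K E \<omega> = free_rng K (letters E \<omega>) Quot wlpa_ideal K E \<omega>"


section \<open>Gradings\<close>

definition graded_ideal :: "'g set \<Rightarrow> ('g \<Rightarrow> 'a set) \<Rightarrow> 'a set \<Rightarrow> 'a ring \<Rightarrow> bool" where
  "graded_ideal \<Gamma> H I A \<longleftrightarrow> rng_ideal I A \<and>
    (\<forall>x\<in>I. \<exists>S c. finite S \<and> S \<subseteq> \<Gamma> \<and> (\<forall>g\<in>S. c g \<in> H g \<inter> I) \<and> x = finsum A c S)"

text \<open>Here \<open>A\<close> is graded by the group \<open>\<Gamma>\<close>, with homogeneous components \<open>H g\<close>.\<close>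

definition graded_simple :: "'g set \<Rightarrow> ('g \<Rightarrow> 'a set) \<Rightarrow> 'a ring \<Rightarrow> bool" where
  "graded_simple \<Gamma> H A \<longleftrightarrow> carrier A \<noteq> {\<zero>\<^bsub>A\<^esub>} \<and>
    (\<forall>I. graded_ideal \<Gamma> H I A \<longrightarrow> I = {\<zero>\<^bsub>A\<^esub>} \<or> I = carrier A)"

text \<open>
  The free abelian group with basis \<open>e\<^sub>1, \<dots>, e\<^sub>n\<close>, where \<open>n\<close> is the maximal weight, or with basis
  \<open>e\<^sub>1, e\<^sub>2, \<dots>\<close> if the weights are unbounded.
\<close>

definition degree_group :: "('v, 'e) pre_digraph \<Rightarrow> ('e \<Rightarrow> nat) \<Rightarrow> (nat \<Rightarrow>\<^sub>0 int) set" where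
  "degree_group E \<omega> = {d. Poly_Mapping.keys d \<subseteq> (\<Union>\<alpha>\<in>arcs E. {1..\<omega> \<alpha>})}"

primrec letter_deg :: "('v, 'e) letter \<Rightarrow> nat \<Rightarrow>\<^sub>0 int" where
  "letter_deg (Vertex v) = 0"
| "letter_deg (Edge \<alpha> i) = Poly_Mapping.single i 1"
| "letter_deg (Ghost \<alpha> i) = - Poly_Mapping.single i 1"

definition word_deg :: "('v, 'e) letter list \<Rightarrow> nat \<Rightarrow>\<^sub>0 int" where
  "word_deg w = sum_list (map letter_deg w)"

definition wlpa_component ::
    "'k::field itself \<Rightarrow> ('v, 'e) pre_digraph \<Rightarrow> ('e \<Rightarrow> nat) \<Rightarrow> (nat \<Rightarrow>\<^sub>0 int)
      \<Rightarrow> ('v, 'e, 'k) words_alg set set" where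
  "wlpa_component K E \<omega> d =
    {wlpa_ideal K E \<omega> +>\<^bsub>free_rng K (letters E \<omega>)\<^esub> f | f.
      f \<in> carrier (free_rng K (letters E \<omega>)) \<and> (\<forall>w\<in>Poly_Mapping.keys f. word_deg w = d)}"

end

theory Submission
  imports Defs
begin

text \<open>
  Simplicity implies reducibility: an action of the algebra on a vector space by partial injections of
  a basis is a choice, at every vertex \<open>u\<close> that is not a sink, of a bijection between copies of the
  basis indexed by \<open>out_arcs E u\<close> and by \<open>{1..vertex_weight E \<omega> u}\<close>. The choices at different
  vertices are independent of each other. If the graph is irreducible, there is a word, made of a walk
  that starts at a weighted vertex and of either one further edge or the ghost of a second such walk,
  which is zero or not depending on the choice at a single vertex. The largest graded ideal in the
  kernel of the action that kills the word is then neither zero nor everything.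

  Conversely, if the graph is reducible, exchanging edges and ghosts inside the weight forest turns
  the relations of \<open>(E, \<omega>)\<close> into those of \<open>F\<close>, so both algebras are isomorphic, but with different
  gradings. For each of the gradings, no closed path of \<open>F\<close> has degree zero. Hence every nonzero graded
  ideal contains a vertex, and graded simplicity only depends on the ideals generated by vertices,
  which the isomorphism preserves.
\<close>

section \<open>Ideals of free algebras\<close>

text \<open>Every fibre of the action is a copy of the natural numbers, so both sides of a choice
  are countably infinite, whatever the number of arcs and the weights; the only constraint is that
  \<open>\<alpha>\<close> has no more than \<open>\<omega> \<alpha>\<close> edges. Hence a choice
  can be made with almost any prescribed image, provided that the sets involved and their
  complements are infinite. A weighted vertex supplies the complement: the words use edges of index
  1 only, and index 2 leaves room. Walks are taken as short as possible so that exactly one letter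
  of the word comes from an arc at the vertex whose choice is varied. In the converse, the usual
  reduction of a homogeneous element to a vertex relies on closed paths having positive degree. The
  grading carried over from \<open>(E, \<omega>)\<close> makes some edges of \<open>F\<close>
  negative, so the reduction is proved for any degree of letters that does not vanish on closed
  paths. All computations are congruences \<open>f - g \<in> I\<close> in the free ring, without a
  normal form or a basis of the algebra.\<close>

abbreviation mon :: "'x list \<Rightarrow> ('x list \<Rightarrow>\<^sub>0 'k::field)" where
  "mon w \<equiv> Poly_Mapping.single w 1"

definition word_span :: "'x set \<Rightarrow> ('x list \<Rightarrow>\<^sub>0 'k::field) set" where
  "word_span X = {f. Poly_Mapping.keys f \<subseteq> lists X - {[]}}"

text \<open>Serves as extension by linearity: an identity is proved with \<open>f\<close> replaced
  by the left-hand side, where only monomials have to be evaluated, and is then folded back.\<close>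

lemma sum_monomials: "(\<Sum>w\<in>Poly_Mapping.keys f. Poly_Mapping.single w (poly_mapping.lookup f w)) = f"
  by (rule poly_mapping_eqI)
    (simp add: lookup_sum lookup_single when_def sum.delta in_keys_iff)

lemma single_conv_scale: "Poly_Mapping.single w (c::'k::field) = Poly_Mapping.single [] c * mon w"
  by (simp add: mult_single plus_list_def)

lemma scale_commute:
  "Poly_Mapping.single [] c * f = f * Poly_Mapping.single [] (c::'k::field)"
proof -
  have "Poly_Mapping.single [] c * (\<Sum>w\<in>Poly_Mapping.keys f. Poly_Mapping.single w (poly_mapping.lookup f w))
      = (\<Sum>w\<in>Poly_Mapping.keys f. Poly_Mapping.single w (poly_mapping.lookup f w)) * Poly_Mapping.single [] c"
    by (simp add: sum_distrib_left sum_distrib_right mult_single plus_list_def mult.commute)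
  then show ?thesis
    by (simp add: sum_monomials)
qed

lemma scale_eq_mult: "Poly_Mapping.map ((*) c) f = Poly_Mapping.single [] (c::'k::field) * f"
  by (simp add: mult_map_scale_conv_mult zero_list_def)

lemma lookup_scale: "poly_mapping.lookup (Poly_Mapping.single [] (c::'k::field) * f) w = c * poly_mapping.lookup f w"
  by (subst scale_eq_mult[symmetric]) (simp add: map.rep_eq when_def)

lemma scale_one: "Poly_Mapping.single [] (1::'k::field) * f = f"
  by (rule poly_mapping_eqI) (simp add: lookup_scale)

lemma mon_mult: "mon u * mon w = (mon (u @ w) :: 'x list \<Rightarrow>\<^sub>0 'k::field)"
  by (simp add: mult_single plus_list_def)

lemma word_span_0 [simp]: "0 \<in> word_span X"
  by (simp add: word_span_def)

lemma word_span_add: "f \<in> word_span X \<Longrightarrow> g \<in> word_span X \<Longrightarrow> f + g \<in> word_span X"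
  using keys_add[of f g] by (auto simp: word_span_def)

lemma word_span_scale:
  "f \<in> word_span X \<Longrightarrow> Poly_Mapping.single [] (c::'k::field) * f \<in> word_span X"
  by (auto simp: word_span_def in_keys_iff lookup_scale)

lemma word_span_uminus: "f \<in> word_span X \<Longrightarrow> - f \<in> word_span X"
  by (simp add: word_span_def)

lemma word_span_diff: "f \<in> word_span X \<Longrightarrow> g \<in> word_span X \<Longrightarrow> f - g \<in> word_span X"
  using word_span_add[OF _ word_span_uminus, of f X g] by simp

lemma word_span_sum: "(\<And>i. i \<in> A \<Longrightarrow> f i \<in> word_span X) \<Longrightarrow> sum f A \<in> word_span X"
  by (induction A rule: infinite_finite_induct) (auto intro: word_span_add)

lemma word_span_single: "w \<in> lists X \<Longrightarrow> w \<noteq> [] \<Longrightarrow> Poly_Mapping.single w c \<in> word_span X"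
  by (simp add: word_span_def)

lemma word_span_mult: "f \<in> word_span X \<Longrightarrow> g \<in> word_span X \<Longrightarrow> f * g \<in> word_span X"
  using keys_mult[of f g] by (fastforce simp: word_span_def plus_list_def)

text \<open>Only letters and scalars are required to act, so that the condition can be checked one
  letter at a time; closure under the whole free ring is derived. A scalar \<open>c\<close> is the
  element \<open>Poly_Mapping.single [] c\<close>, which for \<open>c \<noteq> 0\<close> lies
  outside the non-unital ring, hence the separate clause.\<close>

definition alg_ideal :: "'x set \<Rightarrow> ('x list \<Rightarrow>\<^sub>0 'k::field) set \<Rightarrow> bool" where
  "alg_ideal X I \<longleftrightarrow> I \<subseteq> word_span X \<and> 0 \<in> I \<and> (\<forall>f\<in>I. \<forall>g\<in>I. f + g \<in> I) \<and>
    (\<forall>c. \<forall>f\<in>I. Poly_Mapping.single [] c * f \<in> I) \<and>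
    (\<forall>x\<in>X. \<forall>f\<in>I. mon [x] * f \<in> I \<and> f * mon [x] \<in> I)"

lemma alg_idealI:
  assumes "I \<subseteq> word_span X" "0 \<in> I" "\<And>f g. f \<in> I \<Longrightarrow> g \<in> I \<Longrightarrow> f + g \<in> I"
    "\<And>c f. f \<in> I \<Longrightarrow> Poly_Mapping.single [] c * f \<in> I"
    "\<And>x f. x \<in> X \<Longrightarrow> f \<in> I \<Longrightarrow> mon [x] * f \<in> I"
    "\<And>x f. x \<in> X \<Longrightarrow> f \<in> I \<Longrightarrow> f * mon [x] \<in> I"
  shows "alg_ideal X I"
  using assms by (auto simp: alg_ideal_def)

context
  fixes X :: "'x set" and I :: "('x list \<Rightarrow>\<^sub>0 'k::field) set"
  assumes I: "alg_ideal X I"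
begin

lemma alg_ideal_subset: "f \<in> I \<Longrightarrow> f \<in> word_span X"
  using I by (auto simp: alg_ideal_def)

lemma alg_ideal_0: "0 \<in> I"
  using I by (auto simp: alg_ideal_def)

lemma alg_ideal_add: "f \<in> I \<Longrightarrow> g \<in> I \<Longrightarrow> f + g \<in> I"
  using I by (auto simp: alg_ideal_def)

lemma alg_ideal_scale: "f \<in> I \<Longrightarrow> Poly_Mapping.single [] c * f \<in> I"
  using I by (auto simp: alg_ideal_def)

lemma alg_ideal_uminus: "f \<in> I \<Longrightarrow> - f \<in> I"
  using alg_ideal_scale[of f "-1"] scale_one[of f] by (simp add: single_uminus)

lemma alg_ideal_diff: "f \<in> I \<Longrightarrow> g \<in> I \<Longrightarrow> f - g \<in> I"
  using alg_ideal_add[OF _ alg_ideal_uminus, of f g] by simp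

lemma alg_ideal_sum: "(\<And>i. i \<in> A \<Longrightarrow> f i \<in> I) \<Longrightarrow> sum f A \<in> I"
  by (induction A rule: infinite_finite_induct) (auto intro: alg_ideal_add alg_ideal_0)

lemma alg_ideal_mon_left: "w \<in> lists X \<Longrightarrow> f \<in> I \<Longrightarrow> mon w * f \<in> I"
proof (induction w)
  case Nil
  then show ?case by (simp add: scale_one)
next
  case (Cons x w)
  then have "mon [x] * (mon w * f) \<in> I"
    using I by (auto simp: alg_ideal_def)
  then show ?case
    by (simp add: mult.assoc[symmetric] mon_mult)
qed

lemma alg_ideal_mon_right: "w \<in> lists X \<Longrightarrow> f \<in> I \<Longrightarrow> f * mon w \<in> I"
proof (induction w arbitrary: f)
  case Nil
  then show ?case by (simp add: scale_one flip: scale_commute)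
next
  case (Cons x w)
  then have "f * mon [x] * mon w \<in> I"
    using I by (auto simp: alg_ideal_def)
  then show ?case
    by (simp add: mult.assoc mon_mult)
qed

lemma alg_ideal_mult_left:
  assumes "a \<in> word_span X" "f \<in> I"
  shows "a * f \<in> I"
proof -
  have "(\<Sum>w\<in>Poly_Mapping.keys a. Poly_Mapping.single w (poly_mapping.lookup a w)) * f \<in> I"
    unfolding sum_distrib_right
    by (rule alg_ideal_sum, subst single_conv_scale, subst mult.assoc,
        rule alg_ideal_scale, rule alg_ideal_mon_left)
      (use assms in \<open>auto simp: word_span_def\<close>)
  then show ?thesis
    by (simp add: sum_monomials)
qed

lemma alg_ideal_mult_right:
  assumes "a \<in> word_span X" "f \<in> I"
  shows "f * a \<in> I"
proof -
  have "f * (\<Sum>w\<in>Poly_Mapping.keys a. Poly_Mapping.single w (poly_mapping.lookup a w)) \<in> I"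
    unfolding sum_distrib_left
    by (rule alg_ideal_sum, subst single_conv_scale, subst scale_commute,
        subst mult.assoc[symmetric], subst scale_commute[symmetric],
        rule alg_ideal_scale, rule alg_ideal_mon_right)
      (use assms in \<open>auto simp: word_span_def\<close>)
  then show ?thesis
    by (simp add: sum_monomials)
qed

end

lemma carrier_free_rng: "carrier (free_rng (K::'k::field itself) X) = word_span X"
  by (simp add: free_rng_def word_span_def)

lemma free_rng_simps:
  "f \<oplus>\<^bsub>free_rng K X\<^esub> g = f + g" "f \<otimes>\<^bsub>free_rng K X\<^esub> g = f * g" "\<zero>\<^bsub>free_rng K X\<^esub> = 0"
  by (simp_all add: free_rng_def)

lemma abelian_group_free_rng: "abelian_group (free_rng (K::'k::field itself) X)"
proof (rule abelian_groupI)
  fix f :: "'a list \<Rightarrow>\<^sub>0 'k" assume "f \<in> carrier (free_rng K X)"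
  then have "- f \<in> carrier (free_rng K X)"
    by (simp add: carrier_free_rng word_span_uminus)
  then show "\<exists>g\<in>carrier (free_rng K X). g \<oplus>\<^bsub>free_rng K X\<^esub> f = \<zero>\<^bsub>free_rng K X\<^esub>"
    by (intro bexI[of _ "- f"]) (simp_all add: free_rng_def)
qed (auto simp: carrier_free_rng free_rng_simps ac_simps intro: word_span_add)

lemma free_rng_a_inv:
  assumes "f \<in> word_span X"
  shows "inv\<^bsub>add_monoid (free_rng (K::'k::field itself) X)\<^esub> f = - f"
proof -
  interpret abelian_group "free_rng K X" by (rule abelian_group_free_rng)
  have "\<ominus>\<^bsub>free_rng K X\<^esub> f = - f"
    by (rule minus_equality)
      (use assms in \<open>simp_all add: carrier_free_rng word_span_uminus, simp_all add: free_rng_def\<close>)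
  then show ?thesis by (simp add: a_inv_def)
qed

text \<open>Every element of the free ring is a linear combination of words, so stability under
  letters and scalars amounts to being an ideal of the ring that is also a subspace.\<close>

lemma alg_ideal_iff:
  "alg_ideal X I \<longleftrightarrow> rng_ideal I (free_rng (K::'k::field itself) X) \<and>
     (\<forall>c. \<forall>f\<in>I. Poly_Mapping.map ((*) c) f \<in> I)" (is "?L \<longleftrightarrow> ?R")
proof
  assume L: ?L
  have "subgroup I (add_monoid (free_rng K X))"
  proof (rule subgroup.intro)
    show "I \<subseteq> carrier (add_monoid (free_rng K X))"
      using L by (auto simp: alg_ideal_subset carrier_free_rng)
    fix f g assume fg: "f \<in> I"
    show "inv\<^bsub>add_monoid (free_rng K X)\<^esub> f \<in> I"
      using free_rng_a_inv[OF alg_ideal_subset[OF L fg], of K] alg_ideal_uminus[OF L fg]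
      by (simp only:)
    assume g: "g \<in> I"
    show "f \<otimes>\<^bsub>add_monoid (free_rng K X)\<^esub> g \<in> I"
      using fg g L by (simp add: free_rng_def alg_ideal_add)
  qed (use L in \<open>simp add: free_rng_def alg_ideal_0\<close>)
  moreover have "a \<otimes>\<^bsub>free_rng K X\<^esub> x \<in> I \<and> x \<otimes>\<^bsub>free_rng K X\<^esub> a \<in> I"
    if "x \<in> I" "a \<in> carrier (free_rng K X)" for a x
    using L alg_ideal_mult_left[OF L _ that(1)] alg_ideal_mult_right[OF L _ that(1)] that(2)
    by (simp add: carrier_free_rng) (simp add: free_rng_def)
  ultimately show ?R
    using L by (simp add: rng_ideal_def additive_subgroup_def scale_eq_mult alg_ideal_scale)
next
  assume R: ?R
  then have sub: "subgroup I (add_monoid (free_rng K X))"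
    by (simp add: rng_ideal_def additive_subgroup_def)
  have letter: "mon [x] \<in> carrier (free_rng K X)" if "x \<in> X" for x
    using that by (simp add: carrier_free_rng word_span_single)
  show ?L
  proof (rule alg_idealI)
    show "I \<subseteq> word_span X"
      using subgroup.subset[OF sub] by (simp add: carrier_free_rng)
    show "0 \<in> I"
      using subgroup.one_closed[OF sub] by (simp add: free_rng_def)
    show "f + g \<in> I" if "f \<in> I" "g \<in> I" for f g
      using subgroup.m_closed[OF sub that] by (simp add: free_rng_def)
    show "Poly_Mapping.single [] c * f \<in> I" if "f \<in> I" for c f
      using R that by (simp add: scale_eq_mult)
    have *: "mon [x] \<otimes>\<^bsub>free_rng K X\<^esub> f \<in> I \<and> f \<otimes>\<^bsub>free_rng K X\<^esub> mon [x] \<in> I"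
      if "x \<in> X" "f \<in> I" for x f
      using R letter that unfolding rng_ideal_def by blast
    show "mon [x] * f \<in> I" "f * mon [x] \<in> I" if "x \<in> X" "f \<in> I" for x f
      using *[OF that] by (simp_all add: free_rng_def)
  qed
qed

lemma generated_ideal_eq: "generated_ideal K X S = \<Inter>{I. alg_ideal X I \<and> S \<subseteq> I}"
  unfolding generated_ideal_def by (subst alg_ideal_iff[where K = K]) (simp add: conj_assoc)

lemma alg_ideal_word_span: "alg_ideal X (word_span X)"
  by (rule alg_idealI) (simp_all add: word_span_add word_span_scale word_span_mult word_span_single)

lemma generated_ideal_mono: "S \<subseteq> T \<Longrightarrow> generated_ideal K X S \<subseteq> generated_ideal K X T"
  by (auto simp: generated_ideal_eq)

lemma generated_ideal_minimal: "alg_ideal X I \<Longrightarrow> S \<subseteq> I \<Longrightarrow> generated_ideal K X S \<subseteq> I"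
  by (auto simp: generated_ideal_eq)

lemma generated_ideal_base: "S \<subseteq> generated_ideal K X S"
  by (auto simp: generated_ideal_eq)

text \<open>The hypothesis keeps the family of ideals in the intersection nonempty, as it then
  contains \<open>word_span X\<close>; otherwise the intersection would be the universal
  set.\<close>

lemma alg_ideal_generated:
  assumes "S \<subseteq> word_span X"
  shows "alg_ideal X (generated_ideal K X S)"
proof (rule alg_idealI)
  show "generated_ideal K X S \<subseteq> word_span X"
    using assms alg_ideal_word_span by (rule generated_ideal_minimal[rotated])
qed (auto simp: generated_ideal_eq alg_ideal_def)


section \<open>Graded ideals and quotients\<close>

definition hom_comp :: "('w \<Rightarrow> 'g) \<Rightarrow> 'g \<Rightarrow> ('w \<Rightarrow>\<^sub>0 'k::zero) \<Rightarrow> ('w \<Rightarrow>\<^sub>0 'k)" where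
  "hom_comp deg g = Poly_Mapping.mapp (\<lambda>w c. c when deg w = g)"

lemma lookup_hom_comp:
  "poly_mapping.lookup (hom_comp deg g f) w = (poly_mapping.lookup f w when deg w = g)"
  by (simp add: hom_comp_def lookup_mapp when_def in_keys_iff)

lemma keys_hom_comp: "Poly_Mapping.keys (hom_comp deg g f) = {w \<in> Poly_Mapping.keys f. deg w = g}"
  by (auto simp: in_keys_iff lookup_hom_comp)

lemma hom_comp_0 [simp]: "hom_comp deg g 0 = 0"
  by (rule poly_mapping_eqI) (simp add: lookup_hom_comp)

lemma hom_comp_add:
  "hom_comp deg g (p + q) = hom_comp deg g p + hom_comp deg g (q :: _ \<Rightarrow>\<^sub>0 'k::monoid_add)"
  by (rule poly_mapping_eqI) (simp add: lookup_hom_comp lookup_add when_add_distrib)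

lemma hom_comp_sum:
  "hom_comp deg g (sum f A) = (\<Sum>i\<in>A. hom_comp deg g (f i :: _ \<Rightarrow>\<^sub>0 'k::comm_monoid_add))"
  by (induction A rule: infinite_finite_induct) (simp_all add: hom_comp_add)

lemma hom_comp_scale:
  "hom_comp deg g (Poly_Mapping.single [] c * f) = Poly_Mapping.single [] (c::'k::field) * hom_comp deg g f"
  by (rule poly_mapping_eqI) (simp add: lookup_hom_comp lookup_scale when_def)

lemma hom_comp_homogeneous:
  assumes "\<forall>w\<in>Poly_Mapping.keys f. deg w = d"
  shows "hom_comp deg g f = (f when d = g)"
  by (rule poly_mapping_eqI) (use assms in \<open>auto simp: lookup_hom_comp when_def in_keys_iff\<close>)

lemma hom_comp_single:
  "hom_comp deg g (Poly_Mapping.single w c) = (Poly_Mapping.single w c when deg w = g)"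
  by (rule hom_comp_homogeneous) (auto split: if_splits)

lemma sum_hom_comp:
  fixes f :: "'w \<Rightarrow>\<^sub>0 'k::comm_monoid_add"
  assumes "finite S" "deg ` Poly_Mapping.keys f \<subseteq> S"
  shows "(\<Sum>g\<in>S. hom_comp deg g f) = f"
proof (rule poly_mapping_eqI)
  fix w
  have "poly_mapping.lookup (\<Sum>g\<in>S. hom_comp deg g f) w
      = (\<Sum>g\<in>S. if g = deg w then poly_mapping.lookup f w else 0)"
    by (simp add: lookup_sum lookup_hom_comp when_def eq_commute)
  also have "\<dots> = poly_mapping.lookup f w"
    using assms by (auto simp: in_keys_iff image_subset_iff)
  finally show "poly_mapping.lookup (\<Sum>g\<in>S. hom_comp deg g f) w = poly_mapping.lookup f w" .
qed

text \<open>Gradedness seen in the free ring, where the components of an element are explicit. For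
  ideals that contain \<open>W\<close> it is matched with \<open>graded_ideal\<close> in the
  quotient by \<open>graded_simple_Quot_iff\<close>.\<close>

definition hom_closed :: "('x list \<Rightarrow> 'g) \<Rightarrow> ('x list \<Rightarrow>\<^sub>0 'k::zero) set \<Rightarrow> bool" where
  "hom_closed deg I \<longleftrightarrow> (\<forall>f\<in>I. \<forall>g. hom_comp deg g f \<in> I)"

lemma hom_comp_word_span: "f \<in> word_span X \<Longrightarrow> hom_comp deg g f \<in> word_span X"
  by (auto simp: word_span_def keys_hom_comp)

locale quotient_rng =
  fixes K :: "'k::field itself" and X :: "'x set" and W :: "('x list \<Rightarrow>\<^sub>0 'k) set"
  assumes W: "alg_ideal X W"
begin

definition cls :: "('x list \<Rightarrow>\<^sub>0 'k) \<Rightarrow> ('x list \<Rightarrow>\<^sub>0 'k) set" where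
  "cls f = W +>\<^bsub>free_rng K X\<^esub> f"

abbreviation Q :: "('x list \<Rightarrow>\<^sub>0 'k) set ring" where
  "Q \<equiv> free_rng K X Quot W"

lemma cls_eq: "cls f = (\<lambda>w. w + f) ` W"
  by (auto simp: cls_def a_r_coset_def r_coset_def free_rng_def)

lemma cls_eq_iff: "cls f = cls g \<longleftrightarrow> f - g \<in> W"
proof
  assume "cls f = cls g"
  moreover have "f \<in> cls f"
    using alg_ideal_0[OF W] by (force simp: cls_eq)
  ultimately obtain w where "w \<in> W" "f = w + g"
    by (auto simp: cls_eq)
  then show "f - g \<in> W" by simp
next
  assume *: "f - g \<in> W"
  have "w + f \<in> cls g" if "w \<in> W" for w
    using alg_ideal_add[OF W that *] by (force simp: cls_eq image_iff algebra_simps)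
  moreover have "w + g \<in> cls f" if "w \<in> W" for w
    using alg_ideal_diff[OF W that *] by (force simp: cls_eq image_iff algebra_simps)
  ultimately show "cls f = cls g"
    by (auto simp: cls_eq)
qed

lemma cls_0: "cls 0 = W"
  by (simp add: cls_eq)

lemma cls_zero_iff: "cls f = W \<longleftrightarrow> f \<in> W"
  using cls_eq_iff[of f 0] by (simp add: cls_0)

lemma carrier_Q: "carrier Q = cls ` word_span X"
  by (auto simp: FactRing_def A_RCOSETS_def' cls_def carrier_free_rng)

lemma zero_Q: "\<zero>\<^bsub>Q\<^esub> = W"
  by (simp add: FactRing_def)

lemma zero_Q': "\<zero>\<^bsub>Q\<^esub> = cls 0"
  by (simp add: zero_Q cls_0)

lemma add_Q: "cls f \<oplus>\<^bsub>Q\<^esub> cls g = cls (f + g)"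
proof -
  have "(\<Union>h\<in>cls f. \<Union>k\<in>cls g. {h + k}) = cls (f + g)"
  proof (intro equalityI subsetI)
    fix x assume "x \<in> (\<Union>h\<in>cls f. \<Union>k\<in>cls g. {h + k})"
    then obtain v w where vw: "v \<in> W" "w \<in> W" "x = (v + f) + (w + g)"
      by (auto simp: cls_eq)
    then have "x = (v + w) + (f + g)" by (simp add: algebra_simps)
    then show "x \<in> cls (f + g)"
      using alg_ideal_add[OF W vw(1,2)] by (auto simp: cls_eq)
  next
    fix x assume "x \<in> cls (f + g)"
    then obtain w where w: "w \<in> W" "x = (w + f) + (0 + g)"
      by (auto simp: cls_eq algebra_simps)
    then have "w + f \<in> cls f" "0 + g \<in> cls g"
      using alg_ideal_0[OF W] by (force simp: cls_eq)+
    then show "x \<in> (\<Union>h\<in>cls f. \<Union>k\<in>cls g. {h + k})"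
      unfolding w(2) by blast
  qed
  then show ?thesis
    by (simp add: FactRing_def set_add_def set_mult_def free_rng_simps)
qed

lemma mult_Q:
  assumes "f \<in> word_span X" "g \<in> word_span X"
  shows "cls f \<otimes>\<^bsub>Q\<^esub> cls g = cls (f * g)"
proof -
  have "cls (h * k) = cls (f * g)" if hk: "h \<in> cls f" "k \<in> cls g" for h k
  proof -
    obtain v w where vw: "v \<in> W" "w \<in> W" "h = v + f" "k = w + g"
      using hk by (auto simp: cls_eq)
    have "h * k - f * g = v * (w + g) + f * w"
      by (simp add: vw algebra_simps)
    moreover have "w + g \<in> word_span X"
      using assms alg_ideal_subset[OF W vw(2)] by (simp add: word_span_add)
    ultimately show ?thesis
      using assms vw by (simp add: cls_eq_iff alg_ideal_add[OF W]
          alg_ideal_mult_left[OF W] alg_ideal_mult_right[OF W])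
  qed
  moreover have "f \<in> cls f" "g \<in> cls g"
    using alg_ideal_0[OF W] by (force simp: cls_eq)+
  ultimately have "(\<Union>h\<in>cls f. \<Union>k\<in>cls g. cls (h * k)) = cls (f * g)"
    by blast
  then show ?thesis
    by (simp add: FactRing_def rcoset_mult_def free_rng_simps cls_def)
qed

lemma abelian_group_Q: "abelian_group Q"
proof (rule abelian_groupI)
  fix x assume "x \<in> carrier Q"
  then obtain f where f: "f \<in> word_span X" "x = cls f"
    by (auto simp: carrier_Q)
  then show "\<exists>y\<in>carrier Q. y \<oplus>\<^bsub>Q\<^esub> x = \<zero>\<^bsub>Q\<^esub>"
    by (intro bexI[of _ "cls (- f)"])
      (auto simp: carrier_Q add_Q zero_Q cls_0 intro: word_span_uminus)
next
  show "\<zero>\<^bsub>Q\<^esub> \<in> carrier Q"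
    using word_span_0 by (auto simp: carrier_Q zero_Q')
next
  fix x assume "x \<in> carrier Q"
  then show "\<zero>\<^bsub>Q\<^esub> \<oplus>\<^bsub>Q\<^esub> x = x"
    by (auto simp: carrier_Q zero_Q' add_Q)
qed (auto simp: carrier_Q add_Q ac_simps intro: word_span_add)

lemma inv_Q: "f \<in> word_span X \<Longrightarrow> inv\<^bsub>add_monoid Q\<^esub> cls f = cls (- f)"
proof -
  assume f: "f \<in> word_span X"
  interpret abelian_group Q by (rule abelian_group_Q)
  have "\<ominus>\<^bsub>Q\<^esub> cls f = cls (- f)"
    by (rule minus_equality)
      (use f in \<open>auto simp: carrier_Q add_Q zero_Q cls_0 intro: word_span_uminus\<close>)
  then show ?thesis by (simp add: a_inv_def)
qed

lemma finsum_Q: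
  assumes "finite S" "\<And>g. g \<in> S \<Longrightarrow> h g \<in> word_span X"
  shows "finsum Q (\<lambda>g. cls (h g)) S = cls (\<Sum>g\<in>S. h g)"
proof -
  interpret abelian_group Q by (rule abelian_group_Q)
  show ?thesis
    using assms
  proof (induction S)
    case empty
    then show ?case by (simp add: zero_Q cls_0)
  next
    case (insert x S)
    then have "finsum Q (\<lambda>g. cls (h g)) (insert x S)
        = cls (h x) \<oplus>\<^bsub>Q\<^esub> finsum Q (\<lambda>g. cls (h g)) S"
      by (intro finsum_insert) (auto simp: carrier_Q)
    then show ?case
      using insert by (simp add: add_Q)
  qed
qed

end

text \<open>
  An ideal of the quotient corresponds to an ideal of the free ring; right local units are what
  makes the latter closed under scalars.
\<close>

lemma (in quotient_rng) graded_simple_Quot_iff: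
  assumes units: "\<And>f. f \<in> word_span X \<Longrightarrow> \<exists>u\<in>word_span X. f * u - f \<in> W"
    and hcW: "hom_closed deg W"
    and deg: "\<And>w. w \<in> lists X \<Longrightarrow> deg w \<in> \<Gamma>"
  shows "graded_simple \<Gamma>
      (\<lambda>d. {W +>\<^bsub>free_rng K X\<^esub> f | f. f \<in> carrier (free_rng K X) \<and> (\<forall>w\<in>Poly_Mapping.keys f. deg w = d)}) Q \<longleftrightarrow>
    W \<noteq> word_span X \<and>
    (\<forall>J. alg_ideal X J \<and> W \<subseteq> J \<and> hom_closed deg J \<longrightarrow> J = W \<or> J = word_span X)"
proof -
  define H where "H = (\<lambda>d. {W +>\<^bsub>free_rng K X\<^esub> f | f.
    f \<in> carrier (free_rng K X) \<and> (\<forall>w\<in>Poly_Mapping.keys f. deg w = d)})"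
  let ?R = "\<forall>J. alg_ideal X J \<and> W \<subseteq> J \<and> hom_closed deg J \<longrightarrow> J = W \<or> J = word_span X"
  interpret Q: abelian_group Q by (rule abelian_group_Q)
  have H: "H d = {cls f | f. f \<in> word_span X \<and> (\<forall>w\<in>Poly_Mapping.keys f. deg w = d)}" for d
    by (simp add: H_def cls_def carrier_free_rng)
  have nz: "carrier Q \<noteq> {\<zero>\<^bsub>Q\<^esub>} \<longleftrightarrow> W \<noteq> word_span X"
  proof -
    have "carrier Q = {\<zero>\<^bsub>Q\<^esub>} \<longleftrightarrow> (\<forall>f\<in>word_span X. cls f = W)"
    proof -
      have "W \<in> carrier Q"
        using Q.zero_closed by (simp add: zero_Q)
      then have "carrier Q = {W} \<longleftrightarrow> (\<forall>x\<in>carrier Q. x = W)" by blast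
      then show ?thesis by (simp add: carrier_Q zero_Q)
    qed
    also have "\<dots> \<longleftrightarrow> W = word_span X"
      using alg_ideal_subset[OF W] by (auto simp: cls_zero_iff)
    finally show ?thesis by simp
  qed
  have "?R \<longleftrightarrow> (\<forall>I. graded_ideal \<Gamma> H I Q \<longrightarrow> I = {\<zero>\<^bsub>Q\<^esub>} \<or> I = carrier Q)"
  proof
    assume R: ?R
    show "\<forall>I. graded_ideal \<Gamma> H I Q \<longrightarrow> I = {\<zero>\<^bsub>Q\<^esub>} \<or> I = carrier Q"
    proof (intro allI impI)
      fix I assume I: "graded_ideal \<Gamma> H I Q"
      then have rng: "rng_ideal I Q"
        by (simp add: graded_ideal_def)
      then have sub: "subgroup I (add_monoid Q)"
        by (simp add: rng_ideal_def additive_subgroup_def)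
      have mult: "a \<otimes>\<^bsub>Q\<^esub> x \<in> I" "x \<otimes>\<^bsub>Q\<^esub> a \<in> I" if "x \<in> I" "a \<in> carrier Q" for a x
        using rng that by (auto simp: rng_ideal_def)
      define J where "J = {f \<in> word_span X. cls f \<in> I}"
      have IJ: "I = cls ` J"
        using subgroup.subset[OF sub] by (auto simp: J_def carrier_Q)
      have Jcong: "g \<in> J" if "f \<in> J" "g \<in> word_span X" "g - f \<in> W" for f g
        using that cls_eq_iff[of g f] by (auto simp: J_def)
      have WJ: "W \<subseteq> J"
        using subgroup.one_closed[OF sub] alg_ideal_subset[OF W]
        by (auto simp: J_def zero_Q cls_zero_iff[THEN iffD2])
      have Jadd: "f + g \<in> J" if "f \<in> J" "g \<in> J" for f g
        using subgroup.m_closed[OF sub, of "cls f" "cls g"] that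
        by (auto simp: J_def add_Q word_span_add)
      have Jmult: "a * f \<in> J" "f * a \<in> J" if "f \<in> J" "a \<in> word_span X" for f a
        using mult[of "cls f" "cls a"] that
        by (auto simp: J_def mult_Q carrier_Q intro: word_span_mult)
      have aJ: "alg_ideal X J"
      proof (rule alg_idealI)
        fix c f assume f: "f \<in> J"
        then obtain u where u: "u \<in> word_span X" "f * u - f \<in> W"
          using units by (auto simp: J_def)
        have "f * (Poly_Mapping.single [] c * u) \<in> J"
          using f u by (intro Jmult word_span_scale)
        moreover have "f * (Poly_Mapping.single [] c * u) = Poly_Mapping.single [] c * (f * u)"
          by (metis mult.assoc scale_commute)
        moreover have "Poly_Mapping.single [] c * f - Poly_Mapping.single [] c * (f * u) \<in> W"
          using alg_ideal_uminus[OF W alg_ideal_scale[OF W u(2), of c]]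
          by (simp add: right_diff_distrib)
        moreover have "Poly_Mapping.single [] c * f \<in> word_span X"
          using f by (auto simp: J_def intro: word_span_scale)
        ultimately show "Poly_Mapping.single [] c * f \<in> J"
          using Jcong by metis
      next
        show "J \<subseteq> word_span X" by (auto simp: J_def)
        show "0 \<in> J" using WJ alg_ideal_0[OF W] by blast
      qed (simp_all add: Jadd Jmult word_span_single)
      have "hom_closed deg J"
        unfolding hom_closed_def
      proof (intro ballI allI)
        fix f g assume f: "f \<in> J"
        then have "cls f \<in> I" by (simp add: J_def)
        then obtain S c where S: "finite S" "\<forall>g\<in>S. c g \<in> H g \<inter> I" "cls f = finsum Q c S"
          using I unfolding graded_ideal_def by metis
        then have "\<forall>g\<in>S. \<exists>h. h \<in> J \<and> c g = cls h \<and> (\<forall>w\<in>Poly_Mapping.keys h. deg w = g)"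
          unfolding H by (fastforce simp: J_def)
        then obtain h where h: "\<And>g. g \<in> S \<Longrightarrow> h g \<in> J" "\<And>g. g \<in> S \<Longrightarrow> c g = cls (h g)"
          "\<And>g. g \<in> S \<Longrightarrow> \<forall>w\<in>Poly_Mapping.keys (h g). deg w = g"
          by metis
        have "finsum Q c S = finsum Q (\<lambda>g. cls (h g)) S"
          by (rule Q.finsum_cong') (use h in \<open>auto simp: J_def carrier_Q\<close>)
        also have "\<dots> = cls (\<Sum>g\<in>S. h g)"
          by (rule finsum_Q) (use S h in \<open>auto simp: J_def\<close>)
        finally have "f - (\<Sum>g\<in>S. h g) \<in> W"
          using S cls_eq_iff by simp
        \<comment> \<open>The error term has its components in the graded ideal \<open>W\<close>,
          and a component of the homogeneous \<open>h i\<close> is \<open>h i\<close> or zero. This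
          recovers the components of \<open>f\<close> from a decomposition that holds only modulo
          \<open>W\<close>.\<close>
        then have "hom_comp deg g (f - (\<Sum>g\<in>S. h g)) \<in> J"
          using hcW WJ by (auto simp: hom_closed_def)
        moreover have "hom_comp deg g (\<Sum>g\<in>S. h g) \<in> J"
          unfolding hom_comp_sum
        proof (rule alg_ideal_sum[OF aJ])
          fix i assume "i \<in> S"
          then show "hom_comp deg g (h i) \<in> J"
            using h(1)[of i] hom_comp_homogeneous[OF h(3)[of i], of g]
            by (auto simp: when_def alg_ideal_0[OF aJ])
        qed
        ultimately have "hom_comp deg g ((f - (\<Sum>g\<in>S. h g)) + (\<Sum>g\<in>S. h g)) \<in> J"
          unfolding hom_comp_add by (rule Jadd)
        then show "hom_comp deg g f \<in> J" by simp
      qed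
      then have "J = W \<or> J = word_span X"
        using R aJ WJ by blast
      moreover have "cls ` W = {W}"
        using alg_ideal_0[OF W] by (auto simp: cls_zero_iff[THEN iffD2])
      ultimately show "I = {\<zero>\<^bsub>Q\<^esub>} \<or> I = carrier Q"
        by (auto simp: IJ zero_Q carrier_Q)
    qed
  next
    assume L: "\<forall>I. graded_ideal \<Gamma> H I Q \<longrightarrow> I = {\<zero>\<^bsub>Q\<^esub>} \<or> I = carrier Q"
    show ?R
    proof (intro allI impI, elim conjE)
      fix J assume J: "alg_ideal X J" "W \<subseteq> J" "hom_closed deg J"
      have clsJ: "f \<in> J" if f: "cls f \<in> cls ` J" for f
      proof -
        obtain g where "g \<in> J" "cls f = cls g"
          using f by blast
        then have "g \<in> J" "f - g \<in> W"
          by (simp_all add: cls_eq_iff)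
        then show ?thesis
          using alg_ideal_add[OF J(1), of "f - g" g] J(2) by auto
      qed
      note Jsub = alg_ideal_subset[OF J(1)]
      have "subgroup (cls ` J) (add_monoid Q)"
      proof (rule subgroup.intro)
        show "cls ` J \<subseteq> carrier (add_monoid Q)"
          using Jsub by (auto simp: carrier_Q)
        show "\<one>\<^bsub>add_monoid Q\<^esub> \<in> cls ` J"
          using alg_ideal_0[OF J(1)] by (auto simp: zero_Q')
        show "x \<otimes>\<^bsub>add_monoid Q\<^esub> y \<in> cls ` J" if "x \<in> cls ` J" "y \<in> cls ` J" for x y
          using that alg_ideal_add[OF J(1)] by (auto simp: add_Q)
        show "inv\<^bsub>add_monoid Q\<^esub> x \<in> cls ` J" if "x \<in> cls ` J" for x
          using that inv_Q Jsub alg_ideal_uminus[OF J(1)] by (auto simp del: monoid.simps)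
      qed
      then have "rng_ideal (cls ` J) Q"
        using Jsub by (auto simp: rng_ideal_def additive_subgroup_def carrier_Q mult_Q
            alg_ideal_mult_left[OF J(1)] alg_ideal_mult_right[OF J(1)])
      moreover have "\<exists>S c. finite S \<and> S \<subseteq> \<Gamma> \<and> (\<forall>g\<in>S. c g \<in> H g \<inter> cls ` J) \<and> cls f = finsum Q c S"
        if f: "f \<in> J" for f
      proof (intro exI conjI ballI)
        let ?S = "deg ` Poly_Mapping.keys f"
        show "finite ?S" by simp
        show "?S \<subseteq> \<Gamma>"
          using deg Jsub[OF f] by (auto simp: word_span_def)
        show "cls (hom_comp deg g f) \<in> H g \<inter> cls ` J" if "g \<in> ?S" for g
        proof
          show "cls (hom_comp deg g f) \<in> H g"
            unfolding H mem_Collect_eq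
            by (intro exI[of _ "hom_comp deg g f"] conjI hom_comp_word_span[OF Jsub[OF f]] refl)
              (simp add: keys_hom_comp)
          show "cls (hom_comp deg g f) \<in> cls ` J"
            using J(3) f unfolding hom_closed_def by blast
        qed
        show "cls f = finsum Q (\<lambda>g. cls (hom_comp deg g f)) ?S"
        proof -
          have ws: "hom_comp deg g f \<in> word_span X" for g
            by (rule hom_comp_word_span, rule Jsub, rule f)
          have "finite ?S" by simp
          from finsum_Q[of ?S "\<lambda>g. hom_comp deg g f", OF this ws] sum_hom_comp[OF this subset_refl]
          show ?thesis by simp
        qed
      qed
      ultimately have "graded_ideal \<Gamma> H (cls ` J) Q"
        unfolding graded_ideal_def by blast
      then have "cls ` J = {W} \<or> cls ` J = cls ` word_span X"
        using L by (simp add: zero_Q carrier_Q)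
      then show "J = W \<or> J = word_span X"
      proof
        assume "cls ` J = {W}"
        then have "f \<in> W" if "f \<in> J" for f
          using imageI[OF that, of cls] by (simp add: cls_zero_iff)
        then have "J = W" using J(2) by blast
        then show ?thesis ..
      next
        assume eq: "cls ` J = cls ` word_span X"
        have "f \<in> J" if "f \<in> word_span X" for f
          using imageI[OF that, of cls] unfolding eq[symmetric] by (rule clsJ)
        then have "J = word_span X" using Jsub by blast
        then show ?thesis ..
      qed
    qed
  qed
  then show ?thesis
    unfolding graded_simple_def nz H_def by blast
qed

text \<open>For an ideal \<open>G\<close> this is the largest graded ideal inside \<open>G\<close>:
  membership asks every component to lie in \<open>G\<close>, and an element is the sum of its
  components.\<close>

definition hom_core :: "'x set \<Rightarrow> ('x list \<Rightarrow> 'g) \<Rightarrow> ('x list \<Rightarrow>\<^sub>0 'k::field) set \<Rightarrow> ('x list \<Rightarrow>\<^sub>0 'k) set" where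
  "hom_core X deg G = {f \<in> word_span X. \<forall>g. hom_comp deg g f \<in> G}"

lemma alg_ideal_hom_core:
  fixes G :: "('x list \<Rightarrow>\<^sub>0 'k::field) set"
  assumes G: "alg_ideal X G"
    and deg: "\<And>u w. deg (u @ w) = deg u + (deg w :: 'g::ab_group_add)"
  shows "alg_ideal X (hom_core X deg G)"
proof -
  \<comment> \<open>Multiplication by a word translates degrees, so the component \<open>g\<close>
    of the product comes from the component \<open>g - deg u\<close> of the factor; this uses that
    degrees form a group.\<close>
  have left: "hom_comp deg g (mon u * f) = mon u * hom_comp deg (g - deg u) (f :: _ \<Rightarrow>\<^sub>0 'k)" for g u f
  proof -
    have "hom_comp deg g (mon u * (\<Sum>w\<in>Poly_Mapping.keys f. Poly_Mapping.single w (poly_mapping.lookup f w)))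
      = mon u * hom_comp deg (g - deg u) (\<Sum>w\<in>Poly_Mapping.keys f. Poly_Mapping.single w (poly_mapping.lookup f w))"
      by (simp add: sum_distrib_left hom_comp_sum mult_single hom_comp_single plus_list_def deg
          mult_when eq_diff_eq add.commute)
    then show ?thesis by (simp add: sum_monomials)
  qed
  have right: "hom_comp deg g (f * mon u) = hom_comp deg (g - deg u) (f :: _ \<Rightarrow>\<^sub>0 'k) * mon u" for g u f
  proof -
    have "hom_comp deg g ((\<Sum>w\<in>Poly_Mapping.keys f. Poly_Mapping.single w (poly_mapping.lookup f w)) * mon u)
      = hom_comp deg (g - deg u) (\<Sum>w\<in>Poly_Mapping.keys f. Poly_Mapping.single w (poly_mapping.lookup f w)) * mon u"
      by (simp add: sum_distrib_right hom_comp_sum mult_single hom_comp_single plus_list_def deg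
          when_mult eq_diff_eq)
    then show ?thesis by (simp add: sum_monomials)
  qed
  show ?thesis
  proof (rule alg_idealI)
    show "hom_core X deg G \<subseteq> word_span X" by (auto simp: hom_core_def)
    show "0 \<in> hom_core X deg G" by (simp add: hom_core_def alg_ideal_0[OF G])
  qed (simp_all add: hom_core_def word_span_add word_span_scale word_span_mult word_span_single
        hom_comp_add hom_comp_scale left right
        alg_ideal_add[OF G] alg_ideal_scale[OF G] alg_ideal_mon_left[OF G] alg_ideal_mon_right[OF G])
qed

lemma hom_closed_hom_core:
  assumes "0 \<in> G"
  shows "hom_closed deg (hom_core X deg G)"
  unfolding hom_closed_def
proof (intro ballI allI)
  fix f g assume f: "f \<in> hom_core X deg G"
  have "hom_comp deg h (hom_comp deg g f) = (hom_comp deg g f when g = h)" for h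
    by (rule hom_comp_homogeneous) (auto simp: keys_hom_comp)
  then show "hom_comp deg g f \<in> hom_core X deg G"
    using f assms by (auto simp: hom_core_def when_def intro: hom_comp_word_span)
qed

lemma hom_core_superset:
  "I \<subseteq> G \<Longrightarrow> I \<subseteq> word_span X \<Longrightarrow> hom_closed deg I \<Longrightarrow> I \<subseteq> hom_core X deg G"
  by (auto simp: hom_core_def hom_closed_def)

text \<open>The graded core of the generated ideal is itself an ideal, and it contains the
  generators because a component of a homogeneous generator is the generator or zero. Minimality of
  the generated ideal does the rest.\<close>

lemma hom_closed_generated:
  assumes S: "S \<subseteq> word_span X"
    and hom: "\<And>f. f \<in> S \<Longrightarrow> \<exists>d. \<forall>w\<in>Poly_Mapping.keys f. deg w = d"
    and deg: "\<And>u w. deg (u @ w) = deg u + (deg w :: 'g::ab_group_add)"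
  shows "hom_closed deg (generated_ideal (K::'k::field itself) X S)"
proof -
  let ?G = "generated_ideal K X S"
  note G = alg_ideal_generated[OF S, of K]
  have "S \<subseteq> hom_core X deg ?G"
  proof
    fix f assume f: "f \<in> S"
    then obtain d where d: "\<forall>w\<in>Poly_Mapping.keys f. deg w = d"
      using hom by blast
    have "f \<in> ?G" using f generated_ideal_base by blast
    then show "f \<in> hom_core X deg ?G"
      using f S by (auto simp: hom_core_def hom_comp_homogeneous[OF d] when_def alg_ideal_0[OF G])
  qed
  then have "?G \<subseteq> hom_core X deg ?G"
    by (intro generated_ideal_minimal alg_ideal_hom_core G deg)
  then show ?thesis
    by (auto simp: hom_closed_def hom_core_def)
qed


section \<open>Ideals of weighted Leavitt path algebras\<close>

lemma word_deg_append: "word_deg (u @ w) = word_deg u + word_deg w"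
  by (simp add: word_deg_def)

lemma edg_eq: "(\<alpha>, i) \<in> edges E \<omega> \<Longrightarrow> edg \<omega> \<alpha> i = mon [Edge \<alpha> i]"
  and gst_eq: "(\<alpha>, i) \<in> edges E \<omega> \<Longrightarrow> gst \<omega> \<alpha> i = mon [Ghost \<alpha> i]"
  by (auto simp: edg_def gst_def edges_def)

text \<open>The vertices that act as identities on the two sides of a letter; a ghost is read
  backwards.\<close>

fun left_end :: "('v, 'e) pre_digraph \<Rightarrow> ('v, 'e) letter \<Rightarrow> 'v" where
  "left_end E (Vertex v) = v"
| "left_end E (Edge \<alpha> i) = tail E \<alpha>"
| "left_end E (Ghost \<alpha> i) = head E \<alpha>"

fun right_end :: "('v, 'e) pre_digraph \<Rightarrow> ('v, 'e) letter \<Rightarrow> 'v" where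
  "right_end E (Vertex v) = v"
| "right_end E (Edge \<alpha> i) = head E \<alpha>"
| "right_end E (Ghost \<alpha> i) = tail E \<alpha>"

lemma letters_iff [simp]:
  "Vertex v \<in> letters E \<omega> \<longleftrightarrow> v \<in> verts E"
  "Edge \<alpha> i \<in> letters E \<omega> \<longleftrightarrow> (\<alpha>, i) \<in> edges E \<omega>"
  "Ghost \<alpha> i \<in> letters E \<omega> \<longleftrightarrow> (\<alpha>, i) \<in> edges E \<omega>"
  by (auto simp: letters_def)

lemma edges_iff: "(\<alpha>, i) \<in> edges E \<omega> \<longleftrightarrow> \<alpha> \<in> arcs E \<and> 1 \<le> i \<and> i \<le> \<omega> \<alpha>"
  by (auto simp: edges_def)

context weighted_graph
begin

lemma vertex_weight_ge:
  assumes "\<alpha> \<in> out_arcs E v" "finite (out_arcs E v)"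
  shows "\<omega> \<alpha> \<le> vertex_weight E \<omega> v"
  using assms by (simp add: vertex_weight_def)

lemma vertex_weight_attained:
  assumes "\<not> sink E v" "finite (out_arcs E v)"
  shows "\<exists>\<alpha>\<in>out_arcs E v. \<omega> \<alpha> = vertex_weight E \<omega> v"
proof -
  have "vertex_weight E \<omega> v \<in> \<omega> ` out_arcs E v"
    unfolding vertex_weight_def using assms by (intro Max_in) (auto simp: sink_def)
  then show ?thesis by auto
qed

lemma ends_in_verts:
  assumes "x \<in> letters E \<omega>"
  shows "left_end E x \<in> verts E" "right_end E x \<in> verts E"
  using assms by (cases x; auto simp: edges_iff)+

lemma relations_homogeneous:
  fixes K :: "'k::field itself"
  assumes "f \<in> relations K E \<omega>"
  shows "f \<in> word_span (letters E \<omega>)" "\<exists>d. \<forall>w\<in>Poly_Mapping.keys f. word_deg w = d"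
proof -
  \<comment> \<open>Both conclusions are carried through together, since for a fixed degree they are
    preserved by sums and differences.\<close>
  define P where "P d f \<longleftrightarrow>
    f \<in> word_span (letters E \<omega>) \<and> (\<forall>w\<in>Poly_Mapping.keys f. word_deg w = d)" for d and f :: "('v, 'e, 'k) words_alg"
  have single: "P d (Poly_Mapping.single w c)"
    if "w \<in> lists (letters E \<omega>)" "w \<noteq> []" "word_deg w = d" for w c d
    using that by (auto simp: P_def word_span_def split: if_splits)
  have diff: "P d (f - g)" if "P d f" "P d g" for f g d
    using that keys_diff[of f g] by (auto simp: P_def intro: word_span_diff)
  have sum: "P d (sum h A)" if "\<And>i. i \<in> A \<Longrightarrow> P d (h i)" for h :: "'i \<Rightarrow> ('v, 'e, 'k) words_alg" and A d
    using that keys_sum[of h A] unfolding P_def by (blast intro: word_span_sum)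
  have zero [simp]: "P d 0" for d
    by (simp add: P_def)
  note [simp] = vtx_def edg_def gst_def mon_mult word_deg_def edges_iff
  have "\<exists>d. P d f"
    using assms unfolding relations_def
  proof (elim UnE CollectE exE conjE)
    fix v w assume "f = vtx v * vtx w - (if v = w then vtx v else 0)" "v \<in> verts E" "w \<in> verts E"
    then show ?thesis
      by (intro exI[of _ 0]) (simp only:, rule diff, auto intro!: single)
  next
    fix \<alpha> i assume "f = vtx (tail E \<alpha>) * edg \<omega> \<alpha> i - edg \<omega> \<alpha> i" "(\<alpha>, i) \<in> edges E \<omega>"
    then show ?thesis
      by (intro exI[of _ "Poly_Mapping.single i 1"])
        (simp only:, rule diff, auto intro!: single)
  next
    fix \<alpha> i assume "f = edg \<omega> \<alpha> i * vtx (head E \<alpha>) - edg \<omega> \<alpha> i" "(\<alpha>, i) \<in> edges E \<omega>"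
    then show ?thesis
      by (intro exI[of _ "Poly_Mapping.single i 1"])
        (simp only:, rule diff, auto intro!: single)
  next
    fix \<alpha> i assume "f = vtx (head E \<alpha>) * gst \<omega> \<alpha> i - gst \<omega> \<alpha> i" "(\<alpha>, i) \<in> edges E \<omega>"
    then show ?thesis
      by (intro exI[of _ "- Poly_Mapping.single i 1"])
        (simp only:, rule diff, auto intro!: single)
  next
    fix \<alpha> i assume "f = gst \<omega> \<alpha> i * vtx (tail E \<alpha>) - gst \<omega> \<alpha> i" "(\<alpha>, i) \<in> edges E \<omega>"
    then show ?thesis
      by (intro exI[of _ "- Poly_Mapping.single i 1"])
        (simp only:, rule diff, auto intro!: single)
  next
    fix v i j
    assume "f = (\<Sum>\<alpha>\<in>out_arcs E v. edg \<omega> \<alpha> i * gst \<omega> \<alpha> j) - (if i = j then vtx v else 0)"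
      "v \<in> verts E" "i \<in> {1..vertex_weight E \<omega> v}" "j \<in> {1..vertex_weight E \<omega> v}"
    \<comment> \<open>The vertex term occurs only for \<open>i = j\<close>, when the degree below is
      0, the degree of a vertex.\<close>
    then show ?thesis
      by (intro exI[of _ "Poly_Mapping.single i 1 - Poly_Mapping.single j 1"])
        (simp only:, rule diff, rule sum, auto intro!: single)
  next
    fix \<alpha> \<beta>
    assume "f = (\<Sum>i=1..max (\<omega> \<alpha>) (\<omega> \<beta>). gst \<omega> \<alpha> i * edg \<omega> \<beta> i) - (if \<alpha> = \<beta> then vtx (head E \<alpha>) else 0)"
      "\<alpha> \<in> arcs E" "\<beta> \<in> arcs E"
    then show ?thesis
      by (intro exI[of _ 0])
        (simp only:, rule diff, rule sum, auto intro!: single)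
  qed
  then show "f \<in> word_span (letters E \<omega>)" "\<exists>d. \<forall>w\<in>Poly_Mapping.keys f. word_deg w = d"
    by (auto simp: P_def)
qed

lemma alg_ideal_wlpa: "alg_ideal (letters E \<omega>) (wlpa_ideal K E \<omega>)"
  unfolding wlpa_ideal_def
  by (rule alg_ideal_generated) (use relations_homogeneous(1) in blast)

lemma hom_closed_wlpa: "hom_closed word_deg (wlpa_ideal (K::'k::field itself) E \<omega>)"
  unfolding wlpa_ideal_def
  by (rule hom_closed_generated)
    (use relations_homogeneous[where K = K] in \<open>auto simp: word_deg_append\<close>)

end

text \<open>An arbitrary ideal above the relations is allowed, not just the smallest one, so that
  the same computations hold in every quotient of the algebra; \<open>f - g \<in> I\<close> stands
  for an equation there.\<close>

locale wlpa_quotient = weighted_graph E \<omega> for E :: "('v, 'e) pre_digraph" and \<omega> +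
  fixes K :: "'k::field itself" and I :: "('v, 'e, 'k) words_alg set"
  assumes ideal: "alg_ideal (letters E \<omega>) I"
    and rel: "relations K E \<omega> \<subseteq> I"
begin

lemma vtx_rel:
  assumes "v \<in> verts E" "w \<in> verts E"
  shows "vtx v * vtx w - (if v = w then vtx v else 0) \<in> I"
proof -
  have "vtx v * vtx w - (if v = w then vtx v else 0) \<in> relations K E \<omega>"
    unfolding relations_def using assms by blast
  then show ?thesis using rel by blast
qed

lemma vtx_idem: "v \<in> verts E \<Longrightarrow> mon [Vertex v, Vertex v] - mon [Vertex v] \<in> I"
  using vtx_rel[of v v] by (simp add: vtx_def mon_mult)

lemma vtx_orth:
  "v \<in> verts E \<Longrightarrow> w \<in> verts E \<Longrightarrow> v \<noteq> w \<Longrightarrow> mon [Vertex v, Vertex w] \<in> I"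
  using vtx_rel[of v w] by (simp add: vtx_def mon_mult)

lemma left_unit:
  assumes "x \<in> letters E \<omega>"
  shows "mon [Vertex (left_end E x), x] - mon [x] \<in> I"
proof (cases x)
  case (Vertex v)
  then show ?thesis using assms vtx_idem by simp
next
  case (Edge \<alpha> i)
  then have "vtx (tail E \<alpha>) * edg \<omega> \<alpha> i - edg \<omega> \<alpha> i \<in> relations K E \<omega>"
    using assms unfolding relations_def by auto
  then show ?thesis
    using assms Edge rel by (auto simp: edg_eq vtx_def mon_mult)
next
  case (Ghost \<alpha> i)
  then have "vtx (head E \<alpha>) * gst \<omega> \<alpha> i - gst \<omega> \<alpha> i \<in> relations K E \<omega>"
    using assms unfolding relations_def by auto
  then show ?thesis
    using assms Ghost rel by (auto simp: gst_eq vtx_def mon_mult)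
qed

lemma right_unit:
  assumes "x \<in> letters E \<omega>"
  shows "mon [x, Vertex (right_end E x)] - mon [x] \<in> I"
proof (cases x)
  case (Vertex v)
  then show ?thesis using assms vtx_idem by simp
next
  case (Edge \<alpha> i)
  then have "edg \<omega> \<alpha> i * vtx (head E \<alpha>) - edg \<omega> \<alpha> i \<in> relations K E \<omega>"
    using assms unfolding relations_def by auto
  then show ?thesis
    using assms Edge rel by (auto simp: edg_eq vtx_def mon_mult)
next
  case (Ghost \<alpha> i)
  then have "gst \<omega> \<alpha> i * vtx (tail E \<alpha>) - gst \<omega> \<alpha> i \<in> relations K E \<omega>"
    using assms unfolding relations_def by auto
  then show ?thesis
    using assms Ghost rel by (auto simp: gst_eq vtx_def mon_mult)
qed

lemma out_rel:
  assumes "v \<in> verts E" "\<not> sink E v" "finite (out_arcs E v)"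
    "i \<in> {1..vertex_weight E \<omega> v}" "j \<in> {1..vertex_weight E \<omega> v}"
  shows "(\<Sum>\<alpha>\<in>out_arcs E v. edg \<omega> \<alpha> i * gst \<omega> \<alpha> j) - (if i = j then vtx v else 0) \<in> I"
  by (rule rel[THEN subsetD], unfold relations_def, rule UnI1, rule UnI2, rule CollectI)
    (rule exI[of _ v], rule exI[of _ i], rule exI[of _ j], intro conjI HOL.refl assms)

lemma arc_rel:
  assumes "\<alpha> \<in> arcs E" "\<beta> \<in> arcs E"
  shows "(\<Sum>i=1..max (\<omega> \<alpha>) (\<omega> \<beta>). gst \<omega> \<alpha> i * edg \<omega> \<beta> i) - (if \<alpha> = \<beta> then vtx (head E \<alpha>) else 0) \<in> I"
  by (rule rel[THEN subsetD], unfold relations_def, rule UnI2, rule CollectI)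
    (rule exI[of _ \<alpha>], rule exI[of _ \<beta>], intro conjI HOL.refl assms)

lemma factor_mem:
  assumes "mon w \<in> I" "u \<in> lists (letters E \<omega>)" "v \<in> lists (letters E \<omega>)"
  shows "mon (u @ w @ v) \<in> I"
  using alg_ideal_mon_left[OF ideal assms(2) alg_ideal_mon_right[OF ideal assms(3,1)]]
  by (simp add: mon_mult)

lemma factor_cong:
  assumes "mon w - mon w' \<in> I" "u \<in> lists (letters E \<omega>)" "v \<in> lists (letters E \<omega>)"
  shows "mon (u @ w @ v) - mon (u @ w' @ v) \<in> I"
  using alg_ideal_mon_left[OF ideal assms(2) alg_ideal_mon_right[OF ideal assms(3,1)]]
  by (simp add: mon_mult algebra_simps)

lemma diff_sym: "f - g \<in> I \<Longrightarrow> g - f \<in> I"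
  using alg_ideal_uminus[OF ideal] by fastforce

lemma diff_trans: "f - g \<in> I \<Longrightarrow> g - h \<in> I \<Longrightarrow> f - h \<in> I"
  using alg_ideal_add[OF ideal, of "f - g" "g - h"] by simp

lemma mem_cong: "f - g \<in> I \<Longrightarrow> f \<in> I \<longleftrightarrow> g \<in> I"
  using alg_ideal_add[OF ideal, of "f - g" g] alg_ideal_diff[OF ideal, of f "f - g"] by auto

text \<open>Inserting the right unit of \<open>x\<close> and the left unit of \<open>y\<close>
  exposes a product of two distinct vertices in the middle.\<close>

lemma mismatch:
  assumes "x \<in> letters E \<omega>" "y \<in> letters E \<omega>" "right_end E x \<noteq> left_end E y"
  shows "mon [x, y] \<in> I"
proof -
  have "mon ([x] @ [Vertex (right_end E x), Vertex (left_end E y)] @ [y]) \<in> I"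
    using assms by (intro factor_mem vtx_orth ends_in_verts) auto
  moreover have "mon ([] @ [x, Vertex (right_end E x)] @ [Vertex (left_end E y), y])
      - mon ([] @ [x] @ [Vertex (left_end E y), y]) \<in> I"
    using assms ends_in_verts by (intro factor_cong right_unit) auto
  moreover have "mon ([x] @ [Vertex (left_end E y), y] @ []) - mon ([x] @ [y] @ []) \<in> I"
    using assms by (intro factor_cong left_unit) auto
  ultimately show ?thesis
    by (simp add: mem_cong)
qed

lemma word_right_unit:
  assumes "w \<in> lists (letters E \<omega>)" "w \<noteq> []"
  shows "mon (w @ [Vertex (right_end E (last w))]) - mon w \<in> I"
proof -
  have "mon (butlast w @ [last w, Vertex (right_end E (last w))] @ [])
      - mon (butlast w @ [last w] @ []) \<in> I"
    using assms by (intro factor_cong right_unit) (auto dest: in_set_butlastD simp: in_lists_conv_set)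
  then show ?thesis
    using assms by (simp add: append_butlast_last_id[symmetric] del: append_butlast_last_id)
      (metis append_butlast_last_id append.assoc append_Cons append_Nil)
qed

lemma word_mismatch:
  assumes "w \<in> lists (letters E \<omega>)" "w \<noteq> []" "v \<in> verts E" "v \<noteq> right_end E (last w)"
  shows "mon (w @ [Vertex v]) \<in> I"
proof -
  have "mon (butlast w @ [last w, Vertex v] @ []) \<in> I"
    using assms by (intro factor_mem mismatch) (auto dest: in_set_butlastD simp: in_lists_conv_set)
  then show ?thesis
    using assms by (metis append_butlast_last_id append.assoc append_Cons append_Nil append_Nil2)
qed

text \<open>The set \<open>Z\<close> consists of the right ends of the words of \<open>f\<close>:
  each word is fixed by its own right end and killed by the other vertices.\<close>

lemma local_units:
  assumes f: "f \<in> word_span (letters E \<omega>)"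
  shows "\<exists>Z. finite Z \<and> Z \<subseteq> verts E \<and> f * (\<Sum>z\<in>Z. mon [Vertex z]) - f \<in> I"
proof (intro exI conjI)
  let ?Z = "(\<lambda>w. right_end E (last w)) ` Poly_Mapping.keys f"
  let ?c = "poly_mapping.lookup f"
  show fin: "finite ?Z" by simp
  have keys: "w \<in> lists (letters E \<omega>)" "w \<noteq> []" if "w \<in> Poly_Mapping.keys f" for w
    using f that by (auto simp: word_span_def)
  show Z: "?Z \<subseteq> verts E"
    using keys by (auto intro!: ends_in_verts simp: in_lists_conv_set)
  have "mon w * (\<Sum>z\<in>?Z. mon [Vertex z]) - mon w \<in> I" if w: "w \<in> Poly_Mapping.keys f" for w
  proof -
    let ?z = "right_end E (last w)"
    have "?z \<in> ?Z" using w by blast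
    then have "mon w * (\<Sum>z\<in>?Z. mon [Vertex z]) - mon w
        = (mon (w @ [Vertex ?z]) - mon w) + (\<Sum>z\<in>?Z - {?z}. mon (w @ [Vertex z]))"
      by (simp add: sum_distrib_left distrib_left mon_mult sum.remove[OF fin])
    also have "\<dots> \<in> I"
      using keys[OF w] Z
      by (intro alg_ideal_add[OF ideal] alg_ideal_sum[OF ideal] word_right_unit word_mismatch) auto
    finally show ?thesis .
  qed
  then have "(\<Sum>w\<in>Poly_Mapping.keys f. Poly_Mapping.single [] (?c w) *
      (mon w * (\<Sum>z\<in>?Z. mon [Vertex z]) - mon w)) \<in> I"
    by (intro alg_ideal_sum[OF ideal] alg_ideal_scale[OF ideal])
  also have "(\<Sum>w\<in>Poly_Mapping.keys f. Poly_Mapping.single [] (?c w) *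
        (mon w * (\<Sum>z\<in>?Z. mon [Vertex z]) - mon w))
      = (\<Sum>w\<in>Poly_Mapping.keys f. Poly_Mapping.single w (?c w)) * (\<Sum>z\<in>?Z. mon [Vertex z])
        - (\<Sum>w\<in>Poly_Mapping.keys f. Poly_Mapping.single w (?c w))"
    by (simp add: right_diff_distrib sum_subtractf sum_distrib_right mult.assoc[symmetric]
        single_conv_scale[symmetric])
  finally show "f * (\<Sum>z\<in>?Z. mon [Vertex z]) - f \<in> I"
    by (simp add: sum_monomials)
qed

text \<open>By the local units \<open>f\<close> is congruent to a finite sum of its products with
  vertices, and these cannot all vanish modulo \<open>I\<close>.\<close>

lemma ex_vertex_not_mem:
  assumes "f \<in> word_span (letters E \<omega>)" "f \<notin> I"
  shows "\<exists>v\<in>verts E. f * mon [Vertex v] \<notin> I"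
proof (rule ccontr)
  assume contra: "\<not> ?thesis"
  obtain Z where Z: "finite Z" "Z \<subseteq> verts E" "f * (\<Sum>z\<in>Z. mon [Vertex z]) - f \<in> I"
    using local_units assms by blast
  have "f * (\<Sum>z\<in>Z. mon [Vertex z]) \<in> I"
    unfolding sum_distrib_left by (rule alg_ideal_sum[OF ideal]) (use contra Z in auto)
  then show False
    using assms(2) mem_cong[OF Z(3)] by blast
qed

lemma eq_word_span_iff: "I = word_span (letters E \<omega>) \<longleftrightarrow> (\<forall>v\<in>verts E. vtx v \<in> I)"
proof
  assume "\<forall>v\<in>verts E. vtx v \<in> I"
  then have "f \<in> I" if "f \<in> word_span (letters E \<omega>)" for f
    using ex_vertex_not_mem[OF that] alg_ideal_mult_left[OF ideal that] unfolding vtx_def by blast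
  then show "I = word_span (letters E \<omega>)"
    using alg_ideal_subset[OF ideal] by blast
qed (auto simp: vtx_def word_span_single)

end

lemma wlpa_quotientI:
  assumes "weighted_graph E \<omega>" "alg_ideal (letters E \<omega>) I" "relations (K::'k::field itself) E \<omega> \<subseteq> I"
  shows "wlpa_quotient E \<omega> K I"
  using assms by (simp add: wlpa_quotient_def wlpa_quotient_axioms_def)

context weighted_graph
begin

lemma wlpa_quotient_wlpa: "wlpa_quotient E \<omega> K (wlpa_ideal K E \<omega>)"
  by (intro wlpa_quotientI alg_ideal_wlpa) (unfold_locales, simp add: wlpa_ideal_def generated_ideal_base)

lemma word_deg_degree_group: "w \<in> lists (letters E \<omega>) \<Longrightarrow> word_deg w \<in> degree_group E \<omega>"
proof (induction w)
  case Nil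
  then show ?case by (simp add: word_deg_def degree_group_def)
next
  case (Cons x w)
  then have x: "x \<in> letters E \<omega>" and w: "word_deg w \<in> degree_group E \<omega>"
    by auto
  have "Poly_Mapping.keys (letter_deg x) \<subseteq> (\<Union>\<alpha>\<in>arcs E. {1..\<omega> \<alpha>})"
    using x by (cases x) (auto simp: edges_iff)
  then show ?case
    using w keys_add[of "letter_deg x" "word_deg w"]
    by (auto simp: word_deg_def degree_group_def)
qed

lemma graded_simple_wlpa_iff:
  "graded_simple (degree_group E \<omega>) (wlpa_component K E \<omega>) (wlpa K E \<omega>) \<longleftrightarrow>
    wlpa_ideal K E \<omega> \<noteq> word_span (letters E \<omega>) \<and>
    (\<forall>J. alg_ideal (letters E \<omega>) J \<and> wlpa_ideal K E \<omega> \<subseteq> J \<and> hom_closed word_deg J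
      \<longrightarrow> J = wlpa_ideal K E \<omega> \<or> J = word_span (letters E \<omega>))"
proof -
  interpret Q: quotient_rng K "letters E \<omega>" "wlpa_ideal K E \<omega>"
    by (rule quotient_rng.intro, rule alg_ideal_wlpa)
  interpret wlpa_quotient E \<omega> K "wlpa_ideal K E \<omega>"
    by (rule wlpa_quotient_wlpa)
  have "\<exists>u\<in>word_span (letters E \<omega>). f * u - f \<in> wlpa_ideal K E \<omega>"
    if f: "f \<in> word_span (letters E \<omega>)" for f
  proof -
    obtain Z where "finite Z" "Z \<subseteq> verts E" "f * (\<Sum>z\<in>Z. mon [Vertex z]) - f \<in> wlpa_ideal K E \<omega>"
      using local_units f by blast
    then show ?thesis
      by (intro bexI[of _ "\<Sum>z\<in>Z. mon [Vertex z]"] word_span_sum word_span_single) auto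
  qed
  then show ?thesis
    unfolding wlpa_def wlpa_component_def[abs_def]
    by (intro Q.graded_simple_Quot_iff hom_closed_wlpa word_deg_degree_group) auto
qed

end


section \<open>Actions by partial injections\<close>

text \<open>A matrix coefficient: if words act by partial injections of a basis and
  \<open>P w\<close> says that \<open>w\<close> takes one given basis vector to another, this is the
  corresponding entry of the operator of \<open>f\<close>. Working with entries avoids constructing
  the vector space.\<close>

definition entry :: "('w \<Rightarrow> bool) \<Rightarrow> ('w \<Rightarrow>\<^sub>0 'k::comm_monoid_add) \<Rightarrow> 'k" where
  "entry P f = (\<Sum>w\<in>Poly_Mapping.keys f. poly_mapping.lookup f w when P w)"

lemma entry_0 [simp]: "entry P 0 = 0"
  by (simp add: entry_def)

lemma entry_False [simp]: "entry (\<lambda>_. False) f = 0"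
  by (simp add: entry_def)

lemma entry_add: "entry P (f + g) = entry P f + entry P g"
  unfolding entry_def by (rule setsum_keys_plus_distrib) (simp_all add: when_def)

lemma entry_sum: "entry P (sum h A) = (\<Sum>i\<in>A. entry P (h i))"
  by (induction A rule: infinite_finite_induct) (simp_all add: entry_add)

lemma entry_single [simp]: "entry P (Poly_Mapping.single w c) = (c when P w)"
  by (simp add: entry_def)

lemma entry_diff: "entry P (f - g) = entry P f - entry P (g :: 'w \<Rightarrow>\<^sub>0 'k::ab_group_add)"
  using entry_add[of P "f - g" g] by simp

lemma entry_scale:
  "entry P (Poly_Mapping.single [] (c::'k::field) * f) = c * entry P f"
proof -
  have "entry P (Poly_Mapping.single [] c * (\<Sum>w\<in>Poly_Mapping.keys f. Poly_Mapping.single w (poly_mapping.lookup f w)))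
      = c * entry P (\<Sum>w\<in>Poly_Mapping.keys f. Poly_Mapping.single w (poly_mapping.lookup f w))"
    by (simp add: sum_distrib_left entry_sum mult_single plus_list_def mult_when)
  then show ?thesis by (simp add: sum_monomials)
qed

lemma entry_mon_left: "entry P (mon u * (f :: _ \<Rightarrow>\<^sub>0 'k::field)) = entry (\<lambda>w. P (u @ w)) f"
proof -
  have "entry P (mon u * (\<Sum>w\<in>Poly_Mapping.keys f. Poly_Mapping.single w (poly_mapping.lookup f w)))
      = entry (\<lambda>w. P (u @ w)) (\<Sum>w\<in>Poly_Mapping.keys f. Poly_Mapping.single w (poly_mapping.lookup f w))"
    by (simp add: sum_distrib_left entry_sum mult_single plus_list_def)
  then show ?thesis by (simp add: sum_monomials)
qed

lemma entry_mon_right: "entry P ((f :: _ \<Rightarrow>\<^sub>0 'k::field) * mon u) = entry (\<lambda>w. P (w @ u)) f"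
proof -
  have "entry P ((\<Sum>w\<in>Poly_Mapping.keys f. Poly_Mapping.single w (poly_mapping.lookup f w)) * mon u)
      = entry (\<lambda>w. P (w @ u)) (\<Sum>w\<in>Poly_Mapping.keys f. Poly_Mapping.single w (poly_mapping.lookup f w))"
    by (simp add: sum_distrib_right entry_sum mult_single plus_list_def)
  then show ?thesis by (simp add: sum_monomials)
qed

text \<open>
  The algebra acts on the vector space with basis \<open>verts E \<times> \<nat>\<close>, letters acting by partial
  injections of the basis. Such an action amounts to a bijection between
  \<open>out_arcs E u \<times> \<nat>\<close> and \<open>\<nat> \<times> {1..vertex_weight E \<omega> u}\<close> at every vertex \<open>u\<close> that is not a sink.
\<close>

definition branching_at ::
    "('v, 'e) pre_digraph \<Rightarrow> ('e \<Rightarrow> nat) \<Rightarrow> ('e \<Rightarrow> nat \<Rightarrow> nat \<times> nat) \<Rightarrow> 'v \<Rightarrow> bool" where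
  "branching_at E \<omega> \<theta> u \<longleftrightarrow>
    bij_betw (\<lambda>(\<alpha>, n). \<theta> \<alpha> n) (out_arcs E u \<times> UNIV) (UNIV \<times> {1..vertex_weight E \<omega> u}) \<and>
    (\<forall>\<alpha>\<in>out_arcs E u. \<forall>n. snd (\<theta> \<alpha> n) \<le> \<omega> \<alpha>)"

definition branching ::
    "('v, 'e) pre_digraph \<Rightarrow> ('e \<Rightarrow> nat) \<Rightarrow> ('e \<Rightarrow> nat \<Rightarrow> nat \<times> nat) \<Rightarrow> bool" where
  "branching E \<omega> \<theta> \<longleftrightarrow> (\<forall>u\<in>verts E. \<not> sink E u \<longrightarrow> branching_at E \<omega> \<theta> u)"

text \<open>The basis vector \<open>n\<close> over \<open>head E \<alpha>\<close> goes to the vector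
  \<open>m\<close> over \<open>tail E \<alpha>\<close> through the edge of index \<open>i\<close>
  when \<open>\<theta> \<alpha> n = (m, i)\<close>, and ghosts go back. Bijectivity of the choice is
  then what the two sum relations express: a vector over \<open>head E \<alpha>\<close> takes
  exactly one edge of \<open>\<alpha>\<close>, and a vector over a vertex is reached, for each index
  up to the weight of the vertex, through exactly one arc.\<close>

fun step :: "('v, 'e) pre_digraph \<Rightarrow> ('e \<Rightarrow> nat \<Rightarrow> nat \<times> nat) \<Rightarrow> ('v, 'e) letter \<Rightarrow> ('v \<times> nat) rel" where
  "step E \<theta> (Vertex v) = {((v, n), (v, n)) | n. True}"
| "step E \<theta> (Edge \<alpha> i) = {((head E \<alpha>, n), (tail E \<alpha>, m)) | n m. \<theta> \<alpha> n = (m, i)}"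
| "step E \<theta> (Ghost \<alpha> i) = {((tail E \<alpha>, m), (head E \<alpha>, n)) | n m. \<theta> \<alpha> n = (m, i)}"

text \<open>Words act from the left, so the last letter is applied first.\<close>

primrec act :: "('v, 'e) pre_digraph \<Rightarrow> ('e \<Rightarrow> nat \<Rightarrow> nat \<times> nat) \<Rightarrow> ('v, 'e) letter list \<Rightarrow> ('v \<times> nat) rel" where
  "act E \<theta> [] = Id"
| "act E \<theta> (x # w) = act E \<theta> w O step E \<theta> x"

lemma act_append: "act E \<theta> (u @ w) = act E \<theta> w O act E \<theta> u"
  by (induction u) (simp_all add: O_assoc)

definition act_kernel ::
    "'k::field itself \<Rightarrow> ('v, 'e) pre_digraph \<Rightarrow> ('e \<Rightarrow> nat) \<Rightarrow> ('e \<Rightarrow> nat \<Rightarrow> nat \<times> nat) \<Rightarrow>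
      ('v, 'e, 'k) words_alg set" where
  "act_kernel K E \<omega> \<theta> =
    {f \<in> word_span (letters E \<omega>). \<forall>b. entry (\<lambda>w. b \<in> act E \<theta> w) f = 0}"

lemma edg_gst_mult:
  "edg \<omega> \<alpha> i * gst \<omega> \<alpha> j = (mon [Edge \<alpha> i, Ghost \<alpha> j] when i \<le> \<omega> \<alpha> \<and> j \<le> \<omega> \<alpha>)"
  "gst \<omega> \<alpha> i * edg \<omega> \<beta> i = (mon [Ghost \<alpha> i, Edge \<beta> i] when i \<le> \<omega> \<alpha> \<and> i \<le> \<omega> \<beta>)"
  by (simp_all add: edg_def gst_def mon_mult when_def)

context weighted_graph
begin

context
  fixes \<theta> :: "'e \<Rightarrow> nat \<Rightarrow> nat \<times> nat"
  assumes branching: "branching E \<omega> \<theta>"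
begin

lemma branching_arc:
  assumes "\<alpha> \<in> arcs E"
  shows "branching_at E \<omega> \<theta> (tail E \<alpha>)"
proof -
  have "\<alpha> \<in> out_arcs E (tail E \<alpha>)" using assms by simp
  then have "\<not> sink E (tail E \<alpha>)" by (auto simp: sink_def)
  then show ?thesis
    using branching assms by (simp add: branching_def)
qed

lemma branching_inj:
  assumes "\<theta> \<alpha> n = \<theta> \<beta> m" "\<alpha> \<in> arcs E" "\<beta> \<in> arcs E" "tail E \<alpha> = tail E \<beta>"
  shows "\<alpha> = \<beta> \<and> n = m"
proof -
  have "inj_on (\<lambda>(\<alpha>, n). \<theta> \<alpha> n) (out_arcs E (tail E \<alpha>) \<times> UNIV)"
    using branching_arc[OF assms(2)] by (auto simp: branching_at_def bij_betw_def)
  from inj_onD[OF this, of "(\<alpha>, n)" "(\<beta>, m)"] show ?thesis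
    using assms by simp
qed

lemma branching_le: "\<alpha> \<in> arcs E \<Longrightarrow> \<theta> \<alpha> n = (m, i) \<Longrightarrow> 1 \<le> i \<and> i \<le> \<omega> \<alpha>"
proof -
  assume \<alpha>: "\<alpha> \<in> arcs E" and eq: "\<theta> \<alpha> n = (m, i)"
  have "bij_betw (\<lambda>(\<alpha>, n). \<theta> \<alpha> n) (out_arcs E (tail E \<alpha>) \<times> UNIV)
      (UNIV \<times> {1..vertex_weight E \<omega> (tail E \<alpha>)})"
    using branching_arc[OF \<alpha>] by (simp add: branching_at_def)
  from bij_betw_apply[OF this, of "(\<alpha>, n)"]
  have "\<theta> \<alpha> n \<in> UNIV \<times> {1..vertex_weight E \<omega> (tail E \<alpha>)}"
    using \<alpha> by simp
  moreover have "snd (\<theta> \<alpha> n) \<le> \<omega> \<alpha>"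
    using branching_arc[OF \<alpha>] \<alpha> unfolding branching_at_def by simp
  ultimately show ?thesis using eq by simp
qed

lemma branching_surj:
  assumes "v \<in> verts E" "\<not> sink E v" "i \<in> {1..vertex_weight E \<omega> v}"
  shows "\<exists>\<alpha>\<in>out_arcs E v. \<exists>n. \<theta> \<alpha> n = (m, i)"
proof -
  have "bij_betw (\<lambda>(\<alpha>, n). \<theta> \<alpha> n) (out_arcs E v \<times> UNIV) (UNIV \<times> {1..vertex_weight E \<omega> v})"
    using branching assms(1,2) by (auto simp: branching_def branching_at_def)
  then have "(m, i) \<in> (\<lambda>(\<alpha>, n). \<theta> \<alpha> n) ` (out_arcs E v \<times> UNIV)"
    using assms(3) by (simp add: bij_betw_def)
  then show ?thesis by force
qed

lemma branching_cancel: "\<theta> \<alpha> n = p \<Longrightarrow> \<theta> \<alpha> n' = p \<Longrightarrow> \<alpha> \<in> arcs E \<Longrightarrow> n = n'"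
  using branching_inj[of \<alpha> n \<alpha> n'] by simp

lemma step_right_unique:
  "(b, c) \<in> step E \<theta> x \<Longrightarrow> (b, c') \<in> step E \<theta> x \<Longrightarrow> x \<in> letters E \<omega> \<Longrightarrow> c = c'"
  by (cases x) (auto simp: edges_iff intro: branching_cancel)

lemma step_left_unique:
  "(b, c) \<in> step E \<theta> x \<Longrightarrow> (b', c) \<in> step E \<theta> x \<Longrightarrow> x \<in> letters E \<omega> \<Longrightarrow> b = b'"
  by (cases x) (auto simp: edges_iff intro: branching_cancel)

text \<open>A letter acts by a partial injection, so an entry of a product with a letter is either
  another entry of \<open>f\<close> or zero.\<close>

lemma alg_ideal_act_kernel: "alg_ideal (letters E \<omega>) (act_kernel (K::'k::field itself) E \<omega> \<theta>)"
proof (rule alg_idealI)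
  fix x and f :: "('v, 'e, 'k) words_alg"
  assume x: "x \<in> letters E \<omega>" and f: "f \<in> act_kernel K E \<omega> \<theta>"
  have "entry (\<lambda>w. (b, c) \<in> act E \<theta> ([x] @ w)) f = 0" for b c
  proof (cases "\<exists>c'. (c', c) \<in> step E \<theta> x")
    case True
    then obtain c' where c': "(c', c) \<in> step E \<theta> x" by blast
    have "(b, c) \<in> act E \<theta> w O step E \<theta> x \<longleftrightarrow> (b, c') \<in> act E \<theta> w" for w
      using c' step_left_unique[OF _ c' x] by blast
    then have "(\<lambda>w. (b, c) \<in> act E \<theta> ([x] @ w)) = (\<lambda>w. (b, c') \<in> act E \<theta> w)"
      by simp
    then show ?thesis using f by (simp add: act_kernel_def del: split_paired_All)
  next
    case False
    then have "(\<lambda>w. (b, c) \<in> act E \<theta> ([x] @ w)) = (\<lambda>w. False)"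
      by (auto simp: fun_eq_iff simp del: split_paired_Ex)
    then show ?thesis by (simp only: entry_False)
  qed
  then show "mon [x] * f \<in> act_kernel K E \<omega> \<theta>"
    using x f by (auto simp: act_kernel_def entry_mon_left word_span_mult word_span_single)
  have "entry (\<lambda>w. (b, c) \<in> act E \<theta> (w @ [x])) f = 0" for b c
  proof (cases "\<exists>b'. (b, b') \<in> step E \<theta> x")
    case True
    then obtain b' where b': "(b, b') \<in> step E \<theta> x" by blast
    have "(b, c) \<in> step E \<theta> x O act E \<theta> w \<longleftrightarrow> (b', c) \<in> act E \<theta> w" for w
      using b' step_right_unique[OF _ b' x] by blast
    then have "(\<lambda>w. (b, c) \<in> act E \<theta> (w @ [x])) = (\<lambda>w. (b', c) \<in> act E \<theta> w)"
      by (simp add: act_append)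
    then show ?thesis using f by (simp add: act_kernel_def del: split_paired_All)
  next
    case False
    then have "(\<lambda>w. (b, c) \<in> act E \<theta> (w @ [x])) = (\<lambda>w. False)"
      by (auto simp: fun_eq_iff act_append simp del: split_paired_Ex)
    then show ?thesis by (simp only: entry_False)
  qed
  then show "f * mon [x] \<in> act_kernel K E \<omega> \<theta>"
    using x f by (auto simp: act_kernel_def entry_mon_right word_span_mult word_span_single)
qed (auto simp: act_kernel_def entry_add entry_scale intro: word_span_add word_span_scale)

text \<open>Going along a ghost of \<open>\<alpha>\<close> and back along an edge of
  \<open>\<alpha>\<close> is possible only for \<open>i = j\<close> and returns to the same vector.
  Surjectivity of the choice gives an arc for which this works, and injectivity shows that there is
  only one.\<close>

lemma entry_out_arcs:
  assumes v: "v \<in> verts E" "\<not> sink E v" "finite (out_arcs E v)"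
    and i: "i \<in> {1..vertex_weight E \<omega> v}" "j \<in> {1..vertex_weight E \<omega> v}"
  shows "entry (\<lambda>w. b \<in> act E \<theta> w)
    ((\<Sum>\<alpha>\<in>out_arcs E v. edg \<omega> \<alpha> i * gst \<omega> \<alpha> j) - (if i = j then vtx v else 0)) = (0::'k::field)"
proof -
  obtain u m c where b: "b = ((u, m), c)" by (metis surj_pair)
  define Q where "Q \<alpha> \<longleftrightarrow> i = j \<and> c = (u, m) \<and> u = v \<and> (\<exists>n. \<theta> \<alpha> n = (m, j))" for \<alpha>
  have "entry (\<lambda>w. b \<in> act E \<theta> w) (edg \<omega> \<alpha> i * gst \<omega> \<alpha> j) = ((1::'k) when Q \<alpha>)"
    if \<alpha>: "\<alpha> \<in> out_arcs E v" for \<alpha>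
  proof -
    have "b \<in> act E \<theta> [Edge \<alpha> i, Ghost \<alpha> j] \<longleftrightarrow> Q \<alpha>"
      using \<alpha> by (auto simp: b Q_def dest: branching_cancel intro!: relcompI)
    moreover have "Q \<alpha> \<Longrightarrow> i \<le> \<omega> \<alpha> \<and> j \<le> \<omega> \<alpha>"
      using branching_le[of \<alpha>] \<alpha> by (auto simp: Q_def)
    ultimately show ?thesis
      by (auto simp: edg_gst_mult when_def)
  qed
  then have "entry (\<lambda>w. b \<in> act E \<theta> w)
      ((\<Sum>\<alpha>\<in>out_arcs E v. edg \<omega> \<alpha> i * gst \<omega> \<alpha> j) - (if i = j then vtx v else 0))
    = (\<Sum>\<alpha>\<in>out_arcs E v. 1 when Q \<alpha>) - ((1::'k) when i = j \<and> u = v \<and> c = (u, m))"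
    by (auto simp: entry_diff entry_sum b vtx_def when_def)
  also have "(\<Sum>\<alpha>\<in>out_arcs E v. 1 when Q \<alpha>) = ((1::'k) when i = j \<and> u = v \<and> c = (u, m))"
  proof (cases "i = j \<and> u = v \<and> c = (u, m)")
    case True
    obtain \<gamma> n where \<gamma>: "\<gamma> \<in> out_arcs E v" "\<theta> \<gamma> n = (m, j)"
      using branching_surj[OF v(1,2) i(2)] by blast
    have "Q \<alpha> \<longleftrightarrow> \<alpha> = \<gamma>" if "\<alpha> \<in> out_arcs E v" for \<alpha>
      using \<gamma> that True branching_inj[of \<alpha> _ \<gamma> n] by (auto simp: Q_def)
    then have "(\<Sum>\<alpha>\<in>out_arcs E v. 1 when Q \<alpha>) = (\<Sum>\<alpha>\<in>out_arcs E v. (1::'k) when \<alpha> = \<gamma>)"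
      by (intro sum.cong) auto
    then show ?thesis
      using True \<gamma> v(3) by (simp add: when_def)
  next
    case False
    then have "\<not> Q \<alpha>" for \<alpha> by (auto simp: Q_def)
    then show ?thesis using False by (auto simp: when_def)
  qed
  finally show ?thesis by simp
qed

text \<open>Among arcs with a common tail, an image \<open>(m, i)\<close> determines both the arc
  and the vector, so a nonzero term forces \<open>\<alpha> = \<beta>\<close>. The only index that
  contributes is \<open>snd (\<theta> \<beta> n)\<close>, which lies within the range of
  summation.\<close>

lemma entry_arc_pair:
  assumes arcs: "\<alpha> \<in> arcs E" "\<beta> \<in> arcs E"
  shows "entry (\<lambda>w. b \<in> act E \<theta> w)
    ((\<Sum>i=1..max (\<omega> \<alpha>) (\<omega> \<beta>). gst \<omega> \<alpha> i * edg \<omega> \<beta> i) - (if \<alpha> = \<beta> then vtx (head E \<alpha>) else 0))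
    = (0::'k::field)"
proof -
  obtain u n c where b: "b = ((u, n), c)" by (metis surj_pair)
  define Q where "Q i \<longleftrightarrow> \<alpha> = \<beta> \<and> c = (u, n) \<and> u = head E \<alpha> \<and> i = snd (\<theta> \<beta> n)" for i
  have "entry (\<lambda>w. b \<in> act E \<theta> w) (gst \<omega> \<alpha> i * edg \<omega> \<beta> i) = ((1::'k) when Q i)" for i
  proof -
    have "b \<in> act E \<theta> [Ghost \<alpha> i, Edge \<beta> i] \<longleftrightarrow> Q i"
    proof
      assume "b \<in> act E \<theta> [Ghost \<alpha> i, Edge \<beta> i]"
      then obtain m n' where *: "u = head E \<beta>" "\<theta> \<beta> n = (m, i)" "tail E \<alpha> = tail E \<beta>"
        "\<theta> \<alpha> n' = (m, i)" "c = (head E \<alpha>, n')"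
        by (auto simp: b)
      with branching_inj[of \<alpha> n' \<beta> n] arcs show "Q i"
        by (auto simp: Q_def)
    next
      assume "Q i"
      then have "\<alpha> = \<beta>" "c = (head E \<alpha>, n)" "u = head E \<alpha>" "\<theta> \<alpha> n = (fst (\<theta> \<alpha> n), i)"
        by (auto simp: Q_def)
      then show "b \<in> act E \<theta> [Ghost \<alpha> i, Edge \<beta> i]"
        by (auto simp: b intro!: relcompI)
    qed
    moreover have "Q i \<Longrightarrow> i \<le> \<omega> \<alpha> \<and> i \<le> \<omega> \<beta>"
      using branching_le[OF arcs(1), of n "fst (\<theta> \<alpha> n)" i] by (auto simp: Q_def)
    ultimately show ?thesis
      by (auto simp: edg_gst_mult when_def)
  qed
  then have "entry (\<lambda>w. b \<in> act E \<theta> w)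
      ((\<Sum>i=1..max (\<omega> \<alpha>) (\<omega> \<beta>). gst \<omega> \<alpha> i * edg \<omega> \<beta> i) - (if \<alpha> = \<beta> then vtx (head E \<alpha>) else 0))
    = (\<Sum>i=1..max (\<omega> \<alpha>) (\<omega> \<beta>). 1 when Q i) - ((1::'k) when \<alpha> = \<beta> \<and> u = head E \<alpha> \<and> c = (u, n))"
    by (auto simp: entry_diff entry_sum b vtx_def when_def)
  also have "(\<Sum>i=1..max (\<omega> \<alpha>) (\<omega> \<beta>). 1 when Q i)
      = ((1::'k) when \<alpha> = \<beta> \<and> u = head E \<alpha> \<and> c = (u, n))"
  proof (cases "\<alpha> = \<beta> \<and> u = head E \<alpha> \<and> c = (u, n)")
    case True
    have "snd (\<theta> \<beta> n) \<in> {1..max (\<omega> \<alpha>) (\<omega> \<beta>)}"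
      using branching_le[OF arcs(2), of n "fst (\<theta> \<beta> n)" "snd (\<theta> \<beta> n)"]
      by (simp add: le_max_iff_disj)
    then show ?thesis
      using True by (simp add: Q_def when_def)
  next
    case False
    then have "\<not> Q i" for i by (auto simp: Q_def)
    then show ?thesis using False by (auto simp: when_def)
  qed
  finally show ?thesis by simp
qed

lemma wlpa_subset_act_kernel: "wlpa_ideal (K::'k::field itself) E \<omega> \<subseteq> act_kernel K E \<omega> \<theta>"
proof -
  have "entry (\<lambda>w. b \<in> act E \<theta> w) f = 0" if "f \<in> relations K E \<omega>" for f b
    using that unfolding relations_def
  proof (elim UnE CollectE exE conjE)
    fix v w assume "f = vtx v * vtx w - (if v = w then vtx v else 0)"
    then show ?thesis
      by (cases b) (auto simp: vtx_def mon_mult entry_diff when_def)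
  next
    fix \<alpha> i assume "f = vtx (tail E \<alpha>) * edg \<omega> \<alpha> i - edg \<omega> \<alpha> i"
    then show ?thesis
      by (cases b) (auto simp: vtx_def edg_def mon_mult entry_diff when_def)
  next
    fix \<alpha> i assume "f = edg \<omega> \<alpha> i * vtx (head E \<alpha>) - edg \<omega> \<alpha> i"
    then show ?thesis
      by (cases b) (auto simp: vtx_def edg_def mon_mult entry_diff when_def)
  next
    fix \<alpha> i assume "f = vtx (head E \<alpha>) * gst \<omega> \<alpha> i - gst \<omega> \<alpha> i"
    then show ?thesis
      by (cases b) (auto simp: vtx_def gst_def mon_mult entry_diff when_def)
  next
    fix \<alpha> i assume "f = gst \<omega> \<alpha> i * vtx (tail E \<alpha>) - gst \<omega> \<alpha> i"
    then show ?thesis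
      by (cases b) (auto simp: vtx_def gst_def mon_mult entry_diff when_def)
  qed ((erule ssubst, (rule entry_out_arcs entry_arc_pair; assumption))+)
  then have "relations K E \<omega> \<subseteq> act_kernel K E \<omega> \<theta>"
    using relations_homogeneous(1)[where K = K] by (auto simp: act_kernel_def)
  then show ?thesis
    unfolding wlpa_ideal_def by (rule generated_ideal_minimal[OF alg_ideal_act_kernel])
qed

lemma mon_act_kernel_iff:
  assumes "w \<in> lists (letters E \<omega>)" "w \<noteq> []"
  shows "(mon w :: ('v, 'e, 'k::field) words_alg) \<in> act_kernel K E \<omega> \<theta> \<longleftrightarrow> act E \<theta> w = {}"
  using assms by (auto simp: act_kernel_def word_span_single when_def split: if_splits)

end

text \<open>
  Otherwise the largest graded ideal inside the kernel of the second action would be neither zero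
  nor everything.
\<close>

lemma graded_simple_act:
  assumes simple: "graded_simple (degree_group E \<omega>) (wlpa_component K E \<omega>) (wlpa (K::'k::field itself) E \<omega>)"
    and \<theta>: "branching E \<omega> \<theta>" "branching E \<omega> \<theta>'"
    and w: "w \<in> lists (letters E \<omega>)" "w \<noteq> []"
    and nz: "act E \<theta> w \<noteq> {}"
    and verts: "verts E \<noteq> {}"
  shows "act E \<theta>' w \<noteq> {}"
proof
  assume z: "act E \<theta>' w = {}"
  let ?W = "wlpa_ideal K E \<omega>" and ?J = "hom_core (letters E \<omega>) word_deg (act_kernel K E \<omega> \<theta>')"
  note ker = alg_ideal_act_kernel[OF \<theta>(2), where K = K]
  have J: "alg_ideal (letters E \<omega>) ?J"
    by (rule alg_ideal_hom_core[OF ker word_deg_append])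
  have "?W \<subseteq> ?J"
    using wlpa_subset_act_kernel[OF \<theta>(2)] alg_ideal_subset[OF alg_ideal_wlpa] hom_closed_wlpa
    by (intro hom_core_superset) auto
  moreover have "hom_closed word_deg ?J"
    by (rule hom_closed_hom_core[OF alg_ideal_0[OF ker]])
  moreover have "mon w \<in> ?J"
    using w z mon_act_kernel_iff[OF \<theta>(2) w, where K = K]
    by (auto simp: hom_core_def word_span_single hom_comp_single when_def alg_ideal_0[OF ker])
  moreover have "mon w \<notin> ?W"
    using wlpa_subset_act_kernel[OF \<theta>(1), of K] mon_act_kernel_iff[OF \<theta>(1) w, where K = K] nz
    by blast
  moreover have "?J \<noteq> word_span (letters E \<omega>)"
  proof
    assume eq: "?J = word_span (letters E \<omega>)"
    \<comment> \<open>A vertex acts as the identity on its fibre, so its word stays outside the core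
      and the core is proper.\<close>
    obtain v where v: "v \<in> verts E" using verts by blast
    define u :: "('v, 'e) letter list" where "u = [Vertex v]"
    have u: "u \<in> lists (letters E \<omega>)" "u \<noteq> []" using v by (simp_all add: u_def)
    then have "mon u \<in> ?J"
      unfolding eq by (intro word_span_single)
    then have "hom_comp word_deg (word_deg u) (mon u) \<in> act_kernel K E \<omega> \<theta>'"
      by (simp add: hom_core_def)
    then have "act E \<theta>' u = {}"
      using mon_act_kernel_iff[OF \<theta>(2) u, where K = K] by (simp add: hom_comp_single)
    then show False by (simp add: u_def)
  qed
  ultimately show False
    using simple J unfolding graded_simple_wlpa_iff by blast
qed

end


section \<open>Graded simplicity implies reducibility\<close>

lemma ex_bij_betw_infinite:
  assumes "countable A" "infinite A" "countable B" "infinite B"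
  shows "\<exists>h. bij_betw h A B"
  using to_nat_on_infinite[OF assms(1,2)] to_nat_on_infinite[OF assms(3,4)]
  by (meson bij_betw_inv_into bij_betw_trans)

text \<open>Two bijections are glued. This allows the image of \<open>A\<close> under a choice to be
  prescribed, as long as infinite sets remain on both sides for the rest.\<close>

lemma ex_bij_betw_split:
  assumes "countable A" "infinite A" "countable B" "infinite B"
    and "countable A'" "infinite A'" "countable B'" "infinite B'"
    and "A \<inter> A' = {}" "B \<inter> B' = {}"
  shows "\<exists>h. bij_betw h (A \<union> A') (B \<union> B') \<and> h ` A = B \<and> h ` A' = B'"
proof -
  obtain f g where f: "bij_betw f A B" and g: "bij_betw g A' B'"
    using ex_bij_betw_infinite assms by metis
  define h where "h x = (if x \<in> A then f x else g x)" for x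
  have "bij_betw h A B"
    using f by (rule iffD1[OF bij_betw_cong, rotated]) (simp add: h_def)
  moreover have "bij_betw h A' B'"
    using g by (rule iffD1[OF bij_betw_cong, rotated]) (use assms(9) in \<open>auto simp: h_def\<close>)
  ultimately show ?thesis
    using assms(10) by (intro exI[of _ h]) (auto simp: bij_betw_combine bij_betw_imp_surj_on)
qed

lemma infinite_split:
  assumes "infinite (A :: 'a set)"
  shows "\<exists>B\<subseteq>A. infinite B \<and> infinite (A - B)"
proof -
  obtain f :: "nat \<Rightarrow> 'a" where f: "inj f" "range f \<subseteq> A"
    using infinite_countable_subset[OF assms] by blast
  have *: "infinite (range (\<lambda>n. f (2 * n)))" "infinite (range (\<lambda>n. f (2 * n + 1)))"
    by (auto intro!: range_inj_infinite injI dest: injD[OF f(1)])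
  have "f (2 * n + 1) \<noteq> f (2 * m)" for n m
    using injD[OF f(1), of "2 * n + 1" "2 * m"] by (metis even_mult_iff even_plus_one_iff dvd_refl)
  then have "range (\<lambda>n. f (2 * n + 1)) \<subseteq> A - range (\<lambda>n. f (2 * n))"
    using f(2) by auto
  then have "infinite (A - range (\<lambda>n. f (2 * n)))"
    using *(2) infinite_super by blast
  then show ?thesis
    using *(1) f(2) by (intro exI[of _ "range (\<lambda>n. f (2 * n))"]) auto
qed

lemma image_Int_nonempty: "f ` A \<inter> B \<noteq> {} \<longleftrightarrow> (\<exists>x\<in>A. f x \<in> B)"
  by blast

text \<open>A vector is moved back along \<open>R\<close> and then on along \<open>S\<close>, so
  what counts is a common point of the two domains. This is the shape of the action of an edge word
  times the ghost of another walk with the same end.\<close>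

lemma converse_relcomp_nonempty_iff:
  assumes "\<And>b. b \<in> Domain R \<Longrightarrow> fst b = w"
  shows "R\<inverse> O S \<noteq> {} \<longleftrightarrow> (\<exists>n. (w, n) \<in> Domain R \<and> (w, n) \<in> Domain S)"
proof
  assume "R\<inverse> O S \<noteq> {}"
  then obtain b where "b \<in> Domain R" "b \<in> Domain S" by blast
  moreover from this have "b = (w, snd b)" using assms by (metis prod.collapse)
  ultimately show "\<exists>n. (w, n) \<in> Domain R \<and> (w, n) \<in> Domain S" by metis
qed blast

definition edge_word :: "'e list \<Rightarrow> ('v, 'e) letter list" where
  "edge_word es = map (\<lambda>\<alpha>. Edge \<alpha> 1) es"

definition ghost_word :: "'e list \<Rightarrow> ('v, 'e) letter list" where
  "ghost_word es = rev (map (\<lambda>\<alpha>. Ghost \<alpha> 1) es)"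

lemma act_edge_word_snoc:
  "act E \<theta> (edge_word (es @ [\<gamma>])) = step E \<theta> (Edge \<gamma> 1) O act E \<theta> (edge_word es)"
  by (simp add: edge_word_def act_append)

lemma act_ghost_word: "act E \<theta> (ghost_word es) = (act E \<theta> (edge_word es))\<inverse>"
proof (induction es)
  case (Cons \<gamma> es)
  have "step E \<theta> (Ghost \<gamma> 1) = (step E \<theta> (Edge \<gamma> 1))\<inverse>" by auto
  then show ?case
    using Cons by (simp add: ghost_word_def edge_word_def act_append converse_relcomp)
qed (simp add: ghost_word_def edge_word_def)

lemma act_edge_word_cong:
  "(\<And>\<gamma>. \<gamma> \<in> set es \<Longrightarrow> \<theta> \<gamma> = \<theta>' \<gamma>) \<Longrightarrow> act E \<theta> (edge_word es) = act E \<theta>' (edge_word es)"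
  by (induction es) (simp_all add: edge_word_def)

text \<open>As the last letter is applied first, the domain of the edge word of a walk sits over the
  end \<open>u\<close> of the walk, not over its start.\<close>

definition act_dom :: "('v, 'e) pre_digraph \<Rightarrow> ('e \<Rightarrow> nat \<Rightarrow> nat \<times> nat) \<Rightarrow> 'v \<Rightarrow> 'e list \<Rightarrow> nat set" where
  "act_dom E \<theta> u es = {n. (u, n) \<in> Domain (act E \<theta> (edge_word es))}"

lemma act_dom_Nil [simp]: "act_dom E \<theta> u [] = UNIV"
  by (auto simp: act_dom_def edge_word_def)

text \<open>Separates the choice at the tail of the last arc from the rest of the walk: if no
  earlier arc starts there, the set \<open>act_dom E \<theta> (tail E \<gamma>) es\<close> does not
  depend on that choice.\<close>

lemma act_dom_snoc:
  "act_dom E \<theta> (head E \<gamma>) (es @ [\<gamma>]) = {n. \<theta> \<gamma> n \<in> act_dom E \<theta> (tail E \<gamma>) es \<times> {1}}"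
proof (intro Set.set_eqI)
  fix n
  obtain m i where p: "\<theta> \<gamma> n = (m, i)" by (metis surj_pair)
  have "((head E \<gamma>, n), b) \<in> step E \<theta> (Edge \<gamma> 1) \<longleftrightarrow> b = (tail E \<gamma>, m) \<and> i = 1" for b
    by (auto simp: p)
  then show "n \<in> act_dom E \<theta> (head E \<gamma>) (es @ [\<gamma>]) \<longleftrightarrow>
      n \<in> {n. \<theta> \<gamma> n \<in> act_dom E \<theta> (tail E \<gamma>) es \<times> {1}}"
    unfolding act_dom_def act_edge_word_snoc Domain_iff relcomp_unfold by (simp add: p conj_commute)
qed

lemma Domain_act_edge_word:
  "b \<in> Domain (act E \<theta> (edge_word (es @ [\<gamma>]))) \<Longrightarrow> fst b = head E \<gamma>"
  unfolding act_edge_word_snoc by auto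

lemma act_edge_word_nonempty_iff:
  "act E \<theta> (edge_word (es @ [\<gamma>])) \<noteq> {} \<longleftrightarrow> (\<exists>n. \<theta> \<gamma> n \<in> act_dom E \<theta> (tail E \<gamma>) es \<times> {1})"
proof -
  have "act E \<theta> (edge_word (es @ [\<gamma>])) \<noteq> {} \<longleftrightarrow> act_dom E \<theta> (head E \<gamma>) (es @ [\<gamma>]) \<noteq> {}"
    using Domain_act_edge_word[of _ E \<theta> es \<gamma>] unfolding act_dom_def by force
  then show ?thesis
    by (auto simp: act_dom_snoc)
qed

section \<open>Existence and modification of choices\<close>

lemma branching_at_cong:
  assumes "\<And>\<alpha>. \<alpha> \<in> out_arcs E u \<Longrightarrow> \<theta> \<alpha> = \<theta>' \<alpha>"
  shows "branching_at E \<omega> \<theta> u = branching_at E \<omega> \<theta>' u"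
proof -
  have "bij_betw (\<lambda>(\<alpha>, n). \<theta> \<alpha> n) (out_arcs E u \<times> UNIV) B
      = bij_betw (\<lambda>(\<alpha>, n). \<theta>' \<alpha> n) (out_arcs E u \<times> UNIV) B" for B
    by (rule bij_betw_cong) (use assms in auto)
  then show ?thesis
    using assms by (simp add: branching_at_def)
qed

lemma branching_update:
  assumes "branching E \<omega> \<theta>" "branching_at E \<omega> \<theta>' u"
  shows "branching E \<omega> (\<lambda>\<alpha>. if tail E \<alpha> = u then \<theta>' \<alpha> else \<theta> \<alpha>)"
  unfolding branching_def
proof (intro ballI impI)
  fix v assume v: "v \<in> verts E" "\<not> sink E v"
  show "branching_at E \<omega> (\<lambda>\<alpha>. if tail E \<alpha> = u then \<theta>' \<alpha> else \<theta> \<alpha>) v"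
  proof (cases "v = u")
    case True
    then show ?thesis
      using assms(2) by (subst branching_at_cong[where \<theta>' = \<theta>']) auto
  next
    case False
    then show ?thesis
      using assms(1) v by (subst branching_at_cong[where \<theta>' = \<theta>]) (auto simp: branching_def)
  qed
qed

context weighted_graph
begin

lemma edge_word_letters: "set es \<subseteq> arcs E \<Longrightarrow> edge_word es \<in> lists (letters E \<omega>)"
  and ghost_word_letters: "set es \<subseteq> arcs E \<Longrightarrow> ghost_word es \<in> lists (letters E \<omega>)"
  using weight_pos by (auto simp: edge_word_def ghost_word_def edges_iff subset_iff)

lemma vertex_weight_single: "out_arcs E u = {\<alpha>} \<Longrightarrow> vertex_weight E \<omega> u = \<omega> \<alpha>"
  by (simp add: vertex_weight_def)

lemma branching_at_single:
  assumes "out_arcs E u = {\<alpha>}" "bij_betw h UNIV (UNIV \<times> {1..\<omega> \<alpha>})"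
  shows "branching_at E \<omega> (\<lambda>_. h) u"
proof -
  have "bij_betw (h \<circ> snd) ({\<alpha>} \<times> UNIV) (UNIV \<times> {1..\<omega> \<alpha>})"
    by (rule bij_betw_trans[OF _ assms(2)]) (auto simp: bij_betw_def inj_on_def)
  then have "bij_betw (\<lambda>(\<alpha>, n). h n) ({\<alpha>} \<times> UNIV) (UNIV \<times> {1..\<omega> \<alpha>})"
    by (simp add: comp_def case_prod_beta')
  moreover have "snd (h n) \<le> \<omega> \<alpha>" for n
    using bij_betw_apply[OF assms(2), of n] by auto
  ultimately show ?thesis
    using assms(1) by (simp add: branching_at_def vertex_weight_single)
qed

text \<open>The arc \<open>\<alpha>\<close> of maximal weight may use all indices and takes
  everything outside \<open>D\<close>. The remaining arcs, of which there is at least one, share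
  \<open>D\<close>; as \<open>D\<close> contains only index 1, their possibly smaller weights do no
  harm.\<close>

lemma branching_at_ex_avoiding:
  assumes \<alpha>: "\<alpha> \<in> out_arcs E u" "\<omega> \<alpha> = vertex_weight E \<omega> u" and ne: "out_arcs E u \<noteq> {\<alpha>}"
    and D: "D \<subseteq> UNIV \<times> {1}" "infinite D" "infinite (UNIV \<times> {1..vertex_weight E \<omega> u} - D)"
  shows "\<exists>\<theta>. branching_at E \<omega> \<theta> u \<and> range (\<theta> \<alpha>) = UNIV \<times> {1..vertex_weight E \<omega> u} - D"
proof -
  let ?T = "UNIV \<times> {1..vertex_weight E \<omega> u} :: (nat \<times> nat) set"
  let ?S = "out_arcs E u - {\<alpha>}"
  have one: "1 \<le> vertex_weight E \<omega> u"
    using \<alpha> weight_pos[of \<alpha>] by simp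
  have "?S \<noteq> {}" using \<alpha> ne by blast
  then have inf: "infinite (?S \<times> (UNIV :: nat set))"
    using finite_cartesian_productD2 infinite_UNIV_nat by blast
  have cnt: "countable (?S \<times> (UNIV :: nat set))"
    by (intro countable_SIGMA countable_subset[OF _ countable_arcs, of ?S]) auto
  have inf1: "infinite ({\<alpha>} \<times> (UNIV :: nat set))"
    by (simp add: finite_cartesian_product_iff)
  have "\<exists>h :: 'e \<times> nat \<Rightarrow> nat \<times> nat. bij_betw h ({\<alpha>} \<times> UNIV \<union> ?S \<times> UNIV) ((?T - D) \<union> D) \<and>
      h ` ({\<alpha>} \<times> UNIV) = ?T - D \<and> h ` (?S \<times> UNIV) = D"
    by (rule ex_bij_betw_split[OF _ inf1 _ D(3) cnt inf _ D(2)]) auto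
  then obtain h :: "'e \<times> nat \<Rightarrow> nat \<times> nat" where h: "bij_betw h ({\<alpha>} \<times> UNIV \<union> ?S \<times> UNIV) ((?T - D) \<union> D)"
    "h ` ({\<alpha>} \<times> UNIV) = ?T - D" "h ` (?S \<times> UNIV) = D"
    by blast
  have "{\<alpha>} \<times> UNIV \<union> ?S \<times> UNIV = out_arcs E u \<times> (UNIV :: nat set)"
    using \<alpha>(1) by auto
  moreover have "(?T - D) \<union> D = ?T"
    using D(1) one by auto
  moreover have "snd (h (\<beta>, n)) \<le> \<omega> \<beta>" if "\<beta> \<in> out_arcs E u" for \<beta> n
  proof (cases "\<beta> = \<alpha>")
    case True
    then have "h (\<beta>, n) \<in> ?T" using h(2) by blast
    then show ?thesis using True \<alpha>(2) by auto
  next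
    case False
    then have "h (\<beta>, n) \<in> D" using h(3) that by blast
    then have "snd (h (\<beta>, n)) = 1" using D(1) by auto
    then show ?thesis using weight_pos[of \<beta>] that by simp
  qed
  moreover have "range (\<lambda>n. h (\<alpha>, n)) = ?T - D"
    using h(2) by auto
  ultimately show ?thesis
    using h(1) by (intro exI[of _ "\<lambda>\<beta> n. h (\<beta>, n)"]) (simp add: branching_at_def case_prod_beta')
qed

lemma weighted_verticesD:
  "v \<in> weighted_vertices E \<omega> \<Longrightarrow> v \<in> verts E \<and> \<not> sink E v \<and> 1 < vertex_weight E \<omega> v"
  by (simp add: weighted_vertices_def)

lemma branching_at_ex:
  assumes u: "\<not> sink E u" "finite (out_arcs E u)"
  shows "\<exists>\<theta>. branching_at E \<omega> \<theta> u"
proof -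
  obtain \<alpha> where \<alpha>: "\<alpha> \<in> out_arcs E u" "\<omega> \<alpha> = vertex_weight E \<omega> u"
    using vertex_weight_attained[OF u] by blast
  have one: "1 \<le> \<omega> \<alpha>"
    using \<alpha> weight_pos[of \<alpha>] by simp
  show ?thesis
  proof (cases "out_arcs E u = {\<alpha>}")
    case True
    have "infinite (UNIV \<times> {1..\<omega> \<alpha>} :: (nat \<times> nat) set)"
      using one by (auto simp: finite_cartesian_product_iff)
    then obtain h :: "nat \<Rightarrow> nat \<times> nat" where "bij_betw h UNIV (UNIV \<times> {1..\<omega> \<alpha>})"
      using ex_bij_betw_infinite[of "UNIV :: nat set"] by (metis countableI_type infinite_UNIV_nat)
    then show ?thesis
      using branching_at_single[OF True] by blast
  next
    case False
    have "infinite (UNIV \<times> {1} :: (nat \<times> nat) set)"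
      by (auto simp: finite_cartesian_product_iff)
    \<comment> \<open>Any infinite part of level 1 with infinite complement can serve as the set
      left to the other arcs.\<close>
    then obtain D :: "(nat \<times> nat) set" where D: "D \<subseteq> UNIV \<times> {1}" "infinite D" "infinite (UNIV \<times> {1} - D)"
      using infinite_split by metis
    have "UNIV \<times> {1} - D \<subseteq> UNIV \<times> {1..vertex_weight E \<omega> u} - D"
      using one \<alpha>(2) by auto
    then have "infinite (UNIV \<times> {1..vertex_weight E \<omega> u} - D)"
      using D(3) infinite_super by blast
    then show ?thesis
      using branching_at_ex_avoiding[OF \<alpha> False D(1,2)] by blast
  qed
qed

lemma branching_ex:
  assumes "row_finite E"
  shows "\<exists>\<theta>. branching E \<omega> \<theta>"
proof -
  have "\<exists>\<theta>. \<forall>u\<in>verts E. \<not> sink E u \<longrightarrow> branching_at E \<omega> (\<theta> u) u"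
    using branching_at_ex assms by (intro bchoice) (auto simp: row_finite_def)
  then obtain \<theta> where \<theta>: "\<And>u. u \<in> verts E \<Longrightarrow> \<not> sink E u \<Longrightarrow> branching_at E \<omega> (\<theta> u) u"
    by blast
  have "branching_at E \<omega> (\<lambda>\<alpha>. \<theta> (tail E \<alpha>) \<alpha>) u" if "u \<in> verts E" "\<not> sink E u" for u
    using \<theta>[OF that] by (subst branching_at_cong[where \<theta>' = "\<theta> u"]) auto
  then show ?thesis
    unfolding branching_def by blast
qed

section \<open>The weight forest and shortest walks from weighted vertices\<close>

lemma wf_digraph_edge_graph: "wf_digraph (edge_graph E \<omega>)"
  by unfold_locales (auto simp: edge_graph_def edges_def)

text \<open>Weights do not affect reachability: a walk of arcs lifts to the edges of index 1, and
  edges project to their arcs.\<close>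

lemma weight_forest_iff:
  "u \<in> weight_forest E \<omega> \<longleftrightarrow> (\<exists>v\<in>weighted_vertices E \<omega>. \<exists>es. awalk v es u)"
proof -
  interpret G: wf_digraph "edge_graph E \<omega>" by (rule wf_digraph_edge_graph)
  have [simp]: "verts (edge_graph E \<omega>) = verts E" "arcs (edge_graph E \<omega>) = edges E \<omega>"
    "tail (edge_graph E \<omega>) = tail E \<circ> fst" "head (edge_graph E \<omega>) = head E \<circ> fst"
    by (simp_all add: edge_graph_def)
  have down: "G.cas v p u \<Longrightarrow> cas v (map fst p) u" for v p
    by (induction p arbitrary: v) (auto simp: G.cas.simps cas.simps)
  have up: "cas v es u \<Longrightarrow> G.cas v (map (\<lambda>\<alpha>. (\<alpha>, 1)) es) u" for v es
    by (induction es arbitrary: v) (auto simp: G.cas.simps cas.simps)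
  have arcs: "set p \<subseteq> edges E \<omega> \<Longrightarrow> set (map fst p) \<subseteq> arcs E"
    "set es \<subseteq> arcs E \<Longrightarrow> set (map (\<lambda>\<alpha>. (\<alpha>, 1)) es) \<subseteq> edges E \<omega>" for p es
    using weight_pos by (auto simp: edges_def)
  have "(\<exists>p. G.awalk v p u) \<longleftrightarrow> (\<exists>es. awalk v es u)" for v
  proof
    assume "\<exists>p. G.awalk v p u"
    then obtain p where "G.awalk v p u" ..
    then have "awalk v (map fst p) u"
      using down[of v p] arcs(1)[of p] by (auto simp: G.awalk_def awalk_def)
    then show "\<exists>es. awalk v es u" ..
  next
    assume "\<exists>es. awalk v es u"
    then obtain es where "awalk v es u" ..
    then have "G.awalk v (map (\<lambda>\<alpha>. (\<alpha>, 1)) es) u"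
      using up[of v es] arcs(2)[of es] by (auto simp: G.awalk_def awalk_def)
    then show "\<exists>p. G.awalk v p u" ..
  qed
  then show ?thesis
    by (auto simp: weight_forest_def tree_def)
qed

lemma weighted_in_forest: "v \<in> weighted_vertices E \<omega> \<Longrightarrow> v \<in> weight_forest E \<omega>"
  by (auto simp: weight_forest_iff awalk_Nil_iff weighted_vertices_def intro!: bexI[of _ v] exI[of _ "[]"])

lemma weight_forest_head:
  assumes "\<alpha> \<in> arcs E" "tail E \<alpha> \<in> weight_forest E \<omega>"
  shows "head E \<alpha> \<in> weight_forest E \<omega>"
proof -
  obtain v es where "v \<in> weighted_vertices E \<omega>" "awalk v es (tail E \<alpha>)"
    using assms by (auto simp: weight_forest_iff)
  moreover have "awalk (tail E \<alpha>) [\<alpha>] (head E \<alpha>)"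
    using assms by (rule_tac arc_implies_awalk)
  ultimately show ?thesis
    unfolding weight_forest_iff by (meson awalk_appendI)
qed

text \<open>The minimum is taken over all weighted starting vertices and all ends at once, so that a
  walk can be compared with its prefixes, which end elsewhere.\<close>

lemma shortest_walk:
  assumes "v \<in> weighted_vertices E \<omega>" "awalk v es u" "P es u"
  shows "\<exists>v\<in>weighted_vertices E \<omega>. \<exists>es u. awalk v es u \<and> P es u \<and>
    (\<forall>v'\<in>weighted_vertices E \<omega>. \<forall>es' u'. awalk v' es' u' \<and> P es' u' \<longrightarrow> length es \<le> length es')"
proof -
  define Q where "Q n \<longleftrightarrow> (\<exists>v\<in>weighted_vertices E \<omega>. \<exists>es u. awalk v es u \<and> P es u \<and> length es = n)" for n
  have "Q (length es)" unfolding Q_def using assms by blast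
  then have "Q (LEAST n. Q n)" by (rule LeastI)
  then obtain v' es' u' where *: "v' \<in> weighted_vertices E \<omega>" "awalk v' es' u'" "P es' u'"
    "length es' = (LEAST n. Q n)"
    unfolding Q_def[of "LEAST n. Q n"] by blast
  have "length es' \<le> length xs"
    if "x \<in> weighted_vertices E \<omega>" "awalk x xs y" "P xs y" for x xs y
  proof -
    have "Q (length xs)" unfolding Q_def using that by blast
    then show ?thesis unfolding *(4) by (rule Least_le)
  qed
  then show ?thesis
    using *(1-3) by blast
qed

text \<open>
  The hypothesis says that the walk is forced: at its inner vertices it is the only way to go on.
  Then the edge word of the walk acts on the fibre of its end with infinite domain, and the
  domain has infinite complement since the first vertex has weight at least two.
\<close>

lemma act_dom_walk:
  assumes \<theta>: "branching E \<omega> \<theta>" and v: "v \<in> weighted_vertices E \<omega>"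
  shows "awalk v es u \<Longrightarrow> (\<And>\<gamma>. \<gamma> \<in> set es \<Longrightarrow> out_arcs E (tail E \<gamma>) = {\<gamma>}) \<Longrightarrow>
    infinite (act_dom E \<theta> u es) \<and>
    (es \<noteq> [] \<longrightarrow> infinite (- act_dom E \<theta> u es)) \<and>
    (\<not> sink E u \<longrightarrow> finite (out_arcs E u) \<longrightarrow>
      infinite (UNIV \<times> {1..vertex_weight E \<omega> u} - act_dom E \<theta> u es \<times> {1}))"
proof (induction es arbitrary: u rule: rev_induct)
  case Nil
  then have "u = v" by (auto simp: awalk_Nil_iff)
  then have "1 < vertex_weight E \<omega> u" using weighted_verticesD v by blast
  \<comment> \<open>For the empty walk the domain is the full fibre, with empty complement, so the
    room comes from index 2, which exists because the vertex is weighted.\<close>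
  then have "UNIV \<times> {2} \<subseteq> UNIV \<times> {1..vertex_weight E \<omega> u} - (UNIV :: nat set) \<times> {1}"
    by auto
  moreover have "infinite (UNIV \<times> {2} :: (nat \<times> nat) set)"
    by (auto simp: finite_cartesian_product_iff)
  ultimately have "infinite (UNIV \<times> {1..vertex_weight E \<omega> u} - (UNIV :: nat set) \<times> {1})"
    using infinite_super by blast
  then show ?case by simp
next
  case (snoc \<gamma> es)
  then have u: "u = head E \<gamma>" and walk: "awalk v es (tail E \<gamma>)" and \<gamma>: "\<gamma> \<in> arcs E"
    and out: "out_arcs E (tail E \<gamma>) = {\<gamma>}"
    by (auto simp: awalk_simps)
  let ?T = "UNIV \<times> {1..vertex_weight E \<omega> (tail E \<gamma>)} :: (nat \<times> nat) set"
  let ?D = "act_dom E \<theta> (tail E \<gamma>) es \<times> {1} :: (nat \<times> nat) set"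
  have "\<gamma> \<in> out_arcs E (tail E \<gamma>)" using \<gamma> by simp
  then have ns: "\<not> sink E (tail E \<gamma>)" by (auto simp: sink_def)
  then have IH: "infinite (act_dom E \<theta> (tail E \<gamma>) es)" "infinite (?T - ?D)"
    using snoc.IH[OF walk] snoc.prems(2) out by auto
  then have D: "infinite ?D" by (auto simp: finite_cartesian_product_iff)
  have DT: "?D \<subseteq> ?T"
    using vertex_weight_single[OF out] weight_pos[OF \<gamma>] by auto
  \<comment> \<open>As \<open>\<gamma>\<close> is the only arc at its tail,
    \<open>\<theta> \<gamma>\<close> alone is onto the whole target, so preimages of infinite sets
    are infinite. This turns free room at the tail into a complement at the head.\<close>
  have "bij_betw (\<lambda>(\<alpha>, n). \<theta> \<alpha> n) ({\<gamma>} \<times> UNIV) ?T"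
    using branching_arc[OF \<theta> \<gamma>] out by (simp add: branching_at_def)
  moreover have "(\<lambda>(\<alpha>, n). \<theta> \<alpha> n) ` ({\<gamma>} \<times> UNIV) = range (\<theta> \<gamma>)"
  proof -
    have "{\<gamma>} \<times> (UNIV :: nat set) = Pair \<gamma> ` UNIV" by auto
    then show ?thesis by (simp only: image_image prod.case)
  qed
  ultimately have range: "range (\<theta> \<gamma>) = ?T"
    using bij_betw_imp_surj_on by metis
  have pre: "infinite {n. \<theta> \<gamma> n \<in> A}" if "infinite A" "A \<subseteq> ?T" for A
  proof -
    have "\<theta> \<gamma> ` (\<theta> \<gamma> -` A) = A"
      using that(2) by (simp add: image_vimage_eq range Int_absorb2)
    then show ?thesis
      using that(1) finite_imageI[of "\<theta> \<gamma> -` A" "\<theta> \<gamma>"] by (auto simp: vimage_def)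
  qed
  have dom: "act_dom E \<theta> u (es @ [\<gamma>]) = {n. \<theta> \<gamma> n \<in> ?D}"
    by (simp only: u act_dom_snoc)
  have inf: "infinite (act_dom E \<theta> u (es @ [\<gamma>]))"
    unfolding dom by (rule pre[OF D DT])
  have "\<theta> \<gamma> n \<in> ?T" for n
    unfolding range[symmetric] by (rule rangeI)
  then have codom: "- act_dom E \<theta> u (es @ [\<gamma>]) = {n. \<theta> \<gamma> n \<in> ?T - ?D}"
    unfolding dom by (intro Set.set_eqI) (simp only: Compl_iff mem_Collect_eq Diff_iff simp_thms)
  have coinf: "infinite (- act_dom E \<theta> u (es @ [\<gamma>]))"
    unfolding codom by (rule pre[OF IH(2) Diff_subset])
  have "infinite (UNIV \<times> {1..vertex_weight E \<omega> u} - act_dom E \<theta> u (es @ [\<gamma>]) \<times> {1})"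
    if u': "\<not> sink E u" "finite (out_arcs E u)"
  proof -
    obtain \<alpha> where "\<alpha> \<in> out_arcs E u" "\<omega> \<alpha> = vertex_weight E \<omega> u"
      using vertex_weight_attained[OF u'] by blast
    \<comment> \<open>After at least one edge the complement at level 1 is already infinite, so
      \<open>u\<close> itself may have weight 1.\<close>
    then have "(- act_dom E \<theta> u (es @ [\<gamma>])) \<times> {1}
        \<subseteq> UNIV \<times> {1..vertex_weight E \<omega> u} - act_dom E \<theta> u (es @ [\<gamma>]) \<times> {1}"
      using weight_pos[of \<alpha>] by auto
    moreover have "infinite ((- act_dom E \<theta> u (es @ [\<gamma>])) \<times> {1 :: nat})"
      using coinf by (auto simp: finite_cartesian_product_iff)
    ultimately show ?thesis
      using infinite_super by blast
  qed
  then show ?case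
    using inf coinf by blast
qed

lemma awalk_prefix:
  assumes "awalk v es u" "\<gamma> \<in> set es"
  shows "\<exists>xs ys. es = xs @ \<gamma> # ys \<and> awalk v xs (tail E \<gamma>) \<and> \<gamma> \<in> arcs E \<and> awalk (head E \<gamma>) ys u"
proof -
  obtain xs ys where es: "es = xs @ \<gamma> # ys"
    using assms(2) by (meson split_list)
  then have "awalk v xs (tail E \<gamma>)" "\<gamma> \<in> arcs E" "awalk (head E \<gamma>) ys u"
    using assms(1) by (auto simp: awalk_simps)
  with es show ?thesis by blast
qed

end

section \<open>Reducibility by varying the choice at one vertex\<close>

locale graded_simple_graph = weighted_graph E \<omega> for E :: "('v, 'e) pre_digraph" and \<omega> +
  fixes K :: "'k::field itself"
  assumes row_finite: "row_finite E"
    and simple: "graded_simple (degree_group E \<omega>) (wlpa_component K E \<omega>) (wlpa K E \<omega>)"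
begin

lemma same_zero_words:
  assumes "branching E \<omega> \<theta>" "branching E \<omega> \<theta>'" "w \<in> lists (letters E \<omega>)" "w \<noteq> []"
    "act E \<theta> w \<noteq> {}" "verts E \<noteq> {}"
  shows "act E \<theta>' w \<noteq> {}"
  using graded_simple_act[OF simple] assms by blast

text \<open>A shortest walk to a vertex with two outgoing arcs is forced, so its domain over that
  vertex is infinite with room outside. The word of the walk followed by an arc
  \<open>\<alpha>\<close> is nonzero exactly if the image of \<open>\<alpha>\<close> meets this
  domain at level 1. The other arcs at the vertex can take over a part of it or all of it, which
  gives a nonzero and a zero action of the same word.\<close>

lemma forest_out_unique:
  assumes "u \<in> weight_forest E \<omega>" "\<alpha> \<in> out_arcs E u" "\<beta> \<in> out_arcs E u"
  shows "\<alpha> = \<beta>"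
proof (rule ccontr)
  define P where "P es u \<longleftrightarrow> (\<exists>\<alpha> \<beta>. \<alpha> \<in> out_arcs E u \<and> \<beta> \<in> out_arcs E u \<and> \<alpha> \<noteq> \<beta>)" for es :: "'e list" and u
  assume "\<alpha> \<noteq> \<beta>"
  moreover obtain v0 es0 where "v0 \<in> weighted_vertices E \<omega>" "awalk v0 es0 u"
    using assms(1) by (auto simp: weight_forest_iff)
  ultimately obtain v es u where v: "v \<in> weighted_vertices E \<omega>" and walk: "awalk v es u" and "P es u"
    and least: "\<And>v' es' u'. v' \<in> weighted_vertices E \<omega> \<Longrightarrow> awalk v' es' u' \<Longrightarrow> P es' u' \<Longrightarrow> length es \<le> length es'"
    using shortest_walk[of v0 es0 u P] assms(2,3) unfolding P_def by blast
  have u: "u \<in> verts E" using walk by auto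
  have fin: "finite (out_arcs E u)" using row_finite u by (auto simp: row_finite_def)
  have ns: "\<not> sink E u" using \<open>P es u\<close> by (auto simp: P_def sink_def)
  have forced: "out_arcs E (tail E \<gamma>) = {\<gamma>}" if \<gamma>: "\<gamma> \<in> set es" for \<gamma>
  proof -
    obtain xs ys where xs: "es = xs @ \<gamma> # ys" "awalk v xs (tail E \<gamma>)" "\<gamma> \<in> arcs E"
      using awalk_prefix[OF walk \<gamma>] by blast
    then have "\<not> P xs (tail E \<gamma>)" using least[OF v xs(2)] by auto
    then show ?thesis using xs(3) by (auto simp: P_def)
  qed
  \<comment> \<open>The vertices passed before \<open>u\<close> have a single outgoing arc, so they
    differ from \<open>u\<close>, and changing the choice at \<open>u\<close> leaves the action of
    \<open>es\<close> as it is.\<close>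
  have off: "tail E \<gamma> \<noteq> u" if "\<gamma> \<in> set es" for \<gamma>
    using forced[OF that] \<open>P es u\<close> unfolding P_def by (metis singletonD)
  obtain \<alpha> where \<alpha>: "\<alpha> \<in> out_arcs E u" "\<omega> \<alpha> = vertex_weight E \<omega> u"
    using vertex_weight_attained[OF ns fin] by blast
  have ne: "out_arcs E u \<noteq> {\<alpha>}" using \<open>P es u\<close> unfolding P_def by (metis singletonD)
  obtain \<theta> where \<theta>: "branching E \<omega> \<theta>" using branching_ex row_finite by blast
  let ?T = "UNIV \<times> {1..vertex_weight E \<omega> u} :: (nat \<times> nat) set"
  let ?D = "act_dom E \<theta> u es \<times> {1} :: (nat \<times> nat) set"
  have D: "infinite ?D" "infinite (?T - ?D)"
    using act_dom_walk[OF \<theta> v walk forced] ns fin by (auto simp: finite_cartesian_product_iff)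
  \<comment> \<open>Half of the domain is given to the other arcs, which need an infinite image; the
    other half stays with \<open>\<alpha>\<close> and makes the word nonzero.\<close>
  obtain D' where D': "D' \<subseteq> ?D" "infinite D'" "infinite (?D - D')"
    using infinite_split[OF D(1)] by blast
  have "infinite (?T - D')"
    using infinite_super[OF _ D(2), of "?T - D'"] D'(1) by blast
  then obtain \<theta>1 where \<theta>1: "branching_at E \<omega> \<theta>1 u" "range (\<theta>1 \<alpha>) = ?T - D'"
    using branching_at_ex_avoiding[OF \<alpha> ne, of D'] D' by blast
  obtain \<theta>2 where \<theta>2: "branching_at E \<omega> \<theta>2 u" "range (\<theta>2 \<alpha>) = ?T - ?D"
    using branching_at_ex_avoiding[OF \<alpha> ne, of ?D] D by blast
  let ?upd = "\<lambda>\<theta>' \<gamma>. if tail E \<gamma> = u then \<theta>' \<gamma> else \<theta> \<gamma>"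
  let ?w = "edge_word (es @ [\<alpha>])"
  have dom: "act_dom E (?upd \<theta>') u es = act_dom E \<theta> u es" for \<theta>'
    unfolding act_dom_def using off by (subst act_edge_word_cong[where \<theta>' = \<theta>]) auto
  have nonempty: "act E (?upd \<theta>') ?w \<noteq> {} \<longleftrightarrow> range (\<theta>' \<alpha>) \<inter> ?D \<noteq> {}" for \<theta>'
  proof -
    have "tail E \<alpha> = u" using \<alpha>(1) by simp
    then have "act E (?upd \<theta>') ?w \<noteq> {} \<longleftrightarrow> (\<exists>n. \<theta>' \<alpha> n \<in> ?D)"
      unfolding act_edge_word_nonempty_iff by (simp only: dom simp_thms if_True)
    then show ?thesis by (simp only: image_Int_nonempty bex_UNIV)
  qed
  have "?D - D' \<noteq> {}" using D'(3) by (metis finite.emptyI)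
  moreover have "?D \<subseteq> ?T" using \<alpha> weight_pos[of \<alpha>] by auto
  ultimately have "(?T - D') \<inter> ?D \<noteq> {}" by blast
  then have "act E (?upd \<theta>1) ?w \<noteq> {}"
    unfolding nonempty \<theta>1(2) .
  moreover have "act E (?upd \<theta>2) ?w = {}"
    using nonempty[of \<theta>2] \<theta>2(2) by (simp only: Diff_disjoint Int_commute simp_thms)
  moreover have "?w \<in> lists (letters E \<omega>)" "?w \<noteq> []"
    using \<alpha>(1) walk by (simp_all add: edge_word_letters awalk_def) (simp add: edge_word_def)
  ultimately show False
    using same_zero_words[OF branching_update[OF \<theta> \<theta>1(1)] branching_update[OF \<theta> \<theta>2(1)]] u by blast
qed

text \<open>Once forest vertices have at most one outgoing arc, every walk from a weighted vertex
  satisfies the hypothesis of \<open>act_dom_walk\<close>.\<close>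

lemma forest_forced:
  assumes "v \<in> weighted_vertices E \<omega>" "awalk v es u" "\<gamma> \<in> set es"
  shows "out_arcs E (tail E \<gamma>) = {\<gamma>}"
proof -
  obtain xs where xs: "awalk v xs (tail E \<gamma>)" "\<gamma> \<in> arcs E"
    using awalk_prefix[OF assms(2,3)] by blast
  then have "tail E \<gamma> \<in> weight_forest E \<omega>"
    using assms(1) by (auto simp: weight_forest_iff)
  then show ?thesis
    using forest_out_unique xs(2) by auto
qed

text \<open>The edge word of a walk to \<open>w\<close> is multiplied by the ghost of a second walk
  to \<open>w\<close> whose last arc \<open>\<gamma>\<close> is different. The product is nonzero
  exactly if the bijection at the tail of \<open>\<gamma>\<close> sends some vector in the domain of
  the first walk to one that the second walk continues. These sets and their complements are
  infinite, so a bijection can match them or keep them apart.\<close>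

lemma forest_in_unique:
  assumes \<alpha>: "\<alpha> \<in> in_arcs E w" "tail E \<alpha> \<in> weight_forest E \<omega>"
    and \<beta>: "\<beta> \<in> in_arcs E w" "tail E \<beta> \<in> weight_forest E \<omega>"
  shows "\<alpha> = \<beta>"
proof (rule ccontr)
  assume ne: "\<alpha> \<noteq> \<beta>"
  obtain v0 es0 where v0: "v0 \<in> weighted_vertices E \<omega>" "awalk v0 es0 (tail E \<alpha>)"
    using \<alpha>(2) by (auto simp: weight_forest_iff)
  then have "awalk v0 (es0 @ [\<alpha>]) w"
    using \<alpha>(1) by (auto simp: awalk_simps)
  \<comment> \<open>The walk has to be nonempty, even if \<open>w\<close> is itself weighted, since
    the domain of the empty walk has empty complement.\<close>
  then obtain v es where v: "v \<in> weighted_vertices E \<omega>" and es: "awalk v es w" "es \<noteq> []"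
    and least: "\<And>v' es'. v' \<in> weighted_vertices E \<omega> \<Longrightarrow> awalk v' es' w \<Longrightarrow> es' \<noteq> [] \<Longrightarrow> length es \<le> length es'"
    using shortest_walk[of v0 "es0 @ [\<alpha>]" w "\<lambda>es u. es \<noteq> [] \<and> u = w"] v0(1) by blast
  obtain \<gamma> where \<gamma>: "\<gamma> \<in> in_arcs E w" "tail E \<gamma> \<in> weight_forest E \<omega>" "\<gamma> \<noteq> last es"
    using \<alpha> \<beta> ne by metis
  let ?s = "tail E \<gamma>"
  have \<gamma>_arc: "\<gamma> \<in> arcs E" "head E \<gamma> = w" using \<gamma>(1) by auto
  have out: "out_arcs E ?s = {\<gamma>}"
    using forest_out_unique[OF \<gamma>(2)] \<gamma>_arc by auto
  \<comment> \<open>Otherwise the walk would use \<open>\<gamma>\<close>, the only arc at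
    \<open>?s\<close>, and reach \<open>w\<close> there; by minimality it would end with
    \<open>\<gamma>\<close>, which differs from its last arc.\<close>
  have off_es: "tail E \<delta> \<noteq> ?s" if \<delta>: "\<delta> \<in> set es" for \<delta>
  proof
    assume eq: "tail E \<delta> = ?s"
    obtain xs ys where xs: "es = xs @ \<delta> # ys" "awalk v xs (tail E \<delta>)" "\<delta> \<in> arcs E"
      using awalk_prefix[OF es(1) \<delta>] by blast
    have "\<delta> \<in> out_arcs E ?s" using xs(3) eq by simp
    then have "\<delta> = \<gamma>" using out by blast
    then have "awalk v (xs @ [\<delta>]) w"
      using xs \<gamma>_arc by (auto simp: awalk_simps)
    then have "ys = []"
      using least[OF v, of "xs @ [\<delta>]"] xs(1) by auto
    then show False
      using xs(1) \<open>\<delta> = \<gamma>\<close> \<gamma>(3) by simp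
  qed
  obtain x0 fs0 where "x0 \<in> weighted_vertices E \<omega>" "awalk x0 fs0 ?s"
    using \<gamma>(2) by (auto simp: weight_forest_iff)
  then obtain x fs where x: "x \<in> weighted_vertices E \<omega>" and fs: "awalk x fs ?s"
    and least': "\<And>v' es'. v' \<in> weighted_vertices E \<omega> \<Longrightarrow> awalk v' es' ?s \<Longrightarrow> length fs \<le> length es'"
    using shortest_walk[of x0 fs0 ?s "\<lambda>es u. u = ?s"] by blast
  have off_fs: "tail E \<delta> \<noteq> ?s" if \<delta>: "\<delta> \<in> set fs" for \<delta>
  proof
    assume eq: "tail E \<delta> = ?s"
    obtain xs ys where "fs = xs @ \<delta> # ys" "awalk x xs (tail E \<delta>)"
      using awalk_prefix[OF fs \<delta>] by blast
    then show False
      using least'[OF x, of xs] eq by simp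
  qed
  obtain \<theta> where \<theta>: "branching E \<omega> \<theta>" using branching_ex row_finite by blast
  let ?D = "act_dom E \<theta> w es"
  let ?T = "UNIV \<times> {1..\<omega> \<gamma>} :: (nat \<times> nat) set"
  let ?F = "act_dom E \<theta> ?s fs \<times> {1} :: (nat \<times> nat) set"
  have D: "infinite ?D" "infinite (- ?D)"
    using act_dom_walk[OF \<theta> v es(1) forest_forced[OF v es(1)]] es(2) by auto
  have "\<not> sink E ?s" using out by (simp add: sink_def)
  then have F: "infinite ?F" "infinite (?T - ?F)"
    using act_dom_walk[OF \<theta> x fs forest_forced[OF x fs]] out
    by (auto simp: vertex_weight_single[OF out] finite_cartesian_product_iff)
  have FT: "?F \<subseteq> ?T" using weight_pos[OF \<gamma>_arc(1)] by auto
  have UN: "?D \<union> - ?D = UNIV" "?F \<union> (?T - ?F) = ?T" "(?T - ?F) \<union> ?F = ?T"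
    using FT by auto
  \<comment> \<open>\<open>h1\<close> sends the domain of the first walk onto the vectors that the
    second walk continues, \<open>h2\<close> onto all the others.\<close>
  obtain h1 where h1: "bij_betw h1 UNIV ?T" "h1 ` ?D = ?F"
    using ex_bij_betw_split[of ?D ?F "- ?D" "?T - ?F"] D F unfolding UN by auto
  obtain h2 where h2: "bij_betw h2 UNIV ?T" "h2 ` ?D = ?T - ?F"
    using ex_bij_betw_split[of ?D "?T - ?F" "- ?D" ?F] D F unfolding UN by auto
  let ?upd = "\<lambda>h \<delta>. if tail E \<delta> = ?s then h else \<theta> \<delta>"
  let ?w = "edge_word es @ ghost_word (fs @ [\<gamma>])"
  have nonempty: "act E (?upd h) ?w \<noteq> {} \<longleftrightarrow> h ` ?D \<inter> ?F \<noteq> {}" for h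
  proof -
    let ?R = "act E (?upd h)"
    have es': "?R (edge_word es) = act E \<theta> (edge_word es)"
      using off_es by (intro act_edge_word_cong) auto
    have fs': "?R (edge_word fs) = act E \<theta> (edge_word fs)"
      using off_fs by (intro act_edge_word_cong) auto
    have dom: "act_dom E (?upd h) w (fs @ [\<gamma>]) = {n. h n \<in> ?F}"
      using act_dom_snoc[of E "?upd h" \<gamma> fs] fs' by (simp add: \<gamma>_arc act_dom_def)
    have end_w: "fst b = w" if "b \<in> Domain (?R (edge_word (fs @ [\<gamma>])))" for b
      using Domain_act_edge_word[OF that] \<gamma>_arc(2) by simp
    have word: "?R ?w = (?R (edge_word (fs @ [\<gamma>])))\<inverse> O ?R (edge_word es)"
      by (simp only: act_append act_ghost_word)
    have "?R ?w \<noteq> {} \<longleftrightarrow>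
        (\<exists>n. (w, n) \<in> Domain (?R (edge_word (fs @ [\<gamma>]))) \<and> (w, n) \<in> Domain (?R (edge_word es)))"
      unfolding word by (rule converse_relcomp_nonempty_iff[OF end_w])
    also have "\<dots> \<longleftrightarrow> (\<exists>n. n \<in> act_dom E (?upd h) w (fs @ [\<gamma>]) \<and> n \<in> ?D)"
      by (simp add: act_dom_def es')
    finally show ?thesis
      unfolding dom image_Int_nonempty mem_Collect_eq by (metis (no_types, lifting))
  qed
  have "act E (?upd h1) ?w \<noteq> {}"
    unfolding nonempty h1(2) Int_absorb using F(1) by (metis finite.emptyI)
  moreover have "act E (?upd h2) ?w = {}"
    using nonempty[of h2] h2(2) by (simp only: Diff_disjoint Int_commute simp_thms)
  moreover have "?w \<in> lists (letters E \<omega>)"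
    using es(1) fs \<gamma>_arc(1) edge_word_letters[of es] ghost_word_letters[of "fs @ [\<gamma>]"]
    by (auto simp: awalk_def)
  moreover have "?w \<noteq> []" by (simp add: ghost_word_def)
  moreover have "verts E \<noteq> {}" using es(1) by auto
  moreover have "branching E \<omega> (?upd h1)" "branching E \<omega> (?upd h2)"
    using branching_update[OF \<theta> branching_at_single[OF out h1(1)]]
      branching_update[OF \<theta> branching_at_single[OF out h2(1)]] by simp_all
  ultimately show False
    using same_zero_words by blast
qed

lemma reducible: "reducible E \<omega>"
proof -
  have small: "finite A \<and> card A \<le> 1" if same: "\<And>x y. x \<in> A \<Longrightarrow> y \<in> A \<Longrightarrow> x = y" for A :: "'e set"
  proof (cases "A = {}")
    case False
    then obtain x where "A = {x}" using same by blast
    then show ?thesis by simp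
  qed simp
  show ?thesis
    unfolding reducible_def Let_def
  proof (intro ballI)
    fix v assume v: "v \<in> weight_forest E \<omega>"
    have "finite (out_arcs E v) \<and> card (out_arcs E v) \<le> 1"
      by (rule small) (rule forest_out_unique[OF v])
    moreover have "finite {\<alpha> \<in> in_arcs E v. tail E \<alpha> \<in> weight_forest E \<omega>} \<and>
        card {\<alpha> \<in> in_arcs E v. tail E \<alpha> \<in> weight_forest E \<omega>} \<le> 1"
      by (rule small, unfold mem_Collect_eq, elim conjE) (rule forest_in_unique)
    ultimately show "(finite (out_arcs E v) \<and> card (out_arcs E v) \<le> 1) \<and>
      finite {\<alpha> \<in> in_arcs E v. tail E \<alpha> \<in> weight_forest E \<omega>} \<and>
      card {\<alpha> \<in> in_arcs E v. tail E \<alpha> \<in> weight_forest E \<omega>} \<le> 1"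
      by blast
  qed
qed

end


section \<open>Graded ideals of Leavitt path algebras contain vertices\<close>

text \<open>Left multiplication of a path by a letter, with \<open>None\<close> for zero. A ghost
  applied to a path of length zero need not give a path; \<open>None\<close> is guaranteed to be
  right only at a sink, which is the reason for the hypothesis on ghosts in
  \<open>path_step_cong\<close>.\<close>

fun path_step :: "('v, 'e) pre_digraph \<Rightarrow> ('v, 'e) letter \<Rightarrow> 'v \<times> 'e list \<Rightarrow> ('v \<times> 'e list) option" where
  "path_step E (Vertex u) (v, es) = (if u = v then Some (v, es) else None)"
| "path_step E (Edge \<alpha> i) (v, es) = (if head E \<alpha> = v then Some (tail E \<alpha>, \<alpha> # es) else None)"
| "path_step E (Ghost \<alpha> i) (v, []) = None"
| "path_step E (Ghost \<alpha> i) (v, \<beta> # es) = (if \<alpha> = \<beta> then Some (head E \<alpha>, es) else None)"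

primrec path_run :: "('v, 'e) pre_digraph \<Rightarrow> ('v, 'e) letter list \<Rightarrow> 'v \<times> 'e list \<Rightarrow> ('v \<times> 'e list) option" where
  "path_run E [] p = Some p"
| "path_run E (x # w) p = Option.bind (path_run E w p) (path_step E x)"

lemma path_run_append: "path_run E (u @ w) p = Option.bind (path_run E w p) (path_run E u)"
  by (induction u) (auto simp: bind_assoc)

text \<open>Paths are recorded with their starting vertex, which makes paths of length zero uniform.\<close>

fun path_word :: "'v \<times> 'e list \<Rightarrow> ('v, 'e) letter list" where
  "path_word (v, es) = Vertex v # edge_word es"

definition path_elt :: "('v \<times> 'e list) option \<Rightarrow> ('v, 'e, 'k::field) words_alg" where
  "path_elt p = (case p of None \<Rightarrow> 0 | Some q \<Rightarrow> mon (path_word q))"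

lemma path_elt_simps [simp]: "path_elt None = 0" "path_elt (Some q) = mon (path_word q)"
  by (simp_all add: path_elt_def)

fun is_ghost :: "('v, 'e) letter \<Rightarrow> bool" where
  "is_ghost (Ghost \<alpha> i) = True"
| "is_ghost _ = False"

text \<open>General enough for two gradings on the letters of \<open>F\<close>: the standard one,
  and \<open>letter_deg \<circ> unflip\<close>, in which edges reversed from the forest have
  negative degree.\<close>

definition additive_deg :: "(('v, 'e) letter \<Rightarrow> 'g::ab_group_add) \<Rightarrow> bool" where
  "additive_deg \<delta> \<longleftrightarrow> (\<forall>v. \<delta> (Vertex v) = 0) \<and> (\<forall>\<alpha> i. \<delta> (Ghost \<alpha> i) = - \<delta> (Edge \<alpha> i))"

lemma inj_path_word: "path_word p = path_word q \<longleftrightarrow> p = q"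
proof -
  have "inj (\<lambda>\<alpha>. Edge \<alpha> 1 :: ('a, 'b) letter)" by (auto simp: inj_def)
  then show ?thesis
    by (cases p; cases q) (auto simp: edge_word_def inj_map_eq_map)
qed

locale leavitt_quotient = wlpa_quotient E "\<lambda>_. 1" K I
  for E :: "('v, 'e) pre_digraph" and K :: "'k::field itself" and I +
  assumes row_finite: "row_finite E"
begin

declare One_nat_def [simp del]

abbreviation "L \<equiv> letters E (\<lambda>_. 1)"

lemma unit_edges_iff: "(\<alpha>, i) \<in> edges E (\<lambda>_. 1) \<longleftrightarrow> \<alpha> \<in> arcs E \<and> i = 1"
  by (auto simp: edges_def)

lemma ghost_edge:
  assumes "\<alpha> \<in> arcs E" "\<beta> \<in> arcs E"
  shows "mon [Ghost \<alpha> 1, Edge \<beta> 1] - (if \<alpha> = \<beta> then mon [Vertex (head E \<alpha>)] else 0) \<in> I"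
proof -
  have "(\<Sum>i=1..max 1 1. gst (\<lambda>_. 1) \<alpha> i * edg (\<lambda>_. 1) \<beta> i) - (if \<alpha> = \<beta> then vtx (head E \<alpha>) else 0) \<in> I"
    using assms by (rule arc_rel)
  then show ?thesis
    by (cases "\<alpha> = \<beta>") (simp_all add: gst_def edg_def mon_mult vtx_def)
qed

lemma vertex_expand:
  assumes "v \<in> verts E" "\<not> sink E v"
  shows "(\<Sum>\<alpha>\<in>out_arcs E v. mon [Edge \<alpha> 1, Ghost \<alpha> 1]) - mon [Vertex v] \<in> I"
proof -
  have fin: "finite (out_arcs E v)"
    using row_finite assms(1) by (simp add: row_finite_def)
  have "vertex_weight E (\<lambda>_. 1) v = 1"
    using assms(2) by (simp add: vertex_weight_def sink_def image_constant_conv)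
  then show ?thesis
    using out_rel[OF assms fin, of 1 1] by (simp add: gst_def edg_def mon_mult vtx_def)
qed

lemma path_word_letters:
  assumes "awalk v es z"
  shows "path_word (v, es) \<in> lists L" "edge_word es \<in> lists L"
proof -
  have "v \<in> verts E" "set es \<subseteq> arcs E" using assms by (auto simp: awalk_def)
  then show "path_word (v, es) \<in> lists L" "edge_word es \<in> lists L"
    by (simp_all add: edge_word_letters)
qed

lemma path_step_cong:
  assumes x: "x \<in> L" and walk: "awalk v es z" and g: "is_ghost x \<Longrightarrow> es = [] \<Longrightarrow> sink E v"
  shows "mon (x # path_word (v, es)) - path_elt (path_step E x (v, es)) \<in> I"
proof (cases x)
  case (Vertex u)
  have "mon ([] @ [Vertex u, Vertex v] @ edge_word es) \<in> I" if "u \<noteq> v"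
    by (rule factor_mem) (use that x Vertex walk path_word_letters[OF walk] in \<open>auto intro!: vtx_orth\<close>)
  moreover have "mon ([] @ [Vertex v, Vertex v] @ edge_word es) - mon ([] @ [Vertex v] @ edge_word es) \<in> I"
    by (rule factor_cong) (use walk path_word_letters[OF walk] in \<open>auto intro!: vtx_idem\<close>)
  ultimately show ?thesis
    using Vertex by simp
next
  case (Edge \<alpha> i)
  then have \<alpha>: "\<alpha> \<in> arcs E" "i = 1" using x by (simp_all add: unit_edges_iff)
  have "mon ([] @ [x, Vertex v] @ edge_word es) \<in> I" if "head E \<alpha> \<noteq> v"
    by (rule factor_mem) (use that x Edge walk path_word_letters[OF walk] in \<open>auto intro!: mismatch\<close>)
  moreover have "mon (x # path_word (v, es)) - mon (path_word (tail E \<alpha>, \<alpha> # es)) \<in> I" if "head E \<alpha> = v"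
  proof -
    have 1: "mon ([] @ [x, Vertex (right_end E x)] @ edge_word es) - mon ([] @ [x] @ edge_word es) \<in> I"
      by (rule factor_cong) (use x path_word_letters[OF walk] in \<open>auto intro!: right_unit\<close>)
    have 2: "mon ([] @ [Vertex (left_end E x), x] @ edge_word es) - mon ([] @ [x] @ edge_word es) \<in> I"
      by (rule factor_cong) (use x path_word_letters[OF walk] in \<open>auto intro!: left_unit\<close>)
    show ?thesis
      using diff_trans[OF 1 diff_sym[OF 2]] that \<alpha>(2) by (simp add: Edge edge_word_def)
  qed
  ultimately show ?thesis
    using Edge by auto
next
  case (Ghost \<alpha> i)
  then have \<alpha>: "\<alpha> \<in> arcs E" "i = 1" using x by (simp_all add: unit_edges_iff)
  show ?thesis
  proof (cases es)
    case Nil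
    then have "sink E v" using g Ghost by simp
    then have "tail E \<alpha> \<noteq> v" using \<alpha> by (auto simp: sink_def)
    then have "mon [x, Vertex v] \<in> I"
      by (intro mismatch) (use x Ghost walk in auto)
    then show ?thesis
      using Nil Ghost by (simp add: edge_word_def)
  next
    case (Cons \<beta> es')
    then have \<beta>: "\<beta> \<in> arcs E" "tail E \<beta> = v" "awalk (head E \<beta>) es' z"
      using walk by (auto simp: awalk_simps)
    have \<beta>L: "Edge \<beta> 1 \<in> L" using \<beta>(1) by (simp add: unit_edges_iff)
    note es'L = path_word_letters(2)[OF \<beta>(3)]
    have "mon ([x] @ [Vertex (left_end E (Edge \<beta> 1)), Edge \<beta> 1] @ edge_word es')
        - mon ([x] @ [Edge \<beta> 1] @ edge_word es') \<in> I"
      by (rule factor_cong) (use x \<beta>L es'L in \<open>auto intro!: left_unit simp del: left_end.simps\<close>)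
    then have 1: "mon (x # path_word (v, es)) - mon ([] @ [x, Edge \<beta> 1] @ edge_word es') \<in> I"
      using \<beta>(2) Cons by (simp add: edge_word_def)
    show ?thesis
    proof (cases "\<alpha> = \<beta>")
      case True
      have "mon ([] @ [x, Edge \<beta> 1] @ edge_word es') - mon ([] @ [Vertex (head E \<alpha>)] @ edge_word es') \<in> I"
        by (rule factor_cong) (use ghost_edge[of \<alpha> \<beta>] \<alpha> \<beta>(1) True Ghost es'L in auto)
      then show ?thesis
        using diff_trans[OF 1] True Cons Ghost by simp
    next
      case False
      have "mon ([] @ [x, Edge \<beta> 1] @ edge_word es') \<in> I"
        by (rule factor_mem) (use ghost_edge[of \<alpha> \<beta>] \<alpha> \<beta>(1) False Ghost es'L in auto)
      then show ?thesis
        using mem_cong[OF 1] False Cons Ghost by simp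
    qed
  qed
qed

text \<open>
  Reading a word from the right turns a path that is longer than the number of ghosts into a path
  or into zero, since then no ghost ever meets a path of length zero; at a sink this does no harm.
\<close>

lemma path_run_cong:
  assumes walk: "awalk v es z" and \<delta>: "additive_deg \<delta>"
  shows "w \<in> lists L \<Longrightarrow> length (filter is_ghost w) \<le> length es \<or> sink E z \<Longrightarrow>
    mon (w @ path_word (v, es)) - path_elt (path_run E w (v, es)) \<in> I \<and>
    (\<forall>v' es'. path_run E w (v, es) = Some (v', es') \<longrightarrow> awalk v' es' z \<and>
      length es \<le> length es' + length (filter is_ghost w) \<and>
      sum_list (map \<delta> w) + sum_list (map \<delta> (edge_word es)) = sum_list (map \<delta> (edge_word es')))"
proof (induction w)
  case Nil
  then show ?case
    using walk by (simp add: alg_ideal_0[OF ideal])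
next
  case (Cons x w)
  then have x: "x \<in> L" and IH: "mon (w @ path_word (v, es)) - path_elt (path_run E w (v, es)) \<in> I"
    "\<And>v' es'. path_run E w (v, es) = Some (v', es') \<Longrightarrow> awalk v' es' z \<and>
      length es \<le> length es' + length (filter is_ghost w) \<and>
      sum_list (map \<delta> w) + sum_list (map \<delta> (edge_word es)) = sum_list (map \<delta> (edge_word es'))"
    by (auto split: if_splits)
  have "mon [x] * (mon (w @ path_word (v, es)) - path_elt (path_run E w (v, es))) \<in> I"
    using x by (intro alg_ideal_mon_left[OF ideal] IH) auto
  then have 1: "mon ((x # w) @ path_word (v, es)) - mon [x] * path_elt (path_run E w (v, es)) \<in> I"
    by (simp add: right_diff_distrib mon_mult)
  show ?case
  proof (cases "path_run E w (v, es)")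
    case None
    then show ?thesis using 1 by simp
  next
    case (Some q)
    obtain v1 es1 where q: "q = (v1, es1)" by (metis surj_pair)
    have es1: "awalk v1 es1 z" "length es \<le> length es1 + length (filter is_ghost w)"
      "sum_list (map \<delta> w) + sum_list (map \<delta> (edge_word es)) = sum_list (map \<delta> (edge_word es1))"
      using IH(2)[of v1 es1] Some q by auto
    \<comment> \<open>If the path is used up when a further ghost arrives, the ghosts outnumber the
      edges of \<open>es\<close>; so the alternative in the hypothesis must be that
      \<open>z\<close>, which is now \<open>v1\<close>, is a sink.\<close>
    have sink: "sink E v1" if "is_ghost x" "es1 = []"
      using that es1(1,2) Cons.prems(2) by (auto simp: awalk_Nil_iff)
    have "mon (x # path_word (v1, es1)) - path_elt (path_step E x (v1, es1)) \<in> I"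
      by (rule path_step_cong[OF x es1(1) sink])
    then have "mon ((x # w) @ path_word (v, es)) - path_elt (path_run E (x # w) (v, es)) \<in> I"
      using 1 Some q diff_trans by (simp add: mon_mult)
    moreover have "awalk v' es' z \<and> length es \<le> length es' + length (filter is_ghost (x # w)) \<and>
        sum_list (map \<delta> (x # w)) + sum_list (map \<delta> (edge_word es)) = sum_list (map \<delta> (edge_word es'))"
      if "path_run E (x # w) (v, es) = Some (v', es')" for v' es'
    proof -
      have step: "path_step E x (v1, es1) = Some (v', es')"
        using that Some q by simp
      have "awalk v' es' z \<and> length es1 \<le> length es' + (if is_ghost x then 1 else 0) \<and>
          \<delta> x + sum_list (map \<delta> (edge_word es1)) = sum_list (map \<delta> (edge_word es'))"
        using step x \<delta> es1(1)
        by (cases x; cases es1)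
          (auto simp: awalk_simps edge_word_def additive_deg_def unit_edges_iff split: if_splits)
      then show ?thesis
        using es1(2,3) by (auto simp: add.assoc)
    qed
    ultimately show ?thesis by blast
  qed
qed

text \<open>The ghost of a path times another path is the rest of the latter, or zero if the former
  is not an initial segment. Starting vertices are not compared, which matters for
  \<open>es = []\<close>.\<close>

lemma path_run_ghost_word:
  "awalk v es z \<Longrightarrow> path_run E (ghost_word es) (v, es') =
    (if take (length es) es' = es then Some (z, drop (length es) es') else None)"
proof (induction es arbitrary: v es')
  case Nil
  then show ?case by (simp add: ghost_word_def awalk_Nil_iff)
next
  case (Cons \<alpha> es)
  then have "awalk (head E \<alpha>) es z" by (auto simp: awalk_simps)
  then show ?case
    using Cons.IH by (cases es') (auto simp: ghost_word_def path_run_append)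
qed

lemma right_end_path_word:
  assumes "awalk v es z"
  shows "right_end E (last (path_word (v, es))) = z"
  using assms by (cases es rule: rev_cases) (auto simp: edge_word_def awalk_simps)

lemma path_word_right_unit:
  assumes "awalk v es z"
  shows "mon (path_word (v, es) @ [Vertex z]) - mon (path_word (v, es)) \<in> I"
  using word_right_unit[OF path_word_letters(1)[OF assms]] right_end_path_word[OF assms] by simp

text \<open>A vertex \<open>z\<close> that is not a sink is congruent to the sum of its edges times
  their ghosts, so a product that is nonzero modulo \<open>I\<close> stays nonzero after at least
  one further edge. Only a sink can stop the lengthening.\<close>

lemma ex_long_path:
  assumes f: "f \<in> word_span L" "f \<notin> I"
  shows "\<exists>v \<mu> z. awalk v \<mu> z \<and> (N \<le> length \<mu> \<or> sink E z) \<and> f * mon (path_word (v, \<mu>)) \<notin> I"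
proof (induction N)
  case 0
  obtain v where v: "v \<in> verts E" "f * mon [Vertex v] \<notin> I"
    using ex_vertex_not_mem[OF f] by blast
  then have "awalk v [] v" by (simp add: awalk_Nil_iff)
  moreover have "path_word (v, []) = [Vertex v]" by (simp add: edge_word_def)
  ultimately show ?case using v by (metis le0)
next
  case (Suc N)
  then obtain v \<mu> z where \<mu>: "awalk v \<mu> z" "N \<le> length \<mu> \<or> sink E z" "f * mon (path_word (v, \<mu>)) \<notin> I"
    by blast
  show ?case
  proof (cases "sink E z \<or> Suc N \<le> length \<mu>")
    case True
    then show ?thesis using \<mu> by blast
  next
    case False
    have z: "z \<in> verts E" using \<mu>(1) by auto
    let ?g = "f * mon (path_word (v, \<mu>))"
    have gs: "?g \<in> word_span L"
      using path_word_letters(1)[OF \<mu>(1)] by (intro word_span_mult f(1) word_span_single) auto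
    have "\<exists>\<alpha>\<in>out_arcs E z. ?g * mon [Edge \<alpha> 1] \<notin> I"
    proof (rule ccontr)
      assume contra: "\<not> ?thesis"
      have "?g * mon [Edge \<alpha> 1, Ghost \<alpha> 1] \<in> I" if \<alpha>: "\<alpha> \<in> out_arcs E z" for \<alpha>
      proof -
        have "?g * mon [Edge \<alpha> 1] * mon [Ghost \<alpha> 1] \<in> I"
          by (rule alg_ideal_mon_right[OF ideal]) (use contra \<alpha> in \<open>auto simp: unit_edges_iff\<close>)
        then show ?thesis by (simp add: mult.assoc mon_mult)
      qed
      then have "?g * (\<Sum>\<alpha>\<in>out_arcs E z. mon [Edge \<alpha> 1, Ghost \<alpha> 1]) \<in> I"
        unfolding sum_distrib_left by (rule alg_ideal_sum[OF ideal])
      moreover have "?g * ((\<Sum>\<alpha>\<in>out_arcs E z. mon [Edge \<alpha> 1, Ghost \<alpha> 1]) - mon [Vertex z]) \<in> I"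
        using False z by (intro alg_ideal_mult_left[OF ideal gs] vertex_expand) auto
      then have "?g * (\<Sum>\<alpha>\<in>out_arcs E z. mon [Edge \<alpha> 1, Ghost \<alpha> 1]) - ?g * mon [Vertex z] \<in> I"
        by (simp add: right_diff_distrib)
      ultimately have "?g * mon [Vertex z] \<in> I"
        using mem_cong by blast
      moreover have "f * (mon (path_word (v, \<mu>) @ [Vertex z]) - mon (path_word (v, \<mu>))) \<in> I"
        by (intro alg_ideal_mult_left[OF ideal f(1)] path_word_right_unit \<mu>(1))
      then have "?g * mon [Vertex z] - ?g \<in> I"
        by (simp add: right_diff_distrib mult.assoc mon_mult)
      ultimately show False
        using mem_cong \<mu>(3) by blast
    qed
    then obtain \<alpha> where \<alpha>: "\<alpha> \<in> out_arcs E z" "?g * mon [Edge \<alpha> 1] \<notin> I" by blast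
    have "awalk v (\<mu> @ [\<alpha>]) (head E \<alpha>)"
      using \<mu>(1) \<alpha>(1) by (auto simp: awalk_simps)
    moreover have "f * mon (path_word (v, \<mu> @ [\<alpha>])) \<notin> I"
      using \<alpha>(2) by (simp add: mult.assoc mon_mult edge_word_def)
    moreover have "Suc N \<le> length (\<mu> @ [\<alpha>])"
      using \<mu>(2) False by auto
    ultimately show ?thesis by blast
  qed
qed

text \<open>Multiplication on the right by a long path turns \<open>f\<close> into a combination
  \<open>g\<close> of paths that end at a common vertex \<open>z\<close> and have equal degree. A
  shortest path of \<open>g\<close>, applied as a ghost from the left, kills a path or leaves a
  closed path of degree zero. Such a path is trivial by the hypothesis on cycles, so only the
  shortest path itself contributes, and a nonzero multiple of \<open>z\<close> is left.\<close>

lemma ex_vertex_in_ideal: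
  assumes J: "alg_ideal L J" "I \<subseteq> J"
    and f: "f \<in> J" "f \<notin> I" "\<And>w. w \<in> Poly_Mapping.keys f \<Longrightarrow> sum_list (map \<delta> w) = (d :: 'g::ab_group_add)"
    and \<delta>: "additive_deg \<delta>"
    and cycles: "\<And>v es. awalk v es v \<Longrightarrow> es \<noteq> [] \<Longrightarrow> sum_list (map \<delta> (edge_word es)) \<noteq> 0"
  shows "\<exists>v\<in>verts E. vtx v \<in> J \<and> vtx v \<notin> I"
proof -
  let ?c = "poly_mapping.lookup f"
  have fs: "f \<in> word_span L" by (rule alg_ideal_subset[OF J(1) f(1)])
  then have keys: "w \<in> lists L" if "w \<in> Poly_Mapping.keys f" for w
    using that by (auto simp: word_span_def)
  \<comment> \<open>The bound is crude but uniform: the total length of the words of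
    \<open>f\<close> is at least the number of ghosts in any of them.\<close>
  obtain v \<mu> z where \<mu>: "awalk v \<mu> z" "(\<Sum>w\<in>Poly_Mapping.keys f. length w) \<le> length \<mu> \<or> sink E z"
    "f * mon (path_word (v, \<mu>)) \<notin> I"
    using ex_long_path[OF fs f(2)] by blast
  have long: "length (filter is_ghost w) \<le> length \<mu> \<or> sink E z" if w: "w \<in> Poly_Mapping.keys f" for w
  proof -
    have "length w \<le> (\<Sum>w\<in>Poly_Mapping.keys f. length w)"
      using w by (intro member_le_sum) auto
    then show ?thesis using \<mu>(2) length_filter_le[of is_ghost w] by linarith
  qed
  note run = path_run_cong[OF \<mu>(1) \<delta> keys long]
  define D where "D = d + sum_list (map \<delta> (edge_word \<mu>))"
  define g where "g = (\<Sum>w\<in>Poly_Mapping.keys f. Poly_Mapping.single [] (?c w) * path_elt (path_run E w (v, \<mu>)))"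
  have "(\<Sum>w\<in>Poly_Mapping.keys f. Poly_Mapping.single [] (?c w) *
      (mon (w @ path_word (v, \<mu>)) - path_elt (path_run E w (v, \<mu>)))) \<in> I"
    using run by (intro alg_ideal_sum[OF ideal] alg_ideal_scale[OF ideal]) blast
  also have "(\<Sum>w\<in>Poly_Mapping.keys f. Poly_Mapping.single [] (?c w) *
      (mon (w @ path_word (v, \<mu>)) - path_elt (path_run E w (v, \<mu>))))
    = (\<Sum>w\<in>Poly_Mapping.keys f. Poly_Mapping.single w (?c w)) * mon (path_word (v, \<mu>)) - g"
    by (simp add: g_def right_diff_distrib sum_subtractf sum_distrib_right mult_single plus_list_def)
  finally have fg: "f * mon (path_word (v, \<mu>)) - g \<in> I"
    by (simp add: sum_monomials)
  have "f * mon (path_word (v, \<mu>)) \<in> J"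
    by (rule alg_ideal_mon_right[OF J(1) path_word_letters(1)[OF \<mu>(1)] f(1)])
  then have gJ: "g \<in> J"
    using alg_ideal_diff[OF J(1) _ subsetD[OF J(2) fg]] by fastforce
  have gI: "g \<notin> I"
    using \<mu>(3) mem_cong[OF fg] by blast
  have g_keys: "\<exists>u es. k = path_word (u, es) \<and> awalk u es z \<and> sum_list (map \<delta> (edge_word es)) = D"
    if kg: "k \<in> Poly_Mapping.keys g" for k
  proof -
    obtain w where w: "w \<in> Poly_Mapping.keys f"
      "k \<in> Poly_Mapping.keys (Poly_Mapping.single [] (?c w) * path_elt (path_run E w (v, \<mu>)))"
      using kg keys_sum[of "\<lambda>w. Poly_Mapping.single [] (?c w) * path_elt (path_run E w (v, \<mu>))" "Poly_Mapping.keys f"]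
      unfolding g_def by blast
    then have k: "k \<in> Poly_Mapping.keys (path_elt (path_run E w (v, \<mu>)) :: ('v, 'e, 'k) words_alg)"
      by (simp add: in_keys_iff lookup_scale)
    then obtain u es where "path_run E w (v, \<mu>) = Some (u, es)"
      by (cases "path_run E w (v, \<mu>)") auto
    then show ?thesis
      using run[OF w(1) w(1)] k f(3)[OF w(1)] by (auto simp: D_def)
  qed
  have "g \<noteq> 0" using gI alg_ideal_0[OF ideal] by auto
  then have "Poly_Mapping.keys g \<noteq> {}" by simp
  \<comment> \<open>Minimal length matters because the evaluation of ghosts on a path is justified
    only if the path is at least as long as their number.\<close>
  then obtain k0 where k0: "k0 \<in> Poly_Mapping.keys g"
    "\<And>k. k \<in> Poly_Mapping.keys g \<Longrightarrow> length k0 \<le> length k"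
    using ex_has_least_nat[of "\<lambda>k. k \<in> Poly_Mapping.keys g" _ length] by blast
  obtain u0 es0 where es0: "k0 = path_word (u0, es0)" "awalk u0 es0 z" "sum_list (map \<delta> (edge_word es0)) = D"
    using g_keys[OF k0(1)] by blast
  have z: "z \<in> verts E" using \<mu>(1) by auto
  \<comment> \<open>The vertex \<open>u0\<close> kills paths that start elsewhere, which the ghosts
    cannot detect when \<open>es0\<close> is empty.\<close>
  define q :: "('v, 'e) letter list" where "q = ghost_word es0 @ [Vertex u0]"
  have qL: "q \<in> lists L"
    using es0(2) ghost_word_letters[of es0] by (auto simp: q_def awalk_def)
  have gq: "length (filter is_ghost q) = length es0"
    by (simp add: q_def ghost_word_def rev_filter[symmetric] filter_map comp_def)
  have qk: "mon (q @ k) - (if k = k0 then mon [Vertex z] else 0) \<in> I" if k: "k \<in> Poly_Mapping.keys g" for k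
  proof -
    obtain u es where es: "k = path_word (u, es)" "awalk u es z" "sum_list (map \<delta> (edge_word es)) = D"
      using g_keys[OF k] by blast
    have "length es0 \<le> length es"
      using k0(2)[OF k] by (simp add: es0(1) es(1) edge_word_def)
    then have "mon (q @ k) - path_elt (path_run E q (u, es)) \<in> I"
      using path_run_cong[OF es(2) \<delta> qL] gq es(1) by auto
    moreover have "path_run E q (u, es) = (if k = k0 then Some (z, []) else None)"
    proof (cases "u = u0 \<and> take (length es0) es = es0")
      case True
      then obtain t where t: "es = es0 @ t" by (metis append_take_drop_id)
      \<comment> \<open>Both paths end at \<open>z\<close>, so the remainder is closed; both have
        degree \<open>D\<close>, so it has degree zero.\<close>
      have "awalk z t z"
        using es(2) es0(2) True unfolding t by (metis awalk_append_iff awalk_ends awalk_def cas_ends)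
      moreover have "sum_list (map \<delta> (edge_word t)) = 0"
        using es(3) es0(3) by (simp add: t edge_word_def)
      ultimately have "t = []" using cycles by blast
      then show ?thesis
        using True t es es0 by (simp add: q_def path_run_append path_run_ghost_word[OF es0(2)])
    next
      case False
      then have "k \<noteq> k0"
        unfolding es(1) es0(1) inj_path_word by auto
      moreover have "path_run E q (u, es) = None"
        using False path_run_ghost_word[OF es0(2), of es] by (auto simp: q_def path_run_append)
      ultimately show ?thesis by simp
    qed
    ultimately show ?thesis
      by (auto simp: edge_word_def split: if_splits)
  qed
  let ?e = "poly_mapping.lookup g"
  have "(\<Sum>k\<in>Poly_Mapping.keys g. Poly_Mapping.single [] (?e k) *
      (mon (q @ k) - (if k = k0 then mon [Vertex z] else 0))) \<in> I"
    using qk by (intro alg_ideal_sum[OF ideal] alg_ideal_scale[OF ideal])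
  also have "(\<Sum>k\<in>Poly_Mapping.keys g. Poly_Mapping.single [] (?e k) *
      (mon (q @ k) - (if k = k0 then mon [Vertex z] else 0)))
    = mon q * (\<Sum>k\<in>Poly_Mapping.keys g. Poly_Mapping.single k (?e k))
      - (\<Sum>k\<in>Poly_Mapping.keys g. if k = k0 then Poly_Mapping.single [] (?e k0) * mon [Vertex z] else 0)"
    by (simp add: right_diff_distrib sum_subtractf sum_distrib_left mult_single plus_list_def
        if_distrib[where f = "(*) x" for x] cong: if_cong)
  also have "\<dots> = mon q * g - Poly_Mapping.single [] (?e k0) * mon [Vertex z]"
    using k0(1) by (simp add: sum_monomials)
  finally have "mon q * g - Poly_Mapping.single [] (?e k0) * mon [Vertex z] \<in> J"
    using J(2) by blast
  moreover have "mon q * g \<in> J"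
    by (rule alg_ideal_mon_left[OF J(1) qL gJ])
  ultimately have "Poly_Mapping.single [] (?e k0) * mon [Vertex z] \<in> J"
    using alg_ideal_diff[OF J(1)] by fastforce
  then have "Poly_Mapping.single [] (inverse (?e k0)) * (Poly_Mapping.single [] (?e k0) * mon [Vertex z]) \<in> J"
    by (rule alg_ideal_scale[OF J(1)])
  moreover have "?e k0 \<noteq> 0" using k0(1) by (simp add: in_keys_iff)
  ultimately have "vtx z \<in> J"
    by (simp add: vtx_def mult_single plus_list_def)
  moreover have "vtx z \<notin> I"
  proof
    \<comment> \<open>If \<open>z\<close> were zero modulo \<open>I\<close>, so would be all paths
      that end at \<open>z\<close>, and with them \<open>g\<close>.\<close>
    assume "vtx z \<in> I"
    have "mon k \<in> I" if k: "k \<in> Poly_Mapping.keys g" for k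
    proof -
      obtain u es where es: "k = path_word (u, es)" "awalk u es z"
        using g_keys[OF k] by blast
      have "mon k * vtx z \<in> I"
        using \<open>vtx z \<in> I\<close> path_word_letters(1)[OF es(2)] es(1) by (intro alg_ideal_mon_left[OF ideal]) auto
      then show ?thesis
        using mem_cong[OF path_word_right_unit[OF es(2)]] es(1) by (simp add: vtx_def mon_mult)
    qed
    then have "(\<Sum>k\<in>Poly_Mapping.keys g. Poly_Mapping.single [] (?e k) * mon k) \<in> I"
      by (intro alg_ideal_sum[OF ideal] alg_ideal_scale[OF ideal])
    then show False
      using gI by (simp add: sum_monomials flip: single_conv_scale)
  qed
  ultimately show ?thesis using z by blast
qed

end


section \<open>Isomorphism with the associated graph\<close>

text \<open>The homomorphism of free algebras induced by \<open>\<sigma>\<close>; coefficients of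
  words with the same image are added and may cancel.\<close>

definition rename_word :: "('x \<Rightarrow> 'y) \<Rightarrow> ('x list \<Rightarrow>\<^sub>0 'k::field) \<Rightarrow> ('y list \<Rightarrow>\<^sub>0 'k)" where
  "rename_word \<sigma> f = (\<Sum>w\<in>Poly_Mapping.keys f. Poly_Mapping.single (map \<sigma> w) (poly_mapping.lookup f w))"

lemma rename_word_0 [simp]: "rename_word \<sigma> 0 = 0"
  by (simp add: rename_word_def)

lemma rename_word_single [simp]: "rename_word \<sigma> (Poly_Mapping.single w c) = Poly_Mapping.single (map \<sigma> w) c"
  by (simp add: rename_word_def)

lemma rename_word_add: "rename_word \<sigma> (f + g) = rename_word \<sigma> f + rename_word \<sigma> g"
  unfolding rename_word_def by (rule setsum_keys_plus_distrib) (simp_all add: single_add)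

lemma rename_word_diff: "rename_word \<sigma> (f - g) = rename_word \<sigma> f - rename_word \<sigma> g"
  using rename_word_add[of \<sigma> "f - g" g] by simp

lemma rename_word_sum: "rename_word \<sigma> (sum h A) = (\<Sum>i\<in>A. rename_word \<sigma> (h i))"
  by (induction A rule: infinite_finite_induct) (simp_all add: rename_word_add)

lemma rename_word_mult: "rename_word \<sigma> (f * g) = rename_word \<sigma> f * rename_word \<sigma> g"
proof -
  have "rename_word \<sigma>
      ((\<Sum>u\<in>Poly_Mapping.keys f. Poly_Mapping.single u (poly_mapping.lookup f u)) *
       (\<Sum>w\<in>Poly_Mapping.keys g. Poly_Mapping.single w (poly_mapping.lookup g w)))
    = rename_word \<sigma> (\<Sum>u\<in>Poly_Mapping.keys f. Poly_Mapping.single u (poly_mapping.lookup f u)) *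
      rename_word \<sigma> (\<Sum>w\<in>Poly_Mapping.keys g. Poly_Mapping.single w (poly_mapping.lookup g w))"
    by (simp add: sum_product rename_word_sum mult_single plus_list_def)
  then show ?thesis by (simp only: sum_monomials)
qed

lemma rename_word_word_span:
  assumes "\<sigma> ` X \<subseteq> Y" "f \<in> word_span X"
  shows "rename_word \<sigma> f \<in> word_span Y"
  unfolding rename_word_def
proof (intro word_span_sum word_span_single)
  fix w assume "w \<in> Poly_Mapping.keys f"
  then have "w \<in> lists X" "w \<noteq> []" using assms(2) by (auto simp: word_span_def)
  then show "map \<sigma> w \<in> lists Y" "map \<sigma> w \<noteq> []"
    using assms(1) by (simp_all add: in_lists_conv_set image_subset_iff)
qed

lemma rename_word_inverse:
  assumes "\<And>x. x \<in> X \<Longrightarrow> \<tau> (\<sigma> x) = x" "f \<in> word_span X"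
  shows "rename_word \<tau> (rename_word \<sigma> f) = f"
proof -
  have "map \<tau> (map \<sigma> w) = w" if "w \<in> Poly_Mapping.keys f" for w
    using assms that by (auto simp: word_span_def intro!: map_idI)
  then show ?thesis
    unfolding rename_word_def[of \<sigma>] rename_word_sum rename_word_single
    by (simp add: sum_monomials)
qed

lemma keys_rename_word: "Poly_Mapping.keys (rename_word \<sigma> f) \<subseteq> map \<sigma> ` Poly_Mapping.keys f"
proof -
  have "Poly_Mapping.keys (rename_word \<sigma> f) \<subseteq>
      (\<Union>w\<in>Poly_Mapping.keys f. Poly_Mapping.keys (Poly_Mapping.single (map \<sigma> w) (poly_mapping.lookup f w)))"
    unfolding rename_word_def by (rule keys_sum)
  then show ?thesis by (auto split: if_splits)
qed

lemma alg_ideal_vimage: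
  assumes J: "alg_ideal Y J" and \<sigma>: "\<sigma> ` X \<subseteq> Y"
  shows "alg_ideal X {f \<in> word_span X. rename_word \<sigma> f \<in> J}"
proof (rule alg_idealI)
  fix x f assume x: "x \<in> X" and f: "f \<in> {f \<in> word_span X. rename_word \<sigma> f \<in> J}"
  have "[\<sigma> x] \<in> lists Y" using x \<sigma> by auto
  then show "mon [x] * f \<in> {f \<in> word_span X. rename_word \<sigma> f \<in> J}"
    "f * mon [x] \<in> {f \<in> word_span X. rename_word \<sigma> f \<in> J}"
    using x f by (simp_all add: rename_word_mult word_span_mult word_span_single
        alg_ideal_mon_left[OF J] alg_ideal_mon_right[OF J])
qed (simp_all add: rename_word_add rename_word_mult word_span_add word_span_scale
    alg_ideal_0[OF J] alg_ideal_add[OF J] alg_ideal_scale[OF J] Collect_restrict)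

section \<open>Ideals generated by vertices\<close>

definition vertex_closure ::
    "'k::field itself \<Rightarrow> ('v, 'e) pre_digraph \<Rightarrow> ('e \<Rightarrow> nat) \<Rightarrow> 'v set \<Rightarrow> 'v set" where
  "vertex_closure K E \<omega> H = {v \<in> verts E. vtx v \<in> generated_ideal K (letters E \<omega>) (relations K E \<omega> \<union> vtx ` H)}"

text \<open>A substitute for graded simplicity that does not mention the grading and can therefore
  be moved along an isomorphism that changes it. The set
  \<open>vertex_closure K E \<omega> {}\<close> consists of the vertices that are zero in the
  algebra, so the quantifier ranges over the nonzero ones.\<close>

definition vertex_simple :: "'k::field itself \<Rightarrow> ('v, 'e) pre_digraph \<Rightarrow> ('e \<Rightarrow> nat) \<Rightarrow> bool" where
  "vertex_simple K E \<omega> \<longleftrightarrow> vertex_closure K E \<omega> {} \<noteq> verts E \<and>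
    (\<forall>v\<in>verts E - vertex_closure K E \<omega> {}. vertex_closure K E \<omega> {v} = verts E)"

context weighted_graph
begin

lemma vtx_word_span: "v \<in> verts E \<Longrightarrow> vtx v \<in> word_span (letters E \<omega>)"
  by (simp add: vtx_def word_span_single)

lemma relations_vtx_word_span:
  "H \<subseteq> verts E \<Longrightarrow> relations K E \<omega> \<union> vtx ` H \<subseteq> word_span (letters E \<omega>)"
  using relations_homogeneous(1)[where K = K] by (auto intro: vtx_word_span)

lemma alg_ideal_vertices:
  "H \<subseteq> verts E \<Longrightarrow> alg_ideal (letters E \<omega>) (generated_ideal K (letters E \<omega>) (relations K E \<omega> \<union> vtx ` H))"
  by (rule alg_ideal_generated[OF relations_vtx_word_span])

lemma hom_closed_vertices:
  assumes "H \<subseteq> verts E"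
  shows "hom_closed word_deg (generated_ideal (K::'k::field itself) (letters E \<omega>) (relations K E \<omega> \<union> vtx ` H))"
proof (rule hom_closed_generated[OF relations_vtx_word_span[OF assms]])
  fix f assume "f \<in> relations K E \<omega> \<union> vtx ` H"
  then show "\<exists>d. \<forall>w\<in>Poly_Mapping.keys f. word_deg w = d"
    using relations_homogeneous(2)[where K = K] by (auto simp: vtx_def)
qed (rule word_deg_append)

lemma wlpa_ideal_eq: "wlpa_ideal K E \<omega> = generated_ideal K (letters E \<omega>) (relations K E \<omega> \<union> vtx ` {})"
  by (simp add: wlpa_ideal_def)

text \<open>Vertices have degree zero, so the ideals they generate are graded. By the reduction
  every nonzero graded ideal contains one generated by a nonzero vertex, so only these have to be
  tested, and an ideal is everything as soon as it contains all vertices.\<close>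

lemma graded_simple_iff_vertex_simple:
  fixes K :: "'k::field itself"
  assumes reduction: "\<And>J. alg_ideal (letters E \<omega>) J \<Longrightarrow> wlpa_ideal K E \<omega> \<subseteq> J \<Longrightarrow> hom_closed word_deg J \<Longrightarrow>
    J \<noteq> wlpa_ideal K E \<omega> \<Longrightarrow> \<exists>v\<in>verts E. vtx v \<in> J \<and> vtx v \<notin> wlpa_ideal K E \<omega>"
  shows "graded_simple (degree_group E \<omega>) (wlpa_component K E \<omega>) (wlpa K E \<omega>) \<longleftrightarrow> vertex_simple K E \<omega>"
proof -
  let ?W = "wlpa_ideal K E \<omega>" and ?X = "letters E \<omega>"
  let ?G = "\<lambda>v. generated_ideal K ?X (relations K E \<omega> \<union> vtx ` {v})"
  have full: "J = word_span ?X \<longleftrightarrow> (\<forall>v\<in>verts E. vtx v \<in> J)" if "alg_ideal ?X J" "?W \<subseteq> J" for J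
  proof -
    have "relations K E \<omega> \<subseteq> J"
      using that(2) generated_ideal_base[of "relations K E \<omega>" K ?X] unfolding wlpa_ideal_def by blast
    then interpret J: wlpa_quotient E \<omega> K J
      by (intro wlpa_quotientI that(1)) unfold_locales
    show ?thesis by (rule J.eq_word_span_iff)
  qed
  have WG: "?W \<subseteq> ?G v" for v
    unfolding wlpa_ideal_def by (rule generated_ideal_mono) blast
  have vG: "vtx v \<in> ?G v" for v
    using generated_ideal_base[of "relations K E \<omega> \<union> vtx ` {v}" K ?X] by blast
  have nonzero: "?W \<noteq> word_span ?X \<longleftrightarrow> vertex_closure K E \<omega> {} \<noteq> verts E"
    using full[OF alg_ideal_wlpa] by (auto simp: vertex_closure_def wlpa_ideal_eq)
  have all: "?G v = word_span ?X \<longleftrightarrow> vertex_closure K E \<omega> {v} = verts E" if "v \<in> verts E" for v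
    using full[OF alg_ideal_vertices WG, of v] that by (auto simp: vertex_closure_def)
  have "(\<forall>J. alg_ideal ?X J \<and> ?W \<subseteq> J \<and> hom_closed word_deg J \<longrightarrow> J = ?W \<or> J = word_span ?X) \<longleftrightarrow>
      (\<forall>v\<in>verts E - vertex_closure K E \<omega> {}. ?G v = word_span ?X)" (is "?L \<longleftrightarrow> ?R")
  proof
    assume L: ?L
    show ?R
    proof
      fix v assume v: "v \<in> verts E - vertex_closure K E \<omega> {}"
      then have "alg_ideal ?X (?G v)" "hom_closed word_deg (?G v)"
        by (auto intro!: alg_ideal_vertices hom_closed_vertices simp del: image_insert image_empty)
      then have "?G v = ?W \<or> ?G v = word_span ?X"
        using L WG[of v] by blast
      moreover have "vtx v \<notin> ?W"
        using v by (auto simp: vertex_closure_def wlpa_ideal_eq)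
      ultimately show "?G v = word_span ?X"
        using vG[of v] by auto
    qed
  next
    assume R: ?R
    show ?L
    proof (intro allI impI, elim conjE)
      fix J assume J: "alg_ideal ?X J" "?W \<subseteq> J" "hom_closed word_deg J"
      show "J = ?W \<or> J = word_span ?X"
      proof (rule disjCI)
        assume "J \<noteq> word_span ?X"
        show "J = ?W"
        proof (rule ccontr)
          assume "J \<noteq> ?W"
          then obtain v where v: "v \<in> verts E" "vtx v \<in> J" "vtx v \<notin> ?W"
            using reduction[OF J] by blast
          then have "?G v = word_span ?X"
            using R by (auto simp: vertex_closure_def wlpa_ideal_eq)
          moreover have "relations K E \<omega> \<union> vtx ` {v} \<subseteq> J"
            using v(2) J(2) generated_ideal_base[of "relations K E \<omega>" K ?X] unfolding wlpa_ideal_def by blast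
          then have "?G v \<subseteq> J"
            by (rule generated_ideal_minimal[OF J(1)])
          moreover have "J \<subseteq> word_span ?X"
            using alg_ideal_subset[OF J(1)] by blast
          ultimately show False
            using \<open>J \<noteq> word_span ?X\<close> by blast
        qed
      qed
    qed
  qed
  then show ?thesis
    unfolding graded_simple_wlpa_iff vertex_simple_def nonzero using all by auto
qed

lemma ex_homogeneous_not_mem:
  assumes "hom_closed word_deg J" "f \<in> J" "f \<notin> I" "alg_ideal X I"
  shows "\<exists>d. hom_comp word_deg d f \<in> J \<and> hom_comp word_deg d f \<notin> I"
proof (rule ccontr)
  assume "\<not> ?thesis"
  then have "hom_comp word_deg d f \<in> I" for d
    using assms(1,2) by (auto simp: hom_closed_def)
  then have "(\<Sum>d\<in>word_deg ` Poly_Mapping.keys f. hom_comp word_deg d f) \<in> I"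
    by (intro alg_ideal_sum[OF assms(4)])
  then show False
    using assms(3) by (simp add: sum_hom_comp)
qed

end

lemma lookup_sum_list_single:
  "poly_mapping.lookup (sum_list (map (\<lambda>x. Poly_Mapping.single (g x) (1 :: int)) xs)) k
    = int (length (filter (\<lambda>x. g x = k) xs))"
  by (induction xs) (simp_all add: lookup_add lookup_single when_def)

text \<open>All summands are basis vectors with coefficient 1, so nothing cancels: the coordinate
  belonging to the first element is at least 1.\<close>

lemma sum_list_single_nonzero:
  assumes "xs \<noteq> []"
  shows "sum_list (map (\<lambda>x. Poly_Mapping.single (g x) (1 :: int)) xs) \<noteq> 0"
proof
  assume "sum_list (map (\<lambda>x. Poly_Mapping.single (g x) (1 :: int)) xs) = 0"
  then have "length (filter (\<lambda>x. g x = g (hd xs)) xs) = 0"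
    using lookup_sum_list_single[of g xs "g (hd xs)"] by simp
  then show False
    using assms by (cases xs) auto
qed

section \<open>The outgoing arcs of the associated graph\<close>

locale reducible_graph = weighted_graph E \<omega> for E :: "('v, 'e) pre_digraph" and \<omega> +
  assumes row_finite: "row_finite E" and reducible: "reducible E \<omega>"
begin

abbreviation "Fo \<equiv> weight_forest E \<omega>"
abbreviation "F \<equiv> assoc_graph E \<omega>"
abbreviation "LE \<equiv> letters E \<omega>"
abbreviation "LF \<equiv> letters F (\<lambda>_. 1)"

declare One_nat_def [simp del]

sublocale F: weighted_graph F "\<lambda>_. 1"
  by (rule weighted_graph_assoc_graph) unfold_locales

lemma assoc_graph_simps [simp]:
  "verts F = verts E" "arcs F = edges E \<omega>"
  "tail F (\<alpha>, i) = (if tail E \<alpha> \<in> Fo then head E \<alpha> else tail E \<alpha>)"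
  "head F (\<alpha>, i) = (if tail E \<alpha> \<in> Fo then tail E \<alpha> else head E \<alpha>)"
  by (simp_all add: assoc_graph_def)

lemma eq_if_card_le_1: "finite A \<and> card A \<le> 1 \<Longrightarrow> x \<in> A \<Longrightarrow> y \<in> A \<Longrightarrow> x = y"
  using card_le_Suc0_iff_eq[of A] by (auto simp: One_nat_def)

lemma forest_out:
  assumes "\<alpha> \<in> arcs E" "\<beta> \<in> arcs E" "tail E \<alpha> \<in> Fo" "tail E \<alpha> = tail E \<beta>"
  shows "\<alpha> = \<beta>"
proof -
  have "finite (out_arcs E (tail E \<alpha>)) \<and> card (out_arcs E (tail E \<alpha>)) \<le> 1"
    using reducible assms(3) unfolding reducible_def by blast
  from eq_if_card_le_1[OF this] show ?thesis
    using assms by simp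
qed

lemma forest_in:
  assumes "\<alpha> \<in> arcs E" "\<beta> \<in> arcs E" "tail E \<alpha> \<in> Fo" "tail E \<beta> \<in> Fo" "head E \<alpha> = head E \<beta>"
  shows "\<alpha> = \<beta>"
proof -
  let ?B = "{\<gamma> \<in> in_arcs E (head E \<alpha>). tail E \<gamma> \<in> Fo}"
  have "finite ?B \<and> card ?B \<le> 1"
    using reducible weight_forest_head[OF assms(1,3)] unfolding reducible_def Let_def by blast
  from eq_if_card_le_1[OF this] show ?thesis
    using assms by simp
qed

lemma forest_out_arcs: "\<alpha> \<in> arcs E \<Longrightarrow> tail E \<alpha> \<in> Fo \<Longrightarrow> out_arcs E (tail E \<alpha>) = {\<alpha>}"
  using forest_out by auto

lemma vertex_weight_off_forest:
  assumes "v \<in> verts E" "\<not> sink E v" "v \<notin> Fo"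
  shows "vertex_weight E \<omega> v = 1"
proof -
  have fin: "finite (out_arcs E v)" using row_finite assms(1) by (simp add: row_finite_def)
  obtain \<alpha> where "\<alpha> \<in> out_arcs E v" "\<omega> \<alpha> = vertex_weight E \<omega> v"
    using vertex_weight_attained[OF assms(2) fin] by blast
  then have "1 \<le> vertex_weight E \<omega> v" using weight_pos[of \<alpha>] by simp
  moreover have "v \<notin> weighted_vertices E \<omega>"
    using weighted_in_forest assms(3) by blast
  then have "\<not> 1 < vertex_weight E \<omega> v"
    using assms(1,2) by (simp add: weighted_vertices_def)
  ultimately show ?thesis by simp
qed

lemma weight_off_forest:
  assumes "\<alpha> \<in> arcs E" "tail E \<alpha> \<notin> Fo"
  shows "\<omega> \<alpha> = 1"
proof -
  have \<alpha>: "\<alpha> \<in> out_arcs E (tail E \<alpha>)" using assms by simp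
  then have "\<not> sink E (tail E \<alpha>)" by (auto simp: sink_def)
  then have "vertex_weight E \<omega> (tail E \<alpha>) = 1"
    using assms by (intro vertex_weight_off_forest) auto
  then have "\<omega> \<alpha> \<le> 1"
    using vertex_weight_ge[OF \<alpha>] row_finite assms(1) by (simp add: row_finite_def)
  then show ?thesis using weight_pos[OF assms(1)] by simp
qed

text \<open>Another reversed arc leaving this vertex would enter it from the forest in
  \<open>E\<close>, and an unreversed arc starts outside the forest; so only the reversed edges of
  \<open>\<alpha>\<close> remain. A sum over the indices of \<open>\<alpha>\<close> thereby becomes
  a sum over outgoing arcs of \<open>F\<close>.\<close>

lemma out_arcs_F_head:
  assumes "\<alpha> \<in> arcs E" "tail E \<alpha> \<in> Fo"
  shows "out_arcs F (head E \<alpha>) = Pair \<alpha> ` {1..\<omega> \<alpha>}"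
proof -
  have "tail F (\<beta>, i) = head E \<alpha> \<longleftrightarrow> \<beta> = \<alpha>" if "\<beta> \<in> arcs E" for \<beta> i
  proof (cases "tail E \<beta> \<in> Fo")
    case True
    then show ?thesis using forest_in[of \<beta> \<alpha>] that assms by auto
  next
    case False
    then show ?thesis using weight_forest_head[OF assms] assms(2) by auto
  qed
  then show ?thesis
    using assms by (auto simp: out_arcs_def edges_iff simp del: assoc_graph_simps(3))
qed

text \<open>A reversed arc starts inside the forest, which is closed under passing to heads, and an
  unreversed arc has weight 1 and keeps its tail.\<close>

lemma out_arcs_F_off_forest:
  assumes "v \<notin> Fo"
  shows "out_arcs F v = (\<lambda>\<alpha>. (\<alpha>, 1)) ` out_arcs E v"
proof -
  have "(\<alpha>, i) \<in> out_arcs F v \<longleftrightarrow> \<alpha> \<in> out_arcs E v \<and> i = 1" for \<alpha> i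
  proof (cases "\<alpha> \<in> arcs E")
    case True
    have "tail F (\<alpha>, i) = v \<longleftrightarrow> tail E \<alpha> = v"
      using assms weight_forest_head[OF True] by auto
    moreover have "1 \<le> i \<and> i \<le> \<omega> \<alpha> \<longleftrightarrow> i = 1" if "tail E \<alpha> = v"
      using weight_off_forest[OF True] that assms by auto
    ultimately show ?thesis
      using True by (auto simp: out_arcs_def edges_iff simp del: assoc_graph_simps(3))
  qed (simp add: out_arcs_def edges_iff)
  then show ?thesis
    by (intro Set.set_eqI) (auto simp: image_iff simp del: in_out_arcs_conv)
qed

lemma out_arcs_F_forest:
  assumes "v \<in> Fo" "\<not> sink F v"
  shows "\<exists>\<alpha>\<in>arcs E. tail E \<alpha> \<in> Fo \<and> head E \<alpha> = v"
proof -
  obtain \<alpha> i where "\<alpha> \<in> arcs E" "tail F (\<alpha>, i) = v"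
    using assms(2) by (auto simp: sink_def out_arcs_def edges_iff simp del: assoc_graph_simps(3))
  then show ?thesis
    using assms(1) by (auto split: if_splits)
qed

lemma row_finite_F: "row_finite F"
  unfolding row_finite_def
proof
  fix v assume v: "v \<in> verts F"
  show "finite (out_arcs F v)"
  proof (cases "v \<in> Fo")
    case True
    show ?thesis
    proof (cases "sink F v")
      case False
      then show ?thesis
        using out_arcs_F_forest[OF True] out_arcs_F_head by fastforce
    qed (simp add: sink_def)
  next
    case False
    then show ?thesis
      using row_finite v by (simp add: out_arcs_F_off_forest row_finite_def)
  qed
qed

section \<open>Exchanging edges and ghosts over the forest\<close>

fun flip :: "('v, 'e) letter \<Rightarrow> ('v, 'e \<times> nat) letter" where
  "flip (Vertex v) = Vertex v"
| "flip (Edge \<alpha> i) = (if tail E \<alpha> \<in> Fo then Ghost (\<alpha>, i) 1 else Edge (\<alpha>, i) 1)"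
| "flip (Ghost \<alpha> i) = (if tail E \<alpha> \<in> Fo then Edge (\<alpha>, i) 1 else Ghost (\<alpha>, i) 1)"

fun unflip :: "('v, 'e \<times> nat) letter \<Rightarrow> ('v, 'e) letter" where
  "unflip (Vertex v) = Vertex v"
| "unflip (Edge a j) = (if tail E (fst a) \<in> Fo then Ghost (fst a) (snd a) else Edge (fst a) (snd a))"
| "unflip (Ghost a j) = (if tail E (fst a) \<in> Fo then Edge (fst a) (snd a) else Ghost (fst a) (snd a))"

lemma F_letters_iff: "(a, j) \<in> edges F (\<lambda>_. 1) \<longleftrightarrow> a \<in> edges E \<omega> \<and> j = 1"
  by (auto simp: edges_def)

lemma flip_letters: "flip ` LE \<subseteq> LF"
proof
  fix y assume "y \<in> flip ` LE"
  then obtain x where "x \<in> LE" "y = flip x" by blast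
  then show "y \<in> LF" by (cases x) (auto simp: F_letters_iff)
qed

lemma unflip_letters: "unflip ` LF \<subseteq> LE"
proof
  fix x assume "x \<in> unflip ` LF"
  then obtain y where "y \<in> LF" "x = unflip y" by blast
  then show "x \<in> LE" by (cases y) (auto simp: F_letters_iff)
qed

lemma unflip_flip: "unflip (flip x) = x"
  by (cases x) auto

text \<open>Reversing an arc and exchanging its edges with ghosts are two changes of direction that
  cancel, so the unit relations are carried over as they are.\<close>

lemma flip_ends: "left_end F (flip x) = left_end E x" "right_end F (flip x) = right_end E x"
  by (cases x; simp)+

lemma unflip_ends: "left_end E (unflip y) = left_end F y" "right_end E (unflip y) = right_end F y"
  by (cases y; force)+

text \<open>Over the forest the two sum relations change places: as a forest vertex has at most one
  outgoing arc, the relation at its tail becomes one between a ghost and an edge of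
  \<open>F\<close>, and the sum over the indices of that arc becomes the relation at a vertex of
  \<open>F\<close>. Off the forest all weights are 1 and each relation goes to one of its own
  kind.\<close>

lemma flip_relations:
  fixes K :: "'k::field itself"
  assumes J: "alg_ideal LF J" "relations K F (\<lambda>_. 1) \<subseteq> J" and f: "f \<in> relations K E \<omega>"
  shows "rename_word flip f \<in> J"
proof -
  interpret J: leavitt_quotient F K J
    by (intro leavitt_quotient.intro wlpa_quotientI J leavitt_quotient_axioms.intro row_finite_F) unfold_locales
  have left: "mon [Vertex (left_end E x), flip x] - mon [flip x] \<in> J" if "x \<in> LE" for x
    using J.left_unit[of "flip x"] flip_letters that by (auto simp: flip_ends)
  have right: "mon [flip x, Vertex (right_end E x)] - mon [flip x] \<in> J" if "x \<in> LE" for x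
    using J.right_unit[of "flip x"] flip_letters that by (auto simp: flip_ends)
  note [simp] = rename_word_diff rename_word_sum mon_mult
  show ?thesis
    using f unfolding relations_def
  proof (elim UnE CollectE exE conjE)
    fix v w assume "f = vtx v * vtx w - (if v = w then vtx v else 0)" "v \<in> verts E" "w \<in> verts E"
    then show ?thesis using J.vtx_rel[of v w] by (cases "v = w") (simp_all add: vtx_def)
  next
    fix \<alpha> i assume "f = vtx (tail E \<alpha>) * edg \<omega> \<alpha> i - edg \<omega> \<alpha> i" "(\<alpha>, i) \<in> edges E \<omega>"
    then show ?thesis using left[of "Edge \<alpha> i"] by (simp add: vtx_def edg_eq)
  next
    fix \<alpha> i assume "f = edg \<omega> \<alpha> i * vtx (head E \<alpha>) - edg \<omega> \<alpha> i" "(\<alpha>, i) \<in> edges E \<omega>"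
    then show ?thesis using right[of "Edge \<alpha> i"] by (simp add: vtx_def edg_eq)
  next
    fix \<alpha> i assume "f = vtx (head E \<alpha>) * gst \<omega> \<alpha> i - gst \<omega> \<alpha> i" "(\<alpha>, i) \<in> edges E \<omega>"
    then show ?thesis using left[of "Ghost \<alpha> i"] by (simp add: vtx_def gst_eq)
  next
    fix \<alpha> i assume "f = gst \<omega> \<alpha> i * vtx (tail E \<alpha>) - gst \<omega> \<alpha> i" "(\<alpha>, i) \<in> edges E \<omega>"
    then show ?thesis using right[of "Ghost \<alpha> i"] by (simp add: vtx_def gst_eq)
  next
    fix v i j
    assume f: "f = (\<Sum>\<alpha>\<in>out_arcs E v. edg \<omega> \<alpha> i * gst \<omega> \<alpha> j) - (if i = j then vtx v else 0)"
      and v: "v \<in> verts E" "\<not> sink E v"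
      and ij: "i \<in> {1..vertex_weight E \<omega> v}" "j \<in> {1..vertex_weight E \<omega> v}"
    show ?thesis
    proof (cases "v \<in> Fo")
      case True
      obtain \<alpha> where "\<alpha> \<in> out_arcs E v" using v(2) unfolding sink_def by blast
      then have \<alpha>: "\<alpha> \<in> arcs E" "tail E \<alpha> = v" by simp_all
      then have out: "out_arcs E v = {\<alpha>}" using forest_out_arcs[of \<alpha>] True by simp
      have e: "(\<alpha>, i) \<in> edges E \<omega>" "(\<alpha>, j) \<in> edges E \<omega>"
        using ij \<alpha>(1) by (simp_all add: vertex_weight_single[OF out] edges_iff)
      show ?thesis
        using J.ghost_edge[of "(\<alpha>, i)" "(\<alpha>, j)"] e \<alpha> True f
        by (cases "i = j") (simp_all add: out edg_eq gst_eq vtx_def)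
    next
      case False
      have ij: "i = 1" "j = 1" using ij vertex_weight_off_forest[OF v False] by simp_all
      have "rename_word flip (edg \<omega> \<alpha> i * gst \<omega> \<alpha> j) = (mon [Edge (\<alpha>, 1) 1, Ghost (\<alpha>, 1) 1] :: ('v, 'e \<times> nat, 'k) words_alg)"
        if "\<alpha> \<in> out_arcs E v" for \<alpha>
      proof -
        have "(\<alpha>, 1) \<in> edges E \<omega>" "tail E \<alpha> \<notin> Fo"
          using that False weight_pos[of \<alpha>] by (auto simp: edges_iff)
        then show ?thesis by (simp add: ij edg_eq gst_eq)
      qed
      moreover have "\<not> sink F v" using v(2) by (simp add: sink_def out_arcs_F_off_forest[OF False])
      then have "(\<Sum>\<alpha>\<in>out_arcs E v. mon [Edge (\<alpha>, 1) 1, Ghost (\<alpha>, 1) 1]) - mon [Vertex v] \<in> J"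
        using J.vertex_expand[of v] v(1)
        by (simp add: out_arcs_F_off_forest[OF False] sum.reindex inj_on_def)
      ultimately show ?thesis
        using f ij by (simp add: vtx_def cong: sum.cong_simp)
    qed
  next
    fix \<alpha> \<beta>
    assume f: "f = (\<Sum>i=1..max (\<omega> \<alpha>) (\<omega> \<beta>). gst \<omega> \<alpha> i * edg \<omega> \<beta> i) - (if \<alpha> = \<beta> then vtx (head E \<alpha>) else 0)"
      and arcs: "\<alpha> \<in> arcs E" "\<beta> \<in> arcs E"
    \<comment> \<open>Forest arcs with a common tail coincide, so distinct arcs with a common tail
      start outside the forest. For different tails the letters do not fit together and each term
      vanishes by itself.\<close>
    consider "tail E \<alpha> \<noteq> tail E \<beta>" | "\<alpha> = \<beta>" "tail E \<alpha> \<in> Fo" | "tail E \<alpha> = tail E \<beta>" "tail E \<alpha> \<notin> Fo"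
      using forest_out arcs by blast
    then show ?thesis
    proof cases
      case 1
      have "rename_word flip (gst \<omega> \<alpha> i * edg \<omega> \<beta> i) \<in> J" if i: "i \<in> {1..max (\<omega> \<alpha>) (\<omega> \<beta>)}" for i
      proof (cases "i \<le> \<omega> \<alpha> \<and> i \<le> \<omega> \<beta>")
        case True
        then have e: "(\<alpha>, i) \<in> edges E \<omega>" "(\<beta>, i) \<in> edges E \<omega>"
          using i arcs by (auto simp: edges_iff)
        then have "mon [flip (Ghost \<alpha> i), flip (Edge \<beta> i)] \<in> J"
          using flip_letters 1 by (intro J.mismatch) (auto simp: flip_ends simp del: flip.simps)
        then show ?thesis using e by (simp add: edg_eq gst_eq del: flip.simps)
      next
        case False
        then show ?thesis using alg_ideal_0[OF J(1)] by (auto simp: edg_def gst_def)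
      qed
      then have "(\<Sum>i=1..max (\<omega> \<alpha>) (\<omega> \<beta>). rename_word flip (gst \<omega> \<alpha> i * edg \<omega> \<beta> i)) \<in> J"
        by (rule alg_ideal_sum[OF J(1)])
      moreover have "\<alpha> \<noteq> \<beta>" using 1 by blast
      ultimately show ?thesis
        using f by simp
    next
      case 2
      have "rename_word flip (gst \<omega> \<alpha> i * edg \<omega> \<alpha> i) = (mon [Edge (\<alpha>, i) 1, Ghost (\<alpha>, i) 1] :: ('v, 'e \<times> nat, 'k) words_alg)"
        if "i \<in> {1..\<omega> \<alpha>}" for i
      proof -
        have "(\<alpha>, i) \<in> edges E \<omega>" using that arcs by (simp add: edges_iff)
        then show ?thesis using 2 by (simp add: edg_eq gst_eq)
      qed
      moreover have "\<not> sink F (head E \<alpha>)"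
        using weight_pos[OF arcs(1)] by (simp add: sink_def out_arcs_F_head[OF arcs(1) 2(2)])
      then have "(\<Sum>i=1..\<omega> \<alpha>. mon [Edge (\<alpha>, i) 1, Ghost (\<alpha>, i) 1]) - mon [Vertex (head E \<alpha>)] \<in> J"
        using J.vertex_expand[of "head E \<alpha>"] arcs(1)
        by (simp add: out_arcs_F_head[OF arcs(1) 2(2)] sum.reindex inj_on_def)
      ultimately show ?thesis
        using f 2 by (simp add: vtx_def cong: sum.cong_simp)
    next
      case 3
      have w: "\<omega> \<alpha> = 1" "\<omega> \<beta> = 1" using weight_off_forest 3 arcs by simp_all
      then have e: "(\<alpha>, 1) \<in> edges E \<omega>" "(\<beta>, 1) \<in> edges E \<omega>"
        using arcs by (simp_all add: edges_iff)
      show ?thesis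
        using J.ghost_edge[of "(\<alpha>, 1)" "(\<beta>, 1)"] e 3 f
        by (cases "\<alpha> = \<beta>") (simp_all add: w edg_eq gst_eq vtx_def)
    qed
  qed
qed

lemma unflip_relations:
  fixes K :: "'k::field itself"
  assumes J: "alg_ideal LE J" "relations K E \<omega> \<subseteq> J" and f: "f \<in> relations K F (\<lambda>_. 1)"
  shows "rename_word unflip f \<in> J"
proof -
  interpret J: wlpa_quotient E \<omega> K J
    by (intro wlpa_quotientI J) unfold_locales
  have left: "mon [Vertex (left_end F y), unflip y] - mon [unflip y] \<in> J" if "y \<in> LF" for y
    using J.left_unit[of "unflip y"] unflip_letters that by (auto simp: unflip_ends)
  have right: "mon [unflip y, Vertex (right_end F y)] - mon [unflip y] \<in> J" if "y \<in> LF" for y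
    using J.right_unit[of "unflip y"] unflip_letters that by (auto simp: unflip_ends)
  note [simp] = rename_word_diff rename_word_sum mon_mult
  show ?thesis
    using f unfolding relations_def
  proof (elim UnE CollectE exE conjE)
    fix v w assume "f = vtx v * vtx w - (if v = w then vtx v else 0)" "v \<in> verts F" "w \<in> verts F"
    then show ?thesis using J.vtx_rel[of v w] by (cases "v = w") (simp_all add: vtx_def)
  next
    fix a i assume "f = vtx (tail F a) * edg (\<lambda>_. 1) a i - edg (\<lambda>_. 1) a i" "(a, i) \<in> edges F (\<lambda>_. 1)"
    then show ?thesis using left[of "Edge a i"] by (simp add: vtx_def edg_eq)
  next
    fix a i assume "f = edg (\<lambda>_. 1) a i * vtx (head F a) - edg (\<lambda>_. 1) a i" "(a, i) \<in> edges F (\<lambda>_. 1)"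
    then show ?thesis using right[of "Edge a i"] by (simp add: vtx_def edg_eq)
  next
    fix a i assume "f = vtx (head F a) * gst (\<lambda>_. 1) a i - gst (\<lambda>_. 1) a i" "(a, i) \<in> edges F (\<lambda>_. 1)"
    then show ?thesis using left[of "Ghost a i"] by (simp add: vtx_def gst_eq)
  next
    fix a i assume "f = gst (\<lambda>_. 1) a i * vtx (tail F a) - gst (\<lambda>_. 1) a i" "(a, i) \<in> edges F (\<lambda>_. 1)"
    then show ?thesis using right[of "Ghost a i"] by (simp add: vtx_def gst_eq)
  next
    fix v i j
    assume f: "f = (\<Sum>a\<in>out_arcs F v. edg (\<lambda>_. 1) a i * gst (\<lambda>_. 1) a j) - (if i = j then vtx v else 0)"
      and v: "v \<in> verts F" "\<not> sink F v"
      and ij: "i \<in> {1..vertex_weight F (\<lambda>_. 1) v}" "j \<in> {1..vertex_weight F (\<lambda>_. 1) v}"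
    have "vertex_weight F (\<lambda>_. 1) v = 1"
      using v(2) by (simp add: vertex_weight_def sink_def image_constant_conv)
    then have ij: "i = 1" "j = 1" using ij by simp_all
    have f: "f = (\<Sum>a\<in>out_arcs F v. mon [Edge a 1, Ghost a 1]) - mon [Vertex v]"
      using f by (simp add: ij edg_def gst_def vtx_def)
    show ?thesis
    proof (cases "v \<in> Fo")
      case True
      \<comment> \<open>All arcs of \<open>F\<close> that leave a vertex of the forest are reversed
        edges of one arc of \<open>E\<close>, so the sum over them is the sum over the indices of
        that arc.\<close>
      obtain \<alpha> where \<alpha>: "\<alpha> \<in> arcs E" "tail E \<alpha> \<in> Fo" "head E \<alpha> = v"
        using out_arcs_F_forest[OF True v(2)] by blast
      have "gst \<omega> \<alpha> i * edg \<omega> \<alpha> i = (mon [Ghost \<alpha> i, Edge \<alpha> i] :: ('v, 'e, 'k) words_alg)" if "i \<in> {1..\<omega> \<alpha>}" for i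
        using that by (simp add: edg_gst_mult)
      then have "(\<Sum>i=1..\<omega> \<alpha>. mon [Ghost \<alpha> i, Edge \<alpha> i]) - mon [Vertex v] \<in> J"
        using J.arc_rel[OF \<alpha>(1,1)] \<alpha>(3) by (simp add: vtx_def cong: sum.cong_simp)
      then show ?thesis
        using \<alpha>(2) out_arcs_F_head[OF \<alpha>(1,2)] by (simp add: f \<alpha>(3) sum.reindex inj_on_def)
    next
      case False
      have nsink: "\<not> sink E v" using v(2) by (simp add: sink_def out_arcs_F_off_forest[OF False])
      have vE: "v \<in> verts E" using v(1) by simp
      have fin: "finite (out_arcs E v)" using row_finite vE by (simp add: row_finite_def)
      have "edg \<omega> \<alpha> 1 * gst \<omega> \<alpha> 1 = (mon [Edge \<alpha> 1, Ghost \<alpha> 1] :: ('v, 'e, 'k) words_alg)" if "\<alpha> \<in> out_arcs E v" for \<alpha>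
        using that weight_pos[of \<alpha>] by (simp add: edg_gst_mult)
      then have "(\<Sum>\<alpha>\<in>out_arcs E v. mon [Edge \<alpha> 1, Ghost \<alpha> 1]) - mon [Vertex v] \<in> J"
        using J.out_rel[OF vE nsink fin, of 1 1] vertex_weight_off_forest[OF vE nsink False]
        by (simp add: vtx_def cong: sum.cong_simp)
      moreover have "tail E \<alpha> \<notin> Fo" if "\<alpha> \<in> out_arcs E v" for \<alpha>
        using that False by simp
      ultimately show ?thesis
        by (simp add: f out_arcs_F_off_forest[OF False] sum.reindex inj_on_def cong: sum.cong_simp)
    qed
  next
    fix a b
    assume f: "f = (\<Sum>i=1..max 1 1. gst (\<lambda>_. 1) a i * edg (\<lambda>_. 1) b i) - (if a = b then vtx (head F a) else 0)"
      and arcs: "a \<in> arcs F" "b \<in> arcs F"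
    have f: "f = mon [Ghost a 1, Edge b 1] - (if a = b then mon [Vertex (head F a)] else 0)"
      using f by (simp add: edg_def gst_def vtx_def)
    obtain \<alpha> i \<beta> j where ab: "a = (\<alpha>, i)" "b = (\<beta>, j)" by (metis surj_pair)
    have e: "(\<alpha>, i) \<in> edges E \<omega>" "(\<beta>, j) \<in> edges E \<omega>" using arcs ab by simp_all
    then have \<alpha>\<beta>: "\<alpha> \<in> arcs E" "\<beta> \<in> arcs E" by (simp_all add: edges_iff)
    \<comment> \<open>A reversed and an unreversed arc never share a tail in \<open>F\<close>, as
      only the former has its tail in the forest; reversed ones that do come from forest arcs with
      the same head, which coincide.\<close>
    have "tail F a \<noteq> tail F b \<or> \<alpha> = \<beta> \<and> tail E \<alpha> \<in> Fo
        \<or> tail E \<alpha> = tail E \<beta> \<and> tail E \<alpha> \<notin> Fo \<and> tail E \<beta> \<notin> Fo"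
      using forest_in[OF \<alpha>\<beta>] weight_forest_head[OF \<alpha>\<beta>(1)] weight_forest_head[OF \<alpha>\<beta>(2)]
      by (cases "tail E \<alpha> \<in> Fo"; cases "tail E \<beta> \<in> Fo") (auto simp: ab)
    then consider "tail F a \<noteq> tail F b" | "\<alpha> = \<beta>" "tail E \<alpha> \<in> Fo"
      | "tail E \<alpha> = tail E \<beta>" "tail E \<alpha> \<notin> Fo" "tail E \<beta> \<notin> Fo"
      by blast
    then show ?thesis
    proof cases
      case 1
      have "mon [unflip (Ghost a 1), unflip (Edge b 1)] \<in> J"
      proof (rule J.mismatch)
        show "unflip (Ghost a 1) \<in> LE" "unflip (Edge b 1) \<in> LE"
          using arcs unflip_letters by (auto simp: F_letters_iff simp del: unflip.simps)
        show "right_end E (unflip (Ghost a 1)) \<noteq> left_end E (unflip (Edge b 1))"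
          using 1 by (simp add: unflip_ends del: unflip.simps)
      qed
      moreover have "a \<noteq> b" using 1 by blast
      ultimately show ?thesis by (simp add: f del: unflip.simps)
    next
      case 2
      have out: "out_arcs E (tail E \<alpha>) = {\<alpha>}"
        by (rule forest_out_arcs[OF \<alpha>\<beta>(1) 2(2)])
      then have nsink: "\<not> sink E (tail E \<alpha>)" by (simp add: sink_def)
      have b: "b = (\<alpha>, j)" and "(\<alpha>, j) \<in> edges E \<omega>" using ab(2) e(2) 2(1) by simp_all
      then show ?thesis
        using J.out_rel[of "tail E \<alpha>" i j] nsink 2(2) e(1) \<alpha>\<beta>(1)
        by (cases "i = j")
          (simp_all add: f ab(1) b out vertex_weight_single[OF out] edges_iff edg_gst_mult vtx_def)
    next
      case 3
      have w: "\<omega> \<alpha> = 1" "\<omega> \<beta> = 1" using weight_off_forest 3 \<alpha>\<beta> by simp_all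
      then have ij: "i = 1" "j = 1" using e by (simp_all add: edges_iff)
      show ?thesis
        using J.arc_rel[OF \<alpha>\<beta>] 3
        by (cases "\<alpha> = \<beta>") (simp_all add: f ab ij w edg_gst_mult vtx_def)
    qed
  qed
qed

text \<open>The elements that \<open>flip\<close> carries into the target ideal form an ideal that
  contains the generators, so minimality of the generated ideal suffices.\<close>

lemma flip_generated:
  assumes "H \<subseteq> verts E" "f \<in> generated_ideal (K::'k::field itself) LE (relations K E \<omega> \<union> vtx ` H)"
  shows "rename_word flip f \<in> generated_ideal K LF (relations K F (\<lambda>_. 1) \<union> vtx ` H)" (is "_ \<in> ?J")
proof -
  have J: "alg_ideal LF ?J" using assms(1) by (intro F.alg_ideal_vertices) simp
  have base: "relations K F (\<lambda>_. 1) \<union> vtx ` H \<subseteq> ?J" by (rule generated_ideal_base)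
  have "relations K E \<omega> \<union> vtx ` H \<subseteq> {f \<in> word_span LE. rename_word flip f \<in> ?J}"
    using relations_vtx_word_span[OF assms(1), of K] flip_relations[OF J, where K = K] base
    by (auto simp: vtx_def)
  then have "generated_ideal K LE (relations K E \<omega> \<union> vtx ` H) \<subseteq> {f \<in> word_span LE. rename_word flip f \<in> ?J}"
    by (rule generated_ideal_minimal[OF alg_ideal_vimage[OF J flip_letters]])
  then show ?thesis using assms(2) by blast
qed

lemma unflip_generated:
  assumes "H \<subseteq> verts E" "f \<in> generated_ideal (K::'k::field itself) LF (relations K F (\<lambda>_. 1) \<union> vtx ` H)"
  shows "rename_word unflip f \<in> generated_ideal K LE (relations K E \<omega> \<union> vtx ` H)" (is "_ \<in> ?J")
proof -
  have J: "alg_ideal LE ?J" using assms(1) by (rule alg_ideal_vertices)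
  have base: "relations K E \<omega> \<union> vtx ` H \<subseteq> ?J" by (rule generated_ideal_base)
  have "relations K F (\<lambda>_. 1) \<union> vtx ` H \<subseteq> {f \<in> word_span LF. rename_word unflip f \<in> ?J}"
    using F.relations_vtx_word_span[of H K] assms(1) unflip_relations[OF J, where K = K] base
    by (auto simp: vtx_def)
  then have "generated_ideal K LF (relations K F (\<lambda>_. 1) \<union> vtx ` H) \<subseteq> {f \<in> word_span LF. rename_word unflip f \<in> ?J}"
    by (rule generated_ideal_minimal[OF alg_ideal_vimage[OF J unflip_letters]])
  then show ?thesis using assms(2) by blast
qed

text \<open>Both renamings fix the vertices, so they carry membership of a vertex back and forth
  between the two ideals.\<close>

lemma vertex_closure_F:
  assumes "H \<subseteq> verts E"
  shows "vertex_closure K F (\<lambda>_. 1) H = vertex_closure (K::'k::field itself) E \<omega> H"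
proof -
  have "rename_word flip (vtx v) = (vtx v :: ('v, 'e \<times> nat, 'k) words_alg)"
    "rename_word unflip (vtx v) = (vtx v :: ('v, 'e, 'k) words_alg)" for v
    by (simp_all add: vtx_def)
  then show ?thesis
    using flip_generated[OF assms, where K = K] unflip_generated[OF assms, where K = K]
    unfolding vertex_closure_def assoc_graph_simps by (metis (no_types, lifting))
qed

lemma vertex_simple_F: "vertex_simple K F (\<lambda>_. 1) \<longleftrightarrow> vertex_simple K E \<omega>"
  by (simp add: vertex_simple_def vertex_closure_F)

section \<open>Reduction to vertices for the two gradings\<close>

lemma leavitt_quotient_F: "leavitt_quotient F K (wlpa_ideal K F (\<lambda>_. 1))"
  by (intro leavitt_quotient.intro F.wlpa_quotient_wlpa leavitt_quotient_axioms.intro row_finite_F)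

text \<open>In the standard grading of \<open>F\<close> the degree of a path is its length times the
  basis vector of index 1, so nontrivial closed paths have nonzero degree and the reduction to a
  vertex applies.\<close>

lemma graded_simple_F_iff:
  "graded_simple (degree_group F (\<lambda>_. 1)) (wlpa_component K F (\<lambda>_. 1)) (wlpa (K::'k::field itself) F (\<lambda>_. 1))
    \<longleftrightarrow> vertex_simple K F (\<lambda>_. 1)"
proof (rule F.graded_simple_iff_vertex_simple)
  fix J assume J: "alg_ideal LF J" "wlpa_ideal K F (\<lambda>_. 1) \<subseteq> J" "hom_closed word_deg J"
    "J \<noteq> wlpa_ideal K F (\<lambda>_. 1)"
  interpret W: leavitt_quotient F K "wlpa_ideal K F (\<lambda>_. 1)"
    by (rule leavitt_quotient_F)
  obtain f where "f \<in> J" "f \<notin> wlpa_ideal K F (\<lambda>_. 1)" using J(2,4) by blast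
  then obtain d where d: "hom_comp word_deg d f \<in> J" "hom_comp word_deg d f \<notin> wlpa_ideal K F (\<lambda>_. 1)"
    using F.ex_homogeneous_not_mem[OF J(3) _ _ F.alg_ideal_wlpa] by blast
  show "\<exists>v\<in>verts F. vtx v \<in> J \<and> vtx v \<notin> wlpa_ideal K F (\<lambda>_. 1)"
  proof (rule W.ex_vertex_in_ideal[OF J(1,2) d])
    show "sum_list (map letter_deg w) = d" if "w \<in> Poly_Mapping.keys (hom_comp word_deg d f)" for w
      using that by (simp add: keys_hom_comp word_deg_def)
    show "additive_deg letter_deg" by (simp add: additive_deg_def)
    show "sum_list (map letter_deg (edge_word es)) \<noteq> 0" if "es \<noteq> []" for es
      using sum_list_single_nonzero[OF that, of "\<lambda>_. 1"] by (simp add: edge_word_def comp_def)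
  qed
qed

text \<open>
  Arcs of the associated graph never leave the weight forest, so a closed walk lies inside the forest
  or avoids it, and all its arcs have degrees of the same sign.
\<close>

lemma cycle_deg_nonzero:
  assumes walk: "F.awalk v es v" and ne: "es \<noteq> []"
  shows "sum_list (map (letter_deg \<circ> unflip) (edge_word es)) \<noteq> 0"
proof -
  have stay: "F.awalk v es u \<Longrightarrow> v \<in> Fo \<Longrightarrow> u \<in> Fo \<and> (\<forall>a\<in>set es. tail E (fst a) \<in> Fo)" for v es u
  proof (induction es arbitrary: v)
    case (Cons a es)
    obtain \<alpha> i where a: "a = (\<alpha>, i)" by (metis surj_pair)
    have "tail F a = v" "F.awalk (head F a) es u"
      using Cons.prems(1) by (auto simp: F.awalk_simps)
    moreover from this(1) have "tail E \<alpha> \<in> Fo" "head F a \<in> Fo"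
      using Cons.prems(2) by (auto simp: a split: if_splits)
    ultimately show ?case
      using Cons.IH a by auto
  qed (auto simp: F.awalk_Nil_iff)
  \<comment> \<open>By \<open>stay\<close>, a walk that ends outside the forest has never been
    inside it.\<close>
  have off: "F.awalk v es u \<Longrightarrow> u \<notin> Fo \<Longrightarrow> \<forall>a\<in>set es. tail E (fst a) \<notin> Fo" for v es u
  proof (induction es arbitrary: v)
    case (Cons a es)
    obtain \<alpha> i where a: "a = (\<alpha>, i)" by (metis surj_pair)
    have w: "F.awalk (head F a) es u"
      using Cons.prems(1) by (auto simp: F.awalk_simps)
    then have "head F a \<notin> Fo" using stay Cons.prems(2) by blast
    then have "tail E \<alpha> \<notin> Fo" by (auto simp: a)
    then show ?case
      using Cons.IH[OF w Cons.prems(2)] a by simp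
  qed simp
  show ?thesis
  proof (cases "v \<in> Fo")
    case True
    then have "map (letter_deg \<circ> unflip) (edge_word es) = map (\<lambda>a. - Poly_Mapping.single (snd a) 1) es"
      using stay[OF walk] by (auto simp: edge_word_def)
    moreover have "sum_list (map (\<lambda>a. - Poly_Mapping.single (snd a) (1::int)) es)
        = - sum_list (map (\<lambda>a. Poly_Mapping.single (snd a) 1) es)"
      by (induction es) simp_all
    ultimately show ?thesis
      using sum_list_single_nonzero[OF ne, of snd] by (simp only: neg_equal_0_iff_equal not_False_eq_True)
  next
    case False
    then have "map (letter_deg \<circ> unflip) (edge_word es) = map (\<lambda>a. Poly_Mapping.single (snd a) 1) es"
      using off[OF walk] by (auto simp: edge_word_def)
    then show ?thesis
      using sum_list_single_nonzero[OF ne, of snd] by (simp only: not_False_eq_True)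
  qed
qed

text \<open>The reduction to paths is available in the algebra of \<open>F\<close>, so the ideal and
  a homogeneous element outside the relations are carried there. The element is homogeneous for the
  degree \<open>letter_deg \<circ> unflip\<close>, not necessarily for the standard grading of
  \<open>F\<close>; the vertex that is found is carried back.\<close>

lemma graded_simple_E_iff:
  "graded_simple (degree_group E \<omega>) (wlpa_component K E \<omega>) (wlpa (K::'k::field itself) E \<omega>)
    \<longleftrightarrow> vertex_simple K E \<omega>"
proof (rule graded_simple_iff_vertex_simple)
  fix J assume J: "alg_ideal LE J" "wlpa_ideal K E \<omega> \<subseteq> J" "hom_closed word_deg J" "J \<noteq> wlpa_ideal K E \<omega>"
  let ?WF = "wlpa_ideal K F (\<lambda>_. 1)"
  interpret W: leavitt_quotient F K ?WF by (rule leavitt_quotient_F)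
  let ?J = "{g \<in> word_span LF. rename_word unflip g \<in> J}"
  obtain f0 where "f0 \<in> J" "f0 \<notin> wlpa_ideal K E \<omega>" using J(2,4) by blast
  then obtain d where d: "hom_comp word_deg d f0 \<in> J" "hom_comp word_deg d f0 \<notin> wlpa_ideal K E \<omega>"
    using ex_homogeneous_not_mem[OF J(3) _ _ alg_ideal_wlpa] by blast
  define f where "f = hom_comp word_deg d f0"
  have f: "f \<in> J" "f \<notin> wlpa_ideal K E \<omega>" using d by (simp_all add: f_def)
  have fs: "f \<in> word_span LE" by (rule alg_ideal_subset[OF J(1) f(1)])
  have unflip_f: "rename_word unflip (rename_word flip f) = f"
    by (rule rename_word_inverse[OF _ fs]) (rule unflip_flip)
  have WF: "rename_word unflip g \<in> wlpa_ideal K E \<omega>" if "g \<in> ?WF" for g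
    using unflip_generated[of "{}" g K] that by (simp add: wlpa_ideal_def)
  have "\<exists>v\<in>verts F. vtx v \<in> ?J \<and> vtx v \<notin> ?WF"
  proof (rule W.ex_vertex_in_ideal)
    show "alg_ideal LF ?J" by (rule alg_ideal_vimage[OF J(1) unflip_letters])
    show "?WF \<subseteq> ?J" using WF J(2) alg_ideal_subset[OF F.alg_ideal_wlpa] by blast
    show "rename_word flip f \<in> ?J"
      using f(1) by (simp add: unflip_f rename_word_word_span[OF flip_letters fs])
    show "rename_word flip f \<notin> ?WF"
      using WF[of "rename_word flip f"] f(2) by (auto simp: unflip_f)
    show "additive_deg (letter_deg \<circ> unflip)" by (simp add: additive_deg_def)
    show "sum_list (map (letter_deg \<circ> unflip) u) = d" if u: "u \<in> Poly_Mapping.keys (rename_word flip f)" for u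
    proof -
      obtain w where w: "w \<in> Poly_Mapping.keys f" "u = map flip w"
        using keys_rename_word[of flip f] u by blast
      have "map (letter_deg \<circ> unflip) u = map letter_deg w"
        by (simp add: w(2) unflip_flip comp_def)
      then show ?thesis
        using w(1) by (simp add: f_def keys_hom_comp word_deg_def)
    qed
  qed (rule cycle_deg_nonzero)
  then obtain v where v: "v \<in> verts E" "vtx v \<in> ?J" "vtx v \<notin> ?WF" by auto
  have "vtx v \<notin> wlpa_ideal K E \<omega>"
    using flip_generated[of "{}" "vtx v" K] v(3) by (auto simp: wlpa_ideal_def vtx_def)
  moreover have "vtx v \<in> J"
    using v(2) by (simp add: vtx_def)
  ultimately show "\<exists>v\<in>verts E. vtx v \<in> J \<and> vtx v \<notin> wlpa_ideal K E \<omega>"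
    using v(1) by blast
qed

end

theorem theorem35:
  fixes E :: "('v, 'e) pre_digraph" and \<omega> :: "'e \<Rightarrow> nat" and K :: "'k::field itself"
  assumes "weighted_graph E \<omega>"
    and "row_finite E"
    and "weighted_vertices E \<omega> \<noteq> {}"
  defines "F \<equiv> assoc_graph E \<omega>" and "\<omega>\<^sub>F \<equiv> \<lambda>_. 1"
  shows "graded_simple (degree_group E \<omega>) (wlpa_component K E \<omega>) (wlpa K E \<omega>) \<longleftrightarrow>
    reducible E \<omega> \<and> graded_simple (degree_group F \<omega>\<^sub>F) (wlpa_component K F \<omega>\<^sub>F) (wlpa K F \<omega>\<^sub>F)"
proof -
  let ?simple = "graded_simple (degree_group E \<omega>) (wlpa_component K E \<omega>) (wlpa K E \<omega>)"
  have "reducible E \<omega>" if ?simple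
  proof -
    interpret graded_simple_graph E \<omega> K
      using assms(1,2) that by (intro graded_simple_graph.intro graded_simple_graph_axioms.intro)
    show ?thesis by (rule reducible)
  qed
  moreover have "?simple \<longleftrightarrow>
      graded_simple (degree_group F \<omega>\<^sub>F) (wlpa_component K F \<omega>\<^sub>F) (wlpa K F \<omega>\<^sub>F)"
    if "reducible E \<omega>"
  proof -
    interpret reducible_graph E \<omega>
      using assms(1,2) that by (intro reducible_graph.intro reducible_graph_axioms.intro)
    show ?thesis
      unfolding F_def \<omega>\<^sub>F_def graded_simple_E_iff graded_simple_F_iff vertex_simple_F ..
  qed
  ultimately show ?thesis by blast
qed

end
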